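(* Let $(G,N,\theta)_{\mathcal H}$ and $(H,M,\varphi)_{\mathcal H}$ be $\mathcal H$-triples with $(G,N,\theta)_{\mathcal H}\ge_c(H,M,\varphi)_{\mathcal H}$. Let $k,m$ be positive integers, let $\sigma_1,\dots,\sigma_k\in\mathcal H$, and write $\theta_i=\theta^{\sigma_i}$ and $\varphi_i=\varphi^{\sigma_i}$. Suppose that $\theta_i$ and $\theta_j$ are not $G$-conjugate whenever $i\neq j$. Then, with $n=mk$, $\tilde\theta=\theta_1^m\times\cdots\times\theta_k^m\in\mathrm{Irr}(N^n)$ and $\tilde\varphi=\varphi_1^m\times\cdots\times\varphi_k^m\in\mathrm{Irr}(M^n)$, $$((G\wr\mathsf S_n)_{\tilde\theta^{\mathcal H}},N^n,\tilde\theta)_{\mathcal H}\ge_c((H\wr\mathsf S_n)_{\tilde\varphi^{\mathcal H}},M^n,\tilde\varphi)_{\mathcal H}.$$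
   Context: All groups are finite; $p$ is a fixed prime. $\mathbb Q^{\mathrm{ab}}\subseteq\mathbb C$ is generated by all roots of unity, $\mathcal G=\mathrm{Gal}(\mathbb Q^{\mathrm{ab}}/\mathbb Q)$, and $\mathcal H\le\mathcal G$ consists of those $\sigma$ for which there is an integer $f$ with $\sigma(\xi)=\xi^{p^f}$ for all roots of unity $\xi$ of order prime to $p$. For $N\trianglelefteq G$, $\theta\in\mathrm{Irr}(N)$, $g\in G$, $\sigma\in\mathcal G$: $\theta^{g\sigma}(n)=\sigma(\theta(gng^{-1}))$; $A_\theta$ is the stabilizer in $A\le G\times\mathcal G$; $\theta^{\mathcal H}$ the $\mathcal H$-orbit; $G_{\theta^{\mathcal H}}=\{g:\theta^g\in\theta^{\mathcal H}\}$. $(G,N,\theta)_{\mathcal H}$ is an $\mathcal H$-triple if $N\trianglelefteq G$, $\theta\in\mathrm{Irr}(N)$, $G_{\theta^{\mathcal H}}=G$. $G^n$ is the $n$-fold direct product, $\theta^m=\theta\times\cdots\times\theta$; $\mathsf S_n$ acts on $G^n$ by $(g_1,\dots,g_n)^\omega=(g_{\omega^{-1}(1)},\dots,g_{\omega^{-1}(n)})$ and $G\wr\mathsf S_n=G^n\rtimes\mathsf S_n$, in which $N^n$ is normal. Projective representation $\mathcal P$ with factor set $\alpha$: $\mathcal P(x)\mathcal P(y)=\alpha(x,y)\mathcal P(xy)$. For $G$-invariant $\theta$, $\mathcal P$ is associated with $\theta$ if $\mathcal P_N$ affords $\theta$ and $\mathcal P(ng)=\mathcal P(n)\mathcal P(g)$,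 $\mathcal P(gn)=\mathcal P(g)\mathcal P(n)$. $\mathcal Q\sim\mu\mathcal P$ means $\mathcal Q(x)=\mu(x)M^{-1}\mathcal P(x)M$ for a fixed invertible $M$. For $\mathcal P$ associated with $\theta$ on $G_\theta$ with entries in $\mathbb Q^{\mathrm{ab}}$ and $\theta^{x\sigma}=\theta$: $\mathcal P^{x\sigma}(y)=\sigma(\mathcal P(xyx^{-1}))$, and $\mu_{x\sigma}$ is the unique function $G_\theta\to\mathbb C^\times$, constant on $N$-cosets, $\mu_{x\sigma}(1)=1$, with $\mathcal P^{x\sigma}\sim\mu_{x\sigma}\mathcal P$. $(G,N,\theta)_{\mathcal H}\ge_c(H,M,\varphi)_{\mathcal H}$ (both $\mathcal H$-triples, $H\le G$) means: (i) $G=NH$, $N\cap H=M$, $\mathbf C_G(N)\subseteq H$; (ii) $(H\times\mathcal H)_\theta=(H\times\mathcal H)_\varphi$; (iii) there are projective representations $\mathcal P$ of $G_\theta$ associated with $\theta$ and $\mathcal P'$ of $H_\varphi$ associated with $\varphi$, entries in $\mathbb Q^{\mathrm{ab}}$, factor sets with root-of-unity values agreeing on $H_\theta\times H_\theta$, and $\mathcal P(c),\mathcal P'(c)$ the same scalar for all $c\in\mathbf C_G(N)$; (iv) $\mu_a=\mu'_a$ on $H_\theta$ for all $a\in(H\times\mathcal H)_\theta$. *)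

theory Defs
  imports "HOL-Algebra.Algebra" "Jordan_Normal_Form.Matrix" "HOL-Combinatorics.Permutations"
    "HOL-Computational_Algebra.Polynomial"
begin

definition Qab :: "complex set" where
  "Qab = {x. \<exists>n::nat. n > 0 \<and> (\<exists>q :: complex poly. (\<forall>i. coeff q i \<in> \<rat>) \<and>
                 x = poly q (cis (2 * pi / real n)))}"

definition root_of_unity :: "complex \<Rightarrow> bool" where
  "root_of_unity z \<longleftrightarrow> (\<exists>m::nat. m > 0 \<and> z ^ m = 1)"

text \<open>Elements of Gal(Q^ab/Q), represented as functions on the complex numbers which are
  field automorphisms of Q^ab and the identity outside Q^ab (normalisation).\<close>
definition galQab :: "(complex \<Rightarrow> complex) set" where
  "galQab = {\<sigma>. bij_betw \<sigma> Qab Qab \<and>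
      (\<forall>x\<in>Qab. \<forall>y\<in>Qab. \<sigma> (x + y) = \<sigma> x + \<sigma> y \<and> \<sigma> (x * y) = \<sigma> x * \<sigma> y) \<and>
      \<sigma> 1 = 1 \<and> (\<forall>x. x \<notin> Qab \<longrightarrow> \<sigma> x = x)}"

text \<open>\<H>: sigma acts on roots of unity of order prime to p as xi |-> xi^(p^f), f an integer
  (for negative f this means sigma(xi)^(p^(-f)) = xi).\<close>
definition Hgal :: "nat \<Rightarrow> (complex \<Rightarrow> complex) set" where
  "Hgal p = {\<sigma> \<in> galQab. \<exists>f::int. \<forall>\<xi> m. m > 0 \<and> coprime m p \<and> \<xi> ^ m = 1 \<longrightarrow>
        (if f \<ge> 0 then \<sigma> \<xi> = \<xi> ^ (p ^ nat f) else (\<sigma> \<xi>) ^ (p ^ nat (- f)) = \<xi>)}"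

definition mtrace :: "complex mat \<Rightarrow> complex" where
  "mtrace A = (\<Sum>i<dim_row A. A $$ (i, i))"

definition is_rep :: "('a, 'b) monoid_scheme \<Rightarrow> 'a set \<Rightarrow> nat \<Rightarrow> ('a \<Rightarrow> complex mat) \<Rightarrow> bool" where
  "is_rep \<Gamma> K d \<rho> \<longleftrightarrow> (\<forall>x\<in>K. \<rho> x \<in> carrier_mat d d) \<and> \<rho> \<one>\<^bsub>\<Gamma>\<^esub> = 1\<^sub>m d \<and>
      (\<forall>x\<in>K. \<forall>y\<in>K. \<rho> (x \<otimes>\<^bsub>\<Gamma>\<^esub> y) = \<rho> x * \<rho> y)"

definition is_subspace :: "nat \<Rightarrow> complex vec set \<Rightarrow> bool" where
  "is_subspace d W \<longleftrightarrow> W \<subseteq> carrier_vec d \<and> 0\<^sub>v d \<in> W \<and>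
      (\<forall>v\<in>W. \<forall>w\<in>W. v + w \<in> W) \<and> (\<forall>c. \<forall>v\<in>W. c \<cdot>\<^sub>v v \<in> W)"

definition irred_rep :: "('a, 'b) monoid_scheme \<Rightarrow> 'a set \<Rightarrow> nat \<Rightarrow> ('a \<Rightarrow> complex mat) \<Rightarrow> bool" where
  "irred_rep \<Gamma> K d \<rho> \<longleftrightarrow> is_rep \<Gamma> K d \<rho> \<and> d > 0 \<and>
      (\<forall>W. is_subspace d W \<and> (\<forall>x\<in>K. \<forall>v\<in>W. \<rho> x *\<^sub>v v \<in> W) \<longrightarrow>
           W = {0\<^sub>v d} \<or> W = carrier_vec d)"

definition afforded :: "'a set \<Rightarrow> ('a \<Rightarrow> complex mat) \<Rightarrow> 'a \<Rightarrow> complex" where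
  "afforded K \<rho> = (\<lambda>x. if x \<in> K then mtrace (\<rho> x) else 0)"

definition Irr :: "('a, 'b) monoid_scheme \<Rightarrow> 'a set \<Rightarrow> ('a \<Rightarrow> complex) set" where
  "Irr \<Gamma> K = {\<chi>. \<exists>d \<rho>. irred_rep \<Gamma> K d \<rho> \<and> \<chi> = afforded K \<rho>}"

definition char_act :: "('a, 'b) monoid_scheme \<Rightarrow> 'a set \<Rightarrow> ('a \<Rightarrow> complex) \<Rightarrow> 'a
      \<Rightarrow> (complex \<Rightarrow> complex) \<Rightarrow> 'a \<Rightarrow> complex" where
  "char_act \<Gamma> N \<theta> g \<sigma> = (\<lambda>n. if n \<in> N then \<sigma> (\<theta> (g \<otimes>\<^bsub>\<Gamma>\<^esub> n \<otimes>\<^bsub>\<Gamma>\<^esub> inv\<^bsub>\<Gamma>\<^esub> g)) else 0)"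

definition Horbit :: "nat \<Rightarrow> ('a, 'b) monoid_scheme \<Rightarrow> 'a set \<Rightarrow> ('a \<Rightarrow> complex) \<Rightarrow> ('a \<Rightarrow> complex) set" where
  "Horbit p \<Gamma> N \<theta> = {char_act \<Gamma> N \<theta> \<one>\<^bsub>\<Gamma>\<^esub> \<sigma> | \<sigma>. \<sigma> \<in> Hgal p}"

definition stab :: "('a, 'b) monoid_scheme \<Rightarrow> 'a set \<Rightarrow> 'a set \<Rightarrow> ('a \<Rightarrow> complex) \<Rightarrow> 'a set" where
  "stab \<Gamma> K N \<theta> = {g \<in> K. char_act \<Gamma> N \<theta> g id = \<theta>}"

definition stab_orb :: "nat \<Rightarrow> ('a, 'b) monoid_scheme \<Rightarrow> 'a set \<Rightarrow> 'a set \<Rightarrow> ('a \<Rightarrow> complex) \<Rightarrow> 'a set" where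
  "stab_orb p \<Gamma> K N \<theta> = {g \<in> K. char_act \<Gamma> N \<theta> g id \<in> Horbit p \<Gamma> N \<theta>}"

definition Htriple :: "nat \<Rightarrow> ('a, 'b) monoid_scheme \<Rightarrow> 'a set \<Rightarrow> 'a set \<Rightarrow> ('a \<Rightarrow> complex) \<Rightarrow> bool" where
  "Htriple p \<Gamma> K N \<theta> \<longleftrightarrow> subgroup K \<Gamma> \<and> normal N (\<Gamma>\<lparr>carrier := K\<rparr>) \<and>
      \<theta> \<in> Irr \<Gamma> N \<and> stab_orb p \<Gamma> K N \<theta> = K"

definition centraliser :: "('a, 'b) monoid_scheme \<Rightarrow> 'a set \<Rightarrow> 'a set \<Rightarrow> 'a set" where
  "centraliser \<Gamma> K N = {g \<in> K. \<forall>n\<in>N. g \<otimes>\<^bsub>\<Gamma>\<^esub> n = n \<otimes>\<^bsub>\<Gamma>\<^esub> g}"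

definition proj_rep :: "('a, 'b) monoid_scheme \<Rightarrow> 'a set \<Rightarrow> nat \<Rightarrow> ('a \<Rightarrow> complex mat)
      \<Rightarrow> ('a \<Rightarrow> 'a \<Rightarrow> complex) \<Rightarrow> bool" where
  "proj_rep \<Gamma> K d P \<alpha> \<longleftrightarrow> (\<forall>x\<in>K. P x \<in> carrier_mat d d \<and> invertible_mat (P x)) \<and>
      (\<forall>x\<in>K. \<forall>y\<in>K. P x * P y = \<alpha> x y \<cdot>\<^sub>m P (x \<otimes>\<^bsub>\<Gamma>\<^esub> y))"

text \<open>P (on K, which contains N and stabilises theta) is associated with theta.\<close>
definition associated :: "('a, 'b) monoid_scheme \<Rightarrow> 'a set \<Rightarrow> 'a set \<Rightarrow> ('a \<Rightarrow> complex)
      \<Rightarrow> nat \<Rightarrow> ('a \<Rightarrow> complex mat) \<Rightarrow> bool" where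
  "associated \<Gamma> K N \<theta> d P \<longleftrightarrow> is_rep \<Gamma> N d P \<and> afforded N P = \<theta> \<and>
      (\<forall>n\<in>N. \<forall>g\<in>K. P (n \<otimes>\<^bsub>\<Gamma>\<^esub> g) = P n * P g \<and> P (g \<otimes>\<^bsub>\<Gamma>\<^esub> n) = P g * P n)"

definition entries_in_Qab :: "'a set \<Rightarrow> nat \<Rightarrow> ('a \<Rightarrow> complex mat) \<Rightarrow> bool" where
  "entries_in_Qab K d P \<longleftrightarrow> (\<forall>x\<in>K. \<forall>i<d. \<forall>j<d. P x $$ (i, j) \<in> Qab)"

text \<open>mu_(x sigma): the unique function on K (= G_theta), nonzero, constant on N-cosets,
  mu(1) = 1, with P^(x sigma) ~ mu P; extended by 0 outside K.\<close>
definition mu_fun :: "('a, 'b) monoid_scheme \<Rightarrow> 'a set \<Rightarrow> 'a set \<Rightarrow> nat \<Rightarrow> ('a \<Rightarrow> complex mat)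
      \<Rightarrow> 'a \<Rightarrow> (complex \<Rightarrow> complex) \<Rightarrow> 'a \<Rightarrow> complex" where
  "mu_fun \<Gamma> K N d P x \<sigma> = (THE \<mu>. (\<forall>y. y \<notin> K \<longrightarrow> \<mu> y = 0) \<and> (\<forall>y\<in>K. \<mu> y \<noteq> 0) \<and>
      \<mu> \<one>\<^bsub>\<Gamma>\<^esub> = 1 \<and> (\<forall>y\<in>K. \<forall>n\<in>N. \<mu> (n \<otimes>\<^bsub>\<Gamma>\<^esub> y) = \<mu> y) \<and>
      (\<exists>A B. A \<in> carrier_mat d d \<and> B \<in> carrier_mat d d \<and> A * B = 1\<^sub>m d \<and> B * A = 1\<^sub>m d \<and>
         (\<forall>y\<in>K. map_mat \<sigma> (P (x \<otimes>\<^bsub>\<Gamma>\<^esub> y \<otimes>\<^bsub>\<Gamma>\<^esub> inv\<^bsub>\<Gamma>\<^esub> x)) = \<mu> y \<cdot>\<^sub>m (B * P y * A))))"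

definition ge_c :: "nat \<Rightarrow> ('a, 'b) monoid_scheme \<Rightarrow> 'a set \<Rightarrow> 'a set \<Rightarrow> ('a \<Rightarrow> complex)
      \<Rightarrow> 'a set \<Rightarrow> 'a set \<Rightarrow> ('a \<Rightarrow> complex) \<Rightarrow> bool" where
  "ge_c p \<Gamma> G N \<theta> H M \<phi> \<longleftrightarrow>
     Htriple p \<Gamma> G N \<theta> \<and> Htriple p \<Gamma> H M \<phi> \<and> H \<subseteq> G \<and>
     \<comment> \<open>(i)\<close>
     G = N <#>\<^bsub>\<Gamma>\<^esub> H \<and> N \<inter> H = M \<and> centraliser \<Gamma> G N \<subseteq> H \<and>
     \<comment> \<open>(ii)\<close>
     (\<forall>h\<in>H. \<forall>\<sigma>\<in>Hgal p. char_act \<Gamma> N \<theta> h \<sigma> = \<theta> \<longleftrightarrow> char_act \<Gamma> M \<phi> h \<sigma> = \<phi>) \<and>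
     \<comment> \<open>(iii) and (iv)\<close>
     (\<exists>d P \<alpha> d' P' \<alpha>'.
        proj_rep \<Gamma> (stab \<Gamma> G N \<theta>) d P \<alpha> \<and> associated \<Gamma> (stab \<Gamma> G N \<theta>) N \<theta> d P \<and>
        entries_in_Qab (stab \<Gamma> G N \<theta>) d P \<and>
        proj_rep \<Gamma> (stab \<Gamma> H M \<phi>) d' P' \<alpha>' \<and> associated \<Gamma> (stab \<Gamma> H M \<phi>) M \<phi> d' P' \<and>
        entries_in_Qab (stab \<Gamma> H M \<phi>) d' P' \<and>
        (\<forall>x\<in>stab \<Gamma> G N \<theta>. \<forall>y\<in>stab \<Gamma> G N \<theta>. root_of_unity (\<alpha> x y)) \<and>
        (\<forall>x\<in>stab \<Gamma> H M \<phi>. \<forall>y\<in>stab \<Gamma> H M \<phi>. root_of_unity (\<alpha>' x y)) \<and>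
        (\<forall>x\<in>stab \<Gamma> H N \<theta>. \<forall>y\<in>stab \<Gamma> H N \<theta>. \<alpha> x y = \<alpha>' x y) \<and>
        (\<forall>c\<in>centraliser \<Gamma> G N. \<exists>s. P c = s \<cdot>\<^sub>m 1\<^sub>m d \<and> P' c = s \<cdot>\<^sub>m 1\<^sub>m d') \<and>
        (\<forall>h\<in>H. \<forall>\<sigma>\<in>Hgal p. char_act \<Gamma> N \<theta> h \<sigma> = \<theta> \<longrightarrow>
            (\<forall>y\<in>stab \<Gamma> H N \<theta>. mu_fun \<Gamma> (stab \<Gamma> G N \<theta>) N d P h \<sigma> y =
                                 mu_fun \<Gamma> (stab \<Gamma> H M \<phi>) M d' P' h \<sigma> y)))"

text \<open>G wr S_n = G^n \<rtimes> S_n. An element (f, w) stands for the product f w with f in G^n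
  (a function on {0..<n}) and w a permutation of {0..<n}; S_n acts on G^n by
  f^w = (f_(w^-1(0)), ..., f_(w^-1(n-1))), so (f1,w1)(f2,w2) = (f1 f2^(w1), w1 w2).\<close>
definition wreath :: "('a, 'b) monoid_scheme \<Rightarrow> nat \<Rightarrow> ((nat \<Rightarrow> 'a) \<times> (nat \<Rightarrow> nat)) monoid" where
  "wreath G n = \<lparr>carrier = {x. fst x \<in> {..<n} \<rightarrow>\<^sub>E carrier G \<and> snd x permutes {..<n}},
     Group.monoid.mult = (\<lambda>x y. ((\<lambda>i\<in>{..<n}. fst x i \<otimes>\<^bsub>G\<^esub> fst y (inv_into UNIV (snd x) i)), snd x \<circ> snd y)),
     Group.monoid.one = ((\<lambda>i\<in>{..<n}. \<one>\<^bsub>G\<^esub>), id)\<rparr>"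

definition wreath_sub :: "'a set \<Rightarrow> nat \<Rightarrow> ((nat \<Rightarrow> 'a) \<times> (nat \<Rightarrow> nat)) set" where
  "wreath_sub K n = {(f, w). f \<in> {..<n} \<rightarrow>\<^sub>E K \<and> w permutes {..<n}}"

definition base_sub :: "'a set \<Rightarrow> nat \<Rightarrow> ((nat \<Rightarrow> 'a) \<times> (nat \<Rightarrow> nat)) set" where
  "base_sub N n = {(f, id) | f. f \<in> {..<n} \<rightarrow>\<^sub>E N}"

definition prod_char :: "'a set \<Rightarrow> nat \<Rightarrow> nat \<Rightarrow> (nat \<Rightarrow> 'a \<Rightarrow> complex)
      \<Rightarrow> (nat \<Rightarrow> 'a) \<times> (nat \<Rightarrow> nat) \<Rightarrow> complex" where
  "prod_char N m k \<theta>s = (\<lambda>x. if x \<in> base_sub N (m * k)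
        then (\<Prod>i<m * k. \<theta>s (i div m) (fst x i)) else 0)"

end

theory Submission
  imports Defs "Jordan_Normal_Form.Char_Poly" "HOL-Computational_Algebra.Fundamental_Theorem_Algebra"
begin

text \<open>Write \<open>b i\<close> for the block of the coordinate \<open>i\<close>. By non-conjugacy of the \<open>\<theta>\<^sub>i\<close>, the stabiliser of
  the product character consists of the elements \<open>(f, w)\<close> with all \<open>f\<^sub>i \<in> G\<^sub>\<theta>\<close> and \<open>w\<close> preserving
  the blocks. From a projective representation \<open>P\<close> associated with \<open>\<theta>\<close> one obtains one of this
  stabiliser by letting \<open>(f, w)\<close> act as the tensor product of the \<open>\<sigma>\<^bsub>b i\<^esub>(P(f\<^sub>i))\<close> preceded by the
  permutation of the tensor factors by \<open>w\<close>; its factor set is the product of the \<open>\<sigma>\<^bsub>b i\<^esub>(\<alpha>)\<close>. If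
  \<open>(f, w)\<close> and a Galois automorphism \<open>\<tau>\<close> stabilise the product character, then \<open>w\<close> permutes the
  blocks, and comparing all coordinates of a block with its first one expresses the function \<open>\<mu>\<close> of
  the tensor representation by Galois conjugates of values of \<open>\<mu>\<close> and \<open>\<alpha>\<close>. As these agree for the
  two given triples, they agree for the wreath products.\<close>

section \<open>Galois automorphisms of the cyclotomic closure\<close>

text \<open>Irreducibility is a statement about complex subspaces, whereas a Galois automorphism
  acts on \<open>Qab\<close> only, and its extension by the identity is in general not even additive
  on the complex numbers. Invariant subspaces can therefore not be carried along an automorphism.
  The proof replaces irreducibility by the Schur orthogonality relations between matrix entries:
  these are polynomial identities with rational coefficients, hence survive an entrywise
  automorphism, and they multiply under tensor products. For the same reason scalars are compared
  through traces, which lie in \<open>Qab\<close> and determine the scalar because the trace of a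
  projective representation cannot vanish on a whole coset of the normal subgroup. The other
  delicate point is the centraliser of the base group: it can contain nontrivial place permutations
  only if \<open>N\<close> is trivial, and then all degrees are one, so that these permutations act
  as the identity as well.\<close>

lemma Qab_I: "n > 0 \<Longrightarrow> (\<And>i. coeff q i \<in> \<rat>) \<Longrightarrow> x = poly q (cis (2 * pi / real n)) \<Longrightarrow> x \<in> Qab"
  unfolding Qab_def by blast

lemma rational_pcompose_monom:
  fixes q :: "complex poly"
  assumes "\<And>i. coeff q i \<in> \<rat>"
  shows "coeff (q \<circ>\<^sub>p monom 1 k) i \<in> \<rat>"
  using assms
proof (induction q arbitrary: i)
  case 0
  then show ?case by simp
next
  case (pCons a q)
  have q: "coeff q j \<in> \<rat>" for j using pCons.prems[of "Suc j"] by simp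
  have a: "a \<in> \<rat>" using pCons.prems[of 0] by simp
  show ?case
    using pCons.IH[OF q] a
    by (auto simp: pcompose_pCons coeff_pCons coeff_monom_mult split: nat.splits)
qed

text \<open>Both roots of unity are powers of \<open>cis (2 * pi / real (a * b))\<close>, so
  substituting a power of the variable writes the two elements as rational polynomials in one root.
  Closure of \<open>Qab\<close> under sums and products then reduces to adding and multiplying
  polynomials.\<close>

lemma Qab_common:
  assumes "x \<in> Qab" "y \<in> Qab"
  obtains n q r where "n > 0" "\<And>i. coeff q i \<in> \<rat>" "\<And>i. coeff r i \<in> \<rat>"
    "x = poly q (cis (2 * pi / real n))" "y = poly r (cis (2 * pi / real n))"
proof -
  obtain a q where q: "a > 0" "\<And>i. coeff q i \<in> \<rat>" "x = poly q (cis (2 * pi / real a))"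
    using assms(1) unfolding Qab_def by blast
  obtain b r where r: "b > 0" "\<And>i. coeff r i \<in> \<rat>" "y = poly r (cis (2 * pi / real b))"
    using assms(2) unfolding Qab_def by blast
  have 1: "x = poly (q \<circ>\<^sub>p monom 1 b) (cis (2 * pi / real (a * b)))"
    using q r by (simp add: poly_pcompose poly_monom DeMoivre)
  have 2: "y = poly (r \<circ>\<^sub>p monom 1 a) (cis (2 * pi / real (a * b)))"
    using q r by (simp add: poly_pcompose poly_monom DeMoivre)
  show thesis
    by (rule that[OF _ _ _ 1 2]) (use q r in \<open>auto intro: rational_pcompose_monom\<close>)
qed

lemma Qab_add: "x \<in> Qab \<Longrightarrow> y \<in> Qab \<Longrightarrow> x + y \<in> Qab"
  by (erule Qab_common, assumption) (rule Qab_I[where q = "_ + _"], auto)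

lemma Qab_mult: "x \<in> Qab \<Longrightarrow> y \<in> Qab \<Longrightarrow> x * y \<in> Qab"
  by (erule Qab_common, assumption) (rule Qab_I[where q = "_ * _"], auto simp: coeff_mult)

lemma Qab_of_nat: "of_nat k \<in> Qab"
  by (rule Qab_I[of 1 "[:of_nat k:]"]) (auto simp: coeff_pCons split: nat.splits)

lemma Qab_0: "0 \<in> Qab" and Qab_1: "1 \<in> Qab"
  using Qab_of_nat[of 0] Qab_of_nat[of 1] by auto

lemma Qab_sum: "(\<And>i. i \<in> A \<Longrightarrow> f i \<in> Qab) \<Longrightarrow> sum f A \<in> Qab"
  by (induction A rule: infinite_finite_induct) (auto simp: Qab_0 Qab_add)

lemma Qab_prod: "(\<And>i. i \<in> A \<Longrightarrow> f i \<in> Qab) \<Longrightarrow> prod f A \<in> Qab"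
  by (induction A rule: infinite_finite_induct) (auto simp: Qab_1 Qab_mult)

lemma Qab_root_of_unity:
  assumes "root_of_unity z"
  shows "z \<in> Qab"
proof -
  obtain n where n: "n > 0" "z ^ n = 1" using assms unfolding root_of_unity_def by blast
  obtain k where k: "k < n" "z = cis (2 * pi * real k / real n)"
    using bij_betw_roots_unity[OF n(1)] n(2) by (auto simp: bij_betw_def)
  show ?thesis
    by (rule Qab_I[OF n(1), of "monom 1 k"])
       (auto simp: k(2) poly_monom DeMoivre mult_ac)
qed

text \<open>Because elements of \<open>galQab\<close> are the identity off \<open>Qab\<close>, they
  are bijections of all complex numbers, and \<open>inv_into UNIV\<close> serves as their inverse
  without any domain condition.\<close>

lemma galQab_bij:
  assumes "\<sigma> \<in> galQab"
  shows "bij \<sigma>"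
proof -
  have b: "bij_betw \<sigma> Qab Qab" and o: "\<And>x. x \<notin> Qab \<Longrightarrow> \<sigma> x = x"
    using assms by (auto simp: galQab_def)
  have c: "bij_betw \<sigma> (- Qab) (- Qab)"
    using o by (auto simp: bij_betw_def inj_on_def image_iff)
  show ?thesis using bij_betw_combine[OF b c] by simp
qed

section \<open>Arithmetic of a Galois automorphism\<close>

context
  fixes \<sigma> assumes s: "\<sigma> \<in> galQab"
begin

lemma gal_mem: "\<sigma> x \<in> Qab \<longleftrightarrow> x \<in> Qab"
  using s unfolding galQab_def bij_betw_def by auto
lemma gal_inj: "\<sigma> x = \<sigma> y \<longleftrightarrow> x = y"
  using galQab_bij[OF s] by (metis bij_def inj_eq)
lemma gal_add: "x \<in> Qab \<Longrightarrow> y \<in> Qab \<Longrightarrow> \<sigma> (x + y) = \<sigma> x + \<sigma> y"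
  using s unfolding galQab_def by auto
lemma gal_mult: "x \<in> Qab \<Longrightarrow> y \<in> Qab \<Longrightarrow> \<sigma> (x * y) = \<sigma> x * \<sigma> y"
  using s unfolding galQab_def by auto
lemma gal_1: "\<sigma> 1 = 1"
  using s unfolding galQab_def by auto
lemma gal_0: "\<sigma> 0 = 0"
  using gal_add[OF Qab_0 Qab_0] by simp
lemma gal_eq_0: "\<sigma> x = 0 \<longleftrightarrow> x = 0"
  using gal_inj[of x 0] gal_0 by simp
lemma gal_sum: "(\<And>i. i \<in> A \<Longrightarrow> f i \<in> Qab) \<Longrightarrow> \<sigma> (sum f A) = (\<Sum>i\<in>A. \<sigma> (f i))"
  by (induction A rule: infinite_finite_induct) (auto simp: gal_0 gal_add Qab_sum)
lemma gal_prod: "(\<And>i. i \<in> A \<Longrightarrow> f i \<in> Qab) \<Longrightarrow> \<sigma> (prod f A) = (\<Prod>i\<in>A. \<sigma> (f i))"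
  by (induction A rule: infinite_finite_induct) (auto simp: gal_1 gal_mult Qab_prod)
lemma gal_of_nat: "\<sigma> (of_nat k) = of_nat k"
  by (induction k) (auto simp: gal_0 gal_1 gal_add Qab_1 Qab_of_nat)
lemma gal_power: "x \<in> Qab \<Longrightarrow> \<sigma> (x ^ k) = \<sigma> x ^ k"
  using gal_prod[of "{..<k}" "\<lambda>_. x"] by simp
lemma gal_root_of_unity: "root_of_unity z \<Longrightarrow> root_of_unity (\<sigma> z)"
  using Qab_root_of_unity[of z] gal_power[of z] gal_1 unfolding root_of_unity_def by metis

end

lemma galQab_id: "id \<in> galQab"
  by (auto simp: galQab_def)

lemma galQab_comp:
  assumes "\<sigma> \<in> galQab" "\<tau> \<in> galQab"
  shows "\<sigma> \<circ> \<tau> \<in> galQab"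
proof -
  have "bij_betw (\<sigma> \<circ> \<tau>) Qab Qab"
    using assms by (auto simp: galQab_def intro: bij_betw_trans)
  then show ?thesis using assms unfolding galQab_def by (auto simp: gal_mem[OF assms(2)])
qed

lemma galQab_inv:
  assumes "\<sigma> \<in> galQab"
  shows "inv_into UNIV \<sigma> \<in> galQab"
proof -
  note b = galQab_bij[OF assms]
  have i: "inv_into UNIV \<sigma> (\<sigma> x) = x" "\<sigma> (inv_into UNIV \<sigma> x) = x" for x
    using b by (auto simp: bij_def surj_f_inv_f)
  have m: "inv_into UNIV \<sigma> x \<in> Qab \<longleftrightarrow> x \<in> Qab" for x
    using gal_mem[OF assms, of "inv_into UNIV \<sigma> x"] i by simp
  have "bij_betw (inv_into UNIV \<sigma>) Qab Qab"
    by (rule bij_betwI[where g = \<sigma>]) (auto simp: m i gal_mem[OF assms])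
  moreover have "inv_into UNIV \<sigma> (x + y) = inv_into UNIV \<sigma> x + inv_into UNIV \<sigma> y" "inv_into UNIV \<sigma> (x * y) = inv_into UNIV \<sigma> x * inv_into UNIV \<sigma> y"
    if "x \<in> Qab" "y \<in> Qab" for x y
    using that gal_add[OF assms, of "inv_into UNIV \<sigma> x" "inv_into UNIV \<sigma> y"] gal_mult[OF assms, of "inv_into UNIV \<sigma> x" "inv_into UNIV \<sigma> y"]
    by (metis i m)+
  moreover have "inv_into UNIV \<sigma> 1 = 1" using i gal_1[OF assms] by metis
  moreover have "inv_into UNIV \<sigma> x = x" if "x \<notin> Qab" for x
    using that i assms unfolding galQab_def by (metis (mono_tags, lifting) mem_Collect_eq)
  ultimately show ?thesis unfolding galQab_def by blast
qed

text \<open>For \<open>z = x / y\<close>, a Bezout relation between \<open>m\<close> and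
  \<open>q\<close> turns \<open>z ^ m = 1\<close> and \<open>z ^ q = 1\<close> into
  \<open>z = 1\<close>. Applied with powers of \<open>p\<close>, it allows them to be cancelled from
  exponents on roots of unity of order prime to \<open>p\<close>.\<close>

lemma power_inj_on_coprime_roots:
  fixes x y :: complex
  assumes "m > 0" "coprime m q" "x ^ m = 1" "y ^ m = 1" "x ^ q = y ^ q"
  shows "x = y"
proof -
  have y0: "y \<noteq> 0" using assms by (auto simp: power_0_left)
  let ?z = "x / y"
  have z: "?z ^ m = 1" "?z ^ q = 1" using assms y0 by (auto simp: power_divide)
  obtain a b where ab: "a * m = b * q + gcd m q"
    using bezout_nat[of m q] assms(1) by (metis mult.commute not_gr0)
  have "?z ^ (a * m) = ?z ^ (b * q) * ?z"
    using ab assms(2) by (simp add: power_add coprime_iff_gcd_eq_1)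
  then have "?z = 1" using z by (simp add: power_mult mult.commute[of a] mult.commute[of b])
  then show ?thesis using y0 by simp
qed

text \<open>The sign distinction in the definition of \<H> disappears if the exponent is written as a
  difference of two natural numbers.\<close>
lemma Hgal_iff:
  assumes p: "Factorial_Ring.prime p"
  shows "\<sigma> \<in> Hgal p \<longleftrightarrow> \<sigma> \<in> galQab \<and>
    (\<exists>a b. \<forall>\<xi> m. m > 0 \<and> coprime m p \<and> \<xi> ^ m = 1 \<longrightarrow> \<sigma> \<xi> ^ (p ^ a) = \<xi> ^ (p ^ b))"
    (is "_ \<longleftrightarrow> _ \<and> ?R")
proof safe
  assume s: "\<sigma> \<in> Hgal p"
  then show "\<sigma> \<in> galQab" by (simp add: Hgal_def)
  from s obtain f :: int where f: "\<And>\<xi> m. m > 0 \<and> coprime m p \<and> \<xi> ^ m = 1 \<Longrightarrow>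
        (if f \<ge> 0 then \<sigma> \<xi> = \<xi> ^ (p ^ nat f) else (\<sigma> \<xi>) ^ (p ^ nat (- f)) = \<xi>)"
    unfolding Hgal_def by blast
  show ?R
  proof (cases "f \<ge> 0")
    case True
    then show ?thesis using f by (intro exI[of _ 0] exI[of _ "nat f"]) auto
  next
    case False
    then show ?thesis using f by (intro exI[of _ "nat (- f)"] exI[of _ 0]) auto
  qed
next
  fix a b assume s: "\<sigma> \<in> galQab"
    and ab: "\<forall>\<xi> m. m > 0 \<and> coprime m p \<and> \<xi> ^ m = 1 \<longrightarrow> \<sigma> \<xi> ^ (p ^ a) = \<xi> ^ (p ^ b)"
  show "\<sigma> \<in> Hgal p"
    unfolding Hgal_def
  proof (intro CollectI conjI s exI[of _ "int b - int a"] allI impI)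
    fix \<xi> :: complex and m :: nat assume m: "m > 0 \<and> coprime m p \<and> \<xi> ^ m = 1"
    then have r: "root_of_unity \<xi>" by (auto simp: root_of_unity_def)
    have sm: "\<sigma> \<xi> ^ m = 1"
      using gal_power[OF s Qab_root_of_unity[OF r], of m] m gal_1[OF s] by simp
    have E: "\<sigma> \<xi> ^ (p ^ a) = \<xi> ^ (p ^ b)" using ab m by blast
    show "if 0 \<le> int b - int a then \<sigma> \<xi> = \<xi> ^ (p ^ nat (int b - int a))
        else \<sigma> \<xi> ^ (p ^ nat (- (int b - int a))) = \<xi>"
    proof (cases "a \<le> b")
      case True
      have "\<sigma> \<xi> = \<xi> ^ (p ^ (b - a))"
      proof (rule power_inj_on_coprime_roots[of m "p ^ a"])
        show "(\<xi> ^ p ^ (b - a)) ^ m = 1" using m by (metis power_mult mult.commute power_one)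
        show "\<sigma> \<xi> ^ p ^ a = (\<xi> ^ p ^ (b - a)) ^ p ^ a"
          using E True by (simp flip: power_mult power_add)
      qed (use m sm in auto)
      then show ?thesis using True by (simp add: nat_diff_distrib)
    next
      case False
      have "\<sigma> \<xi> ^ (p ^ (a - b)) = \<xi>"
      proof (rule power_inj_on_coprime_roots[of m "p ^ b"])
        show "(\<sigma> \<xi> ^ p ^ (a - b)) ^ m = 1" using sm by (metis power_mult mult.commute power_one)
        show "(\<sigma> \<xi> ^ p ^ (a - b)) ^ p ^ b = \<xi> ^ p ^ b"
          using E False by (simp flip: power_mult power_add)
      qed (use m in auto)
      then show ?thesis using False by (simp add: nat_diff_distrib)
    qed
  qed
qed

lemma Hgal_galQab: "\<sigma> \<in> Hgal p \<Longrightarrow> \<sigma> \<in> galQab"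
  by (simp add: Hgal_def)

lemma Hgal_id: "id \<in> Hgal p"
  unfolding Hgal_def by (auto simp: galQab_id intro!: exI[of _ "0::int"])

text \<open>In the form with two exponents these simply add: an automorphism permutes the m-th roots
  of unity, so the relation for \<open>\<sigma>\<close> applies at \<open>\<tau> \<xi>\<close>.
  Inverting an automorphism just swaps the two exponents.\<close>

lemma Hgal_comp:
  assumes p: "Factorial_Ring.prime p" and "\<sigma> \<in> Hgal p" "\<tau> \<in> Hgal p"
  shows "\<sigma> \<circ> \<tau> \<in> Hgal p"
proof -
  obtain a b where s: "\<sigma> \<in> galQab"
    "\<And>\<xi> m. m > 0 \<and> coprime m p \<and> \<xi> ^ m = 1 \<Longrightarrow> \<sigma> \<xi> ^ (p ^ a) = \<xi> ^ (p ^ b)"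
    using assms(2) unfolding Hgal_iff[OF p] by blast
  obtain a' b' where t: "\<tau> \<in> galQab"
    "\<And>\<xi> m. m > 0 \<and> coprime m p \<and> \<xi> ^ m = 1 \<Longrightarrow> \<tau> \<xi> ^ (p ^ a') = \<xi> ^ (p ^ b')"
    using assms(3) unfolding Hgal_iff[OF p] by blast
  show ?thesis
    unfolding Hgal_iff[OF p]
  proof (intro conjI galQab_comp s(1) t(1), rule exI[of _ "a + a'"], rule exI[of _ "b' + b"], intro allI impI)
    fix \<xi> :: complex and m :: nat assume m: "m > 0 \<and> coprime m p \<and> \<xi> ^ m = 1"
    then have r: "root_of_unity \<xi>" by (auto simp: root_of_unity_def)
    have tm: "\<tau> \<xi> ^ m = 1"
      using gal_power[OF t(1) Qab_root_of_unity[OF r], of m] m gal_1[OF t(1)] by simp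
    have "(\<sigma> \<circ> \<tau>) \<xi> ^ p ^ (a + a') = (\<sigma> (\<tau> \<xi>) ^ p ^ a) ^ p ^ a'"
      by (simp add: power_add power_mult)
    also have "\<dots> = (\<tau> \<xi> ^ p ^ a') ^ p ^ b"
      using s(2)[of m "\<tau> \<xi>"] m tm by (simp flip: power_mult add: mult.commute)
    also have "\<dots> = \<xi> ^ p ^ (b' + b)" using t(2)[OF m] by (simp add: power_add power_mult)
    finally show "(\<sigma> \<circ> \<tau>) \<xi> ^ p ^ (a + a') = \<xi> ^ p ^ (b' + b)" .
  qed
qed

lemma Hgal_inv:
  assumes p: "Factorial_Ring.prime p" and "\<sigma> \<in> Hgal p"
  shows "inv_into UNIV \<sigma> \<in> Hgal p"
proof -
  obtain a b where s: "\<sigma> \<in> galQab"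
    "\<And>\<xi> m. m > 0 \<and> coprime m p \<and> \<xi> ^ m = 1 \<Longrightarrow> \<sigma> \<xi> ^ (p ^ a) = \<xi> ^ (p ^ b)"
    using assms(2) unfolding Hgal_iff[OF p] by blast
  note i = galQab_inv[OF s(1)]
  show ?thesis
    unfolding Hgal_iff[OF p]
  proof (intro conjI i, rule exI[of _ b], rule exI[of _ a], intro allI impI)
    fix \<xi> :: complex and m :: nat assume m: "m > 0 \<and> coprime m p \<and> \<xi> ^ m = 1"
    then have r: "root_of_unity \<xi>" by (auto simp: root_of_unity_def)
    have tm: "inv_into UNIV \<sigma> \<xi> ^ m = 1"
      using gal_power[OF i Qab_root_of_unity[OF r], of m] m gal_1[OF i] by simp
    show "inv_into UNIV \<sigma> \<xi> ^ p ^ b = \<xi> ^ p ^ a"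
      using s(2)[of m "inv_into UNIV \<sigma> \<xi>"] m tm galQab_bij[OF s(1)] by (simp add: bij_def surj_f_inv_f)
  qed
qed

section \<open>Schur orthogonality\<close>

lemma mult_mat_index:
  assumes "A \<in> carrier_mat n d" "B \<in> carrier_mat d m" "i < n" "l < m"
  shows "(A * B) $$ (i, l) = (\<Sum>j<d. A $$ (i, j) * B $$ (j, l))"
  using assms by (auto simp: scalar_prod_def atLeast0LessThan)

lemma mult_vec_index:
  assumes "A \<in> carrier_mat n d" "v \<in> carrier_vec d" "i < n"
  shows "(A *\<^sub>v v) $ i = (\<Sum>j<d. A $$ (i, j) * v $ j)"
  using assms by (auto simp: scalar_prod_def atLeast0LessThan)

lemma mtrace_eq: "A \<in> carrier_mat d d \<Longrightarrow> mtrace A = (\<Sum>i<d. A $$ (i, i))"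
  by (simp add: mtrace_def)

lemma mtrace_smult: "A \<in> carrier_mat d d \<Longrightarrow> mtrace (c \<cdot>\<^sub>m A) = c * mtrace A"
  by (simp add: mtrace_def sum_distrib_left)

lemma mtrace_mult_commute:
  assumes "A \<in> carrier_mat d d" "B \<in> carrier_mat d d"
  shows "mtrace (A * B) = mtrace (B * A)"
proof -
  have "mtrace (A * B) = (\<Sum>i<d. \<Sum>j<d. A $$ (i, j) * B $$ (j, i))"
    using assms by (simp add: mtrace_eq[of _ d] mult_mat_index[OF assms] del: index_mult_mat)
  also have "\<dots> = (\<Sum>j<d. \<Sum>i<d. B $$ (j, i) * A $$ (i, j))"
    by (subst sum.swap) (simp add: mult.commute)
  also have "\<dots> = mtrace (B * A)"
    using assms by (simp add: mtrace_eq[of _ d] mult_mat_index[OF assms(2,1)] del: index_mult_mat)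
  finally show ?thesis .
qed

lemma mtrace_conj:
  assumes "A \<in> carrier_mat d d" "B \<in> carrier_mat d d" "Y \<in> carrier_mat d d" "A * B = 1\<^sub>m d"
  shows "mtrace (B * Y * A) = mtrace Y"
proof -
  have "mtrace (B * Y * A) = mtrace (A * (B * Y))"
    using assms by (intro mtrace_mult_commute) auto
  also have "A * (B * Y) = Y" using assms by (simp flip: assoc_mult_mat)
  finally show ?thesis .
qed

lemma det_nonzero_inverse:
  fixes Z :: "complex mat"
  assumes "Z \<in> carrier_mat d d" "det Z \<noteq> 0"
  obtains Z' where "Z' \<in> carrier_mat d d" "Z * Z' = 1\<^sub>m d" "Z' * Z = 1\<^sub>m d"
  using det_non_zero_imp_unit[OF assms, of "()"] unfolding Units_def by (auto simp: ring_mat_def)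

lemma mult_scalar_mat:
  fixes A :: "complex mat"
  assumes "A \<in> carrier_mat d d"
  shows "A * (c \<cdot>\<^sub>m 1\<^sub>m d) = c \<cdot>\<^sub>m A" "(c \<cdot>\<^sub>m 1\<^sub>m d) * A = c \<cdot>\<^sub>m A"
  using assms by (simp_all add: mult_smult_distrib[of _ d d _ d] mult_smult_assoc_mat[of _ d d _ d])

lemma one_mat_nonzero: "d > 0 \<Longrightarrow> (1\<^sub>m d :: complex mat) \<noteq> 0\<^sub>m d d"
  by (metis index_one_mat(1) index_zero_mat(1) zero_neq_one)

text \<open>The kernel of \<open>Z\<close> is invariant under \<open>\<rho>\<close>, so it is zero
  or everything; in the latter case \<open>Z\<close> kills every unit vector and is zero.\<close>

lemma schur_invertible:
  assumes irr: "irred_rep \<Gamma> N d \<rho>"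
    and \<rho>': "\<And>n. n \<in> N \<Longrightarrow> \<rho>' n \<in> carrier_mat d d"
    and Z: "Z \<in> carrier_mat d d" "Z \<noteq> 0\<^sub>m d d"
    and comm: "\<And>n. n \<in> N \<Longrightarrow> \<rho>' n * Z = Z * \<rho> n"
  shows "det Z \<noteq> 0"
proof
  assume "det Z = 0"
  then obtain v where v: "v \<in> carrier_vec d" "v \<noteq> 0\<^sub>v d" "Z *\<^sub>v v = 0\<^sub>v d"
    using det_0_iff_vec_prod_zero_field[OF Z(1)] by auto
  define W where "W = {v \<in> carrier_vec d. Z *\<^sub>v v = 0\<^sub>v d}"
  have \<rho>: "\<rho> n \<in> carrier_mat d d" if "n \<in> N" for n
    using irr that by (auto simp: irred_rep_def is_rep_def)
  have "is_subspace d W"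
    using Z(1) unfolding is_subspace_def W_def
    by (auto simp: mult_add_distrib_mat_vec mult_mat_vec)
  moreover have "\<rho> n *\<^sub>v u \<in> W" if n: "n \<in> N" and u: "u \<in> W" for n u
  proof -
    have u': "u \<in> carrier_vec d" "Z *\<^sub>v u = 0\<^sub>v d" using u by (auto simp: W_def)
    have "Z *\<^sub>v (\<rho> n *\<^sub>v u) = (Z * \<rho> n) *\<^sub>v u"
      using assoc_mult_mat_vec[OF Z(1) \<rho>[OF n] u'(1)] by simp
    also have "\<dots> = \<rho>' n *\<^sub>v (Z *\<^sub>v u)"
      using assoc_mult_mat_vec[OF \<rho>'[OF n] Z(1) u'(1)] comm[OF n] by simp
    also have "\<dots> = 0\<^sub>v d" using u' \<rho>'[OF n] by (intro eq_vecI) auto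
    finally show ?thesis using \<rho>[OF n] u' by (auto simp: W_def)
  qed
  ultimately have "W = {0\<^sub>v d} \<or> W = carrier_vec d"
    using irr unfolding irred_rep_def by blast
  moreover have "v \<in> W" using v by (simp add: W_def)
  ultimately have W: "W = carrier_vec d" using v by auto
  have "Z $$ (i, j) = 0" if "i < d" "j < d" for i j
  proof -
    have "unit_vec d j \<in> W" unfolding W by simp
    then have "Z *\<^sub>v unit_vec d j = 0\<^sub>v d" unfolding W_def by blast
    then have "(Z *\<^sub>v unit_vec d j) $ i = 0" using that by simp
    moreover have "(Z *\<^sub>v unit_vec d j) $ i = Z $$ (i, j)"
      using Z(1) that by simp
    ultimately show ?thesis by simp
  qed
  then have "Z = 0\<^sub>m d d" using Z(1) by (intro eq_matI) auto
  with Z(2) show False by simp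
qed

text \<open>A root \<open>c\<close> of the characteristic polynomial exists by the fundamental
  theorem of algebra. Subtracting \<open>c\<close> times the identity from \<open>Z\<close> gives a
  matrix that still commutes with \<open>\<rho>\<close> but has determinant zero, which
  \<open>schur_invertible\<close> allows only for the zero matrix.\<close>

lemma schur_scalar:
  assumes irr: "irred_rep \<Gamma> N d \<rho>"
    and Z: "Z \<in> carrier_mat d d"
    and comm: "\<And>n. n \<in> N \<Longrightarrow> \<rho> n * Z = Z * \<rho> n"
  shows "\<exists>c. Z = c \<cdot>\<^sub>m 1\<^sub>m d"
proof -
  have d: "d > 0" using irr by (simp add: irred_rep_def)
  have \<rho>: "\<rho> n \<in> carrier_mat d d" if "n \<in> N" for n
    using irr that by (auto simp: irred_rep_def is_rep_def)
  have "\<not> constant (poly (char_poly Z))"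
    using d degree_monic_char_poly[OF Z] by (simp add: constant_degree)
  then obtain c where c0: "poly (char_poly Z) c = 0"
    using fundamental_theorem_of_algebra by blast
  have e: "char_matrix Z c = Z - c \<cdot>\<^sub>m 1\<^sub>m d"
    using Z unfolding char_matrix_def by (intro eq_matI) auto
  then have c: "det (Z - c \<cdot>\<^sub>m 1\<^sub>m d) = 0"
    using eigenvalue_root_char_poly[OF Z, of c] eigenvalue_det[OF Z, of c] e c0 by metis
  let ?D = "Z - c \<cdot>\<^sub>m 1\<^sub>m d"
  have "?D = 0\<^sub>m d d"
  proof (rule ccontr)
    assume "?D \<noteq> 0\<^sub>m d d"
    moreover have "\<rho> n * ?D = ?D * \<rho> n" if "n \<in> N" for n
      using \<rho>[OF that] Z comm[OF that]
      by (simp add: mult_minus_distrib_mat[of _ d d] minus_mult_distrib_mat[of _ d d] mult_scalar_mat)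
    ultimately show False
      using schur_invertible[where Z = ?D and \<rho>' = \<rho>, OF irr \<rho> minus_carrier_mat] Z c by auto
  qed
  then have "(Z - c \<cdot>\<^sub>m 1\<^sub>m d) $$ (i, j) = 0" if "i < d" "j < d" for i j
    using that by simp
  then have "Z = c \<cdot>\<^sub>m 1\<^sub>m d"
    using Z by (intro eq_matI) auto
  then show ?thesis by blast
qed

text \<open>Schur orthogonality of matrix coefficients, written with \<open>\<rho>\<close> at the
  inverse of \<open>n\<close> instead of a complex conjugate and with \<open>d\<close> cleared from
  the denominator. It is then a rational polynomial identity in the entries, compatible with Galois
  automorphisms and with products over tensor factors.\<close>

definition ortho :: "('a, 'b) monoid_scheme \<Rightarrow> 'a set \<Rightarrow> nat \<Rightarrow> ('a \<Rightarrow> complex mat) \<Rightarrow> bool" where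
  "ortho \<Gamma> N d \<rho> \<longleftrightarrow> (\<forall>i<d. \<forall>j<d. \<forall>k<d. \<forall>l<d.
     of_nat d * (\<Sum>n\<in>N. \<rho> n $$ (i, j) * \<rho> (inv\<^bsub>\<Gamma>\<^esub> n) $$ (k, l)) =
       (if i = l \<and> j = k then of_nat (card N) else 0))"

section \<open>Averaging over a finite subgroup\<close>

locale finite_subgroup = group \<Gamma> for N and \<Gamma> (structure) +
  assumes N_subgroup: "subgroup N \<Gamma>" and finite_N: "finite N"
begin

lemma N_one: "\<one> \<in> N"
  and N_mult [simp]: "x \<in> N \<Longrightarrow> y \<in> N \<Longrightarrow> x \<otimes> y \<in> N"
  and N_inv [simp]: "x \<in> N \<Longrightarrow> inv x \<in> N"
  using N_subgroup by (auto intro: subgroup.m_inv_closed subgroup.m_closed subgroup.one_closed)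

lemma card_pos: "card N > 0"
  using finite_N N_one by (metis card_gt_0_iff emptyE)

lemma N_closed [simp]: "x \<in> N \<Longrightarrow> x \<in> carrier \<Gamma>"
  using subgroup.subset[OF N_subgroup] by blast

lemma rep_one: "is_rep \<Gamma> N d \<rho> \<Longrightarrow> n \<in> N \<Longrightarrow> \<rho> n * \<rho> (inv n) = 1\<^sub>m d \<and> \<rho> (inv n) * \<rho> n = 1\<^sub>m d"
  unfolding is_rep_def by (metis l_inv r_inv N_inv N_closed)

lemma sum_translate: "m \<in> N \<Longrightarrow> (\<Sum>n\<in>N. f (m \<otimes> n)) = (\<Sum>n\<in>N. f n)"
  for f :: "_ \<Rightarrow> complex"
  by (rule sum.reindex_bij_witness[where i = "\<lambda>n. inv m \<otimes> n" and j = "\<lambda>n. m \<otimes> n"])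
     (auto simp flip: m_assoc)

text \<open>The sum over n of \<open>\<rho>' n * E * \<rho> (inv n)\<close>, where E is the matrix
  unit at position (j, k): the usual average that turns a matrix into an intertwiner.\<close>

definition avg where
  "avg d \<rho>' \<rho> j k = mat d d (\<lambda>(i, l). \<Sum>n\<in>N. (\<rho>' n :: complex mat) $$ (i, j) * \<rho> (inv n) $$ (k, l))"

lemma avg_intertwines:
  assumes r: "is_rep \<Gamma> N d \<rho>'" "is_rep \<Gamma> N d \<rho>" and "j < d" "k < d" and m: "m \<in> N"
  shows "\<rho>' m * avg d \<rho>' \<rho> j k = avg d \<rho>' \<rho> j k * \<rho> m"
proof (rule eq_matI)
  have c: "\<rho> n \<in> carrier_mat d d" "\<rho>' n \<in> carrier_mat d d" if "n \<in> N" for n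
    using r that by (auto simp: is_rep_def)
  have av: "avg d \<rho>' \<rho> j k \<in> carrier_mat d d" by (simp add: avg_def)
  show "dim_row (\<rho>' m * avg d \<rho>' \<rho> j k) = dim_row (avg d \<rho>' \<rho> j k * \<rho> m)"
    "dim_col (\<rho>' m * avg d \<rho>' \<rho> j k) = dim_col (avg d \<rho>' \<rho> j k * \<rho> m)"
    using c[OF m] av by auto
  fix i l assume "i < dim_row (avg d \<rho>' \<rho> j k * \<rho> m)" "l < dim_col (avg d \<rho>' \<rho> j k * \<rho> m)"
  then have il: "i < d" "l < d" using c[OF m] av by auto
  have "(\<rho>' m * avg d \<rho>' \<rho> j k) $$ (i, l) =
      (\<Sum>a<d. \<rho>' m $$ (i, a) * (\<Sum>n\<in>N. \<rho>' n $$ (a, j) * \<rho> (inv n) $$ (k, l)))"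
    using mult_mat_index[OF c(2)[OF m] av il] il by (simp add: avg_def)
  also have "\<dots> = (\<Sum>n\<in>N. (\<Sum>a<d. \<rho>' m $$ (i, a) * \<rho>' n $$ (a, j)) * \<rho> (inv n) $$ (k, l))"
    by (simp add: sum_distrib_left sum_distrib_right mult.assoc) (rule sum.swap)
  also have "\<dots> = (\<Sum>n\<in>N. \<rho>' (m \<otimes> n) $$ (i, j) * \<rho> (inv n) $$ (k, l))"
    using r(1) m assms(3) il by (intro sum.cong refl)
      (simp add: mult_mat_index[OF c(2)[OF m] c(2), symmetric] is_rep_def del: index_mult_mat)
  \<comment> \<open>\<open>inv n\<close> is rewritten as
    \<open>inv (m \<otimes> n) \<otimes> m\<close>, so that the summation variable occurs only
    through \<open>m \<otimes> n\<close> and the translation can be undone.\<close>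
  also have "\<dots> = (\<Sum>n\<in>N. \<rho>' (m \<otimes> n) $$ (i, j) * \<rho> (inv (m \<otimes> n) \<otimes> m) $$ (k, l))"
    using m by (intro sum.cong refl) (simp add: inv_mult_group m_assoc)
  also have "\<dots> = (\<Sum>n\<in>N. \<rho>' n $$ (i, j) * \<rho> (inv n \<otimes> m) $$ (k, l))"
    using sum_translate[OF m, of "\<lambda>n. \<rho>' n $$ (i, j) * \<rho> (inv n \<otimes> m) $$ (k, l)"] .
  also have "\<dots> = (\<Sum>n\<in>N. \<rho>' n $$ (i, j) * (\<Sum>a<d. \<rho> (inv n) $$ (k, a) * \<rho> m $$ (a, l)))"
    using r(2) m assms(4) il by (intro sum.cong refl)
      (simp add: mult_mat_index[OF c(1) c(1)[OF m], symmetric] is_rep_def del: index_mult_mat)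
  also have "\<dots> = (\<Sum>a<d. (\<Sum>n\<in>N. \<rho>' n $$ (i, j) * \<rho> (inv n) $$ (k, a)) * \<rho> m $$ (a, l))"
    by (simp add: sum_distrib_left sum_distrib_right mult.assoc) (rule sum.swap)
  also have "\<dots> = (avg d \<rho>' \<rho> j k * \<rho> m) $$ (i, l)"
    using mult_mat_index[OF av c(1)[OF m] il] il by (simp add: avg_def)
  finally show "(\<rho>' m * avg d \<rho>' \<rho> j k) $$ (i, l) = (avg d \<rho>' \<rho> j k * \<rho> m) $$ (i, l)" .
qed

text \<open>The average of the matrix unit at (j, k) is a scalar \<open>z\<close>, and its trace
  shows that \<open>d * z\<close> is \<open>card N\<close> for j = k and zero otherwise. The
  hypothesis is a scalar commutant, so that representations known only through their character are
  covered.\<close>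

lemma ortho_if_commutant_scalar:
  assumes r: "is_rep \<Gamma> N d \<rho>"
    and sc: "\<And>Z. Z \<in> carrier_mat d d \<Longrightarrow> (\<And>n. n \<in> N \<Longrightarrow> \<rho> n * Z = Z * \<rho> n) \<Longrightarrow> \<exists>c. Z = c \<cdot>\<^sub>m 1\<^sub>m d"
  shows "ortho \<Gamma> N d \<rho>"
  unfolding ortho_def
proof (intro allI impI)
  fix i j k l assume l: "i < d" "j < d" "k < d" "l < d"
  have c: "\<rho> n \<in> carrier_mat d d" if "n \<in> N" for n
    using r that by (auto simp: is_rep_def)
  obtain z where z: "avg d \<rho> \<rho> j k = z \<cdot>\<^sub>m 1\<^sub>m d"
    using sc[of "avg d \<rho> \<rho> j k"] avg_intertwines[OF r r l(2,3)] by (auto simp: avg_def)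
  have e: "(\<Sum>n\<in>N. \<rho> n $$ (a, j) * \<rho> (inv n) $$ (k, b)) = (if a = b then z else 0)"
    if "a < d" "b < d" for a b
    using arg_cong[OF z, of "\<lambda>A. A $$ (a, b)"] that by (simp add: avg_def)
  have "of_nat d * z = (\<Sum>a<d. \<Sum>n\<in>N. \<rho> n $$ (a, j) * \<rho> (inv n) $$ (k, a))"
    by (simp add: e)
  also have "\<dots> = (\<Sum>n\<in>N. \<Sum>a<d. \<rho> (inv n) $$ (k, a) * \<rho> n $$ (a, j))"
    by (subst sum.swap) (simp add: mult.commute)
  also have "\<dots> = (\<Sum>n\<in>N. (if j = k then 1 else 0))"
  proof (intro sum.cong refl)
    fix n assume n: "n \<in> N"
    have "(\<Sum>a<d. \<rho> (inv n) $$ (k, a) * \<rho> n $$ (a, j)) = (\<rho> (inv n) * \<rho> n) $$ (k, j)"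
      using mult_mat_index[OF c c[OF n] l(3,2)] n by simp
    also have "\<dots> = (if j = k then 1 else 0)" using rep_one[OF r n] l by simp
    finally show "(\<Sum>a<d. \<rho> (inv n) $$ (k, a) * \<rho> n $$ (a, j)) = (if j = k then 1 else 0)" .
  qed
  finally have "of_nat d * z = (if j = k then of_nat (card N) else 0)" by simp
  then show "of_nat d * (\<Sum>n\<in>N. \<rho> n $$ (i, j) * \<rho> (inv n) $$ (k, l)) =
       (if i = l \<and> j = k then of_nat (card N) else 0)"
    using e[OF l(1,4)] by auto
qed

lemma irred_rep_ortho: "irred_rep \<Gamma> N d \<rho> \<Longrightarrow> ortho \<Gamma> N d \<rho>"
  by (rule ortho_if_commutant_scalar, simp add: irred_rep_def, rule schur_scalar)

text \<open>If every average vanished, the inner product of the two characters would be zero,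
  although the orthogonality relations of \<open>\<rho>\<close> give it the value
  \<open>card N\<close>. So some average is nonzero, and Schur's lemma makes it invertible.\<close>

lemma equivalent_if_same_character:
  assumes irr: "irred_rep \<Gamma> N d \<rho>" and r': "is_rep \<Gamma> N d \<rho>'"
    and eq: "\<And>n. n \<in> N \<Longrightarrow> mtrace (\<rho>' n) = mtrace (\<rho> n)"
  obtains C C' where "C \<in> carrier_mat d d" "C' \<in> carrier_mat d d" "C * C' = 1\<^sub>m d" "C' * C = 1\<^sub>m d"
    "\<And>n. n \<in> N \<Longrightarrow> \<rho>' n * C = C * \<rho> n"
proof -
  have d: "d > 0" and r: "is_rep \<Gamma> N d \<rho>" using irr by (auto simp: irred_rep_def)
  have c: "\<rho> n \<in> carrier_mat d d" "\<rho>' n \<in> carrier_mat d d" if "n \<in> N" for n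
    using r r' that by (auto simp: is_rep_def)
  have "\<exists>j<d. \<exists>k<d. avg d \<rho>' \<rho> j k \<noteq> 0\<^sub>m d d"
  proof (rule ccontr)
    assume "\<not> ?thesis"
    then have "avg d \<rho>' \<rho> j k $$ (j, k) = 0" if "j < d" "k < d" for j k
      using that by simp
    then have z: "(\<Sum>n\<in>N. \<rho>' n $$ (j, j) * \<rho> (inv n) $$ (k, k)) = 0" if "j < d" "k < d" for j k
      using that by (simp add: avg_def)
    have "(\<Sum>n\<in>N. mtrace (\<rho> n) * mtrace (\<rho> (inv n))) = (\<Sum>n\<in>N. mtrace (\<rho>' n) * mtrace (\<rho> (inv n)))"
      by (simp add: eq)
    also have "\<dots> = (\<Sum>n\<in>N. \<Sum>j<d. \<Sum>k<d. \<rho>' n $$ (j, j) * \<rho> (inv n) $$ (k, k))"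
      by (intro sum.cong refl) (simp add: mtrace_eq[OF c(1)] mtrace_eq[OF c(2)] sum_product)
    also have "\<dots> = (\<Sum>j<d. \<Sum>k<d. \<Sum>n\<in>N. \<rho>' n $$ (j, j) * \<rho> (inv n) $$ (k, k))"
      by (subst sum.swap, intro sum.cong refl, rule sum.swap)
    also have "\<dots> = 0" by (simp add: z)
    finally have 0: "(\<Sum>n\<in>N. mtrace (\<rho> n) * mtrace (\<rho> (inv n))) = 0" .
    have "of_nat d * (\<Sum>n\<in>N. mtrace (\<rho> n) * mtrace (\<rho> (inv n))) =
        of_nat d * (\<Sum>n\<in>N. \<Sum>j<d. \<Sum>k<d. \<rho> n $$ (j, j) * \<rho> (inv n) $$ (k, k))"
      by (intro arg_cong[where f = "(*) _"] sum.cong refl) (simp add: mtrace_eq[OF c(1)] sum_product)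
    also have "\<dots> = of_nat d * (\<Sum>j<d. \<Sum>k<d. \<Sum>n\<in>N. \<rho> n $$ (j, j) * \<rho> (inv n) $$ (k, k))"
      by (subst sum.swap, intro arg_cong[where f = "(*) _"] sum.cong refl, rule sum.swap)
    also have "\<dots> = (\<Sum>j<d. \<Sum>k<d. of_nat d * (\<Sum>n\<in>N. \<rho> n $$ (j, j) * \<rho> (inv n) $$ (k, k)))"
      by (simp add: sum_distrib_left)
    also have "\<dots> = (\<Sum>j<d. \<Sum>k<d. if j = k then of_nat (card N) else 0)"
      using irred_rep_ortho[OF irr] unfolding ortho_def by (intro sum.cong refl) auto
    also have "\<dots> = of_nat d * of_nat (card N)" by simp
    finally show False using 0 d card_pos by simp
  qed
  then obtain j k where jk: "j < d" "k < d" "avg d \<rho>' \<rho> j k \<noteq> 0\<^sub>m d d" by blast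
  have av: "avg d \<rho>' \<rho> j k \<in> carrier_mat d d" by (simp add: avg_def)
  have "det (avg d \<rho>' \<rho> j k) \<noteq> 0"
    by (rule schur_invertible[OF irr c(2) _ jk(3)]) (auto simp: avg_intertwines[OF r' r jk(1,2)] av)
  then obtain C' where "C' \<in> carrier_mat d d" "avg d \<rho>' \<rho> j k * C' = 1\<^sub>m d" "C' * avg d \<rho>' \<rho> j k = 1\<^sub>m d"
    using det_nonzero_inverse[OF av] by blast
  with avg_intertwines[OF r' r jk(1,2)] show thesis
    by (intro that[of "avg d \<rho>' \<rho> j k" C']) (auto simp: avg_def)
qed

lemma subspace_sum:
  assumes "is_subspace d W" "finite S" "\<And>n. n \<in> S \<Longrightarrow> u n \<in> W"
  shows "vec d (\<lambda>a. \<Sum>n\<in>S. c n * u n $ a) \<in> W"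
  using assms(2,3)
proof (induction S rule: finite_induct)
  case empty
  have "vec d (\<lambda>a. \<Sum>n\<in>{}. c n * u n $ a) = 0\<^sub>v d" by auto
  then show ?case using assms(1) by (simp add: is_subspace_def)
next
  case (insert x S)
  have "vec d (\<lambda>a. \<Sum>n\<in>insert x S. c n * u n $ a) = c x \<cdot>\<^sub>v u x + vec d (\<lambda>a. \<Sum>n\<in>S. c n * u n $ a)"
    using insert.hyps insert.prems[of x] assms(1)
    by (intro eq_vecI) (auto simp: is_subspace_def dest!: subsetD[of W])
  then show ?case using insert assms(1) by (auto simp: is_subspace_def)
qed

text \<open>The relations exhibit every matrix unit as a linear combination of the
  \<open>\<rho> n\<close>, so a nonzero invariant subspace contains all unit vectors. This converse
  returns irreducibility after a Galois twist or a tensor product.\<close>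

lemma irred_if_ortho:
  assumes r: "is_rep \<Gamma> N d \<rho>" and d: "d > 0" and o: "ortho \<Gamma> N d \<rho>"
  shows "irred_rep \<Gamma> N d \<rho>"
  unfolding irred_rep_def
proof (intro conjI allI impI r d)
  fix W assume "is_subspace d W \<and> (\<forall>x\<in>N. \<forall>v\<in>W. \<rho> x *\<^sub>v v \<in> W)"
  then have W: "is_subspace d W" and inv: "\<And>x v. x \<in> N \<Longrightarrow> v \<in> W \<Longrightarrow> \<rho> x *\<^sub>v v \<in> W" by auto
  have c: "\<rho> n \<in> carrier_mat d d" if "n \<in> N" for n
    using r that by (auto simp: is_rep_def)
  have Wc: "W \<subseteq> carrier_vec d" "0\<^sub>v d \<in> W" using W by (auto simp: is_subspace_def)
  show "W = {0\<^sub>v d} \<or> W = carrier_vec d"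
  proof (cases "W = {0\<^sub>v d}")
    case False
    then obtain v where v: "v \<in> W" "v \<noteq> 0\<^sub>v d" using Wc by blast
    then have vc: "v \<in> carrier_vec d" using Wc by blast
    obtain j where j: "j < d" "v $ j \<noteq> 0" using v(2) vc by (metis eq_vecI carrier_vecD index_zero_vec)
    have e: "unit_vec d i \<in> W" if i: "i < d" for i
    proof -
      \<comment> \<open>Summing \<open>\<rho> n\<close> with the weights
        \<open>d * \<rho> (inv n) $$ (j, i) / card N\<close> gives the matrix unit that sends the
        j-th unit vector to the i-th. Dividing by \<open>v $ j\<close> normalises its value on
        \<open>v\<close>.\<close>
      let ?c = "\<lambda>n. of_nat d * \<rho> (inv n) $$ (j, i) / (of_nat (card N) * v $ j)"
      have "vec d (\<lambda>a. \<Sum>n\<in>N. ?c n * (\<rho> n *\<^sub>v v) $ a) \<in> W"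
        by (rule subspace_sum[OF W finite_N]) (auto intro: inv v)
      moreover have "(\<Sum>n\<in>N. ?c n * (\<rho> n *\<^sub>v v) $ a) = unit_vec d i $ a" if a: "a < d" for a
      proof -
        have "(\<Sum>n\<in>N. ?c n * (\<rho> n *\<^sub>v v) $ a) = (\<Sum>n\<in>N. \<Sum>b<d. ?c n * (\<rho> n $$ (a, b) * v $ b))"
          using a by (intro sum.cong refl) (simp only: mult_vec_index[OF c vc a] sum_distrib_left)
        also have "\<dots> = (\<Sum>b<d. \<Sum>n\<in>N. ?c n * (\<rho> n $$ (a, b) * v $ b))" by (rule sum.swap)
        also have "\<dots> = (\<Sum>b<d. (of_nat d * (\<Sum>n\<in>N. \<rho> n $$ (a, b) * \<rho> (inv n) $$ (j, i))) * (v $ b / (of_nat (card N) * v $ j)))"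
          by (simp add: sum_distrib_left sum_distrib_right mult_ac)
        also have "\<dots> = (\<Sum>b<d. (if a = i \<and> b = j then of_nat (card N) else 0) * (v $ b / (of_nat (card N) * v $ j)))"
          using o a i j unfolding ortho_def by (intro sum.cong refl) auto
        also have "\<dots> = (\<Sum>b<d. if b = j then (if a = i then 1 else 0) else 0)"
          using card_pos j by (intro sum.cong refl) auto
        also have "\<dots> = unit_vec d i $ a" using j a i by simp
        finally show ?thesis .
      qed
      ultimately show ?thesis
        by (metis (no_types, lifting) dim_vec eq_vecI index_unit_vec(3) index_vec)
    qed
    have "x \<in> W" if x: "x \<in> carrier_vec d" for x
    proof -
      have "vec d (\<lambda>a. \<Sum>i<d. x $ i * unit_vec d i $ a) \<in> W"
        by (rule subspace_sum[OF W]) (auto intro: e)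
      also have "vec d (\<lambda>a. \<Sum>i<d. x $ i * unit_vec d i $ a) = x"
        using x by (intro eq_vecI) (auto simp: if_distrib[of "(*) _"] cong: if_cong)
      finally show ?thesis .
    qed
    then show ?thesis using Wc by blast
  qed simp
qed

text \<open>Orthogonality recovers each entry of \<open>Y\<close> from the traces
  \<open>mtrace (Y * \<rho> n)\<close>, so these cannot all vanish. With \<open>Y\<close> a value of
  a projective representation this yields an element of nonzero trace in every coset of
  \<open>N\<close>.\<close>

lemma ortho_trace_nonzero:
  assumes r: "is_rep \<Gamma> N d \<rho>" and o: "ortho \<Gamma> N d \<rho>"
    and Y: "Y \<in> carrier_mat d d" "Y \<noteq> 0\<^sub>m d d"
  shows "\<exists>n\<in>N. mtrace (Y * \<rho> n) \<noteq> 0"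
proof (rule ccontr)
  assume n: "\<not> ?thesis"
  have c: "\<rho> n \<in> carrier_mat d d" if "n \<in> N" for n
    using r that by (auto simp: is_rep_def)
  have t: "(\<Sum>i<d. \<Sum>j<d. Y $$ (i, j) * \<rho> n $$ (j, i)) = 0" if "n \<in> N" for n
  proof -
    have "mtrace (Y * \<rho> n) = 0" using n that by blast
    then show ?thesis using mult_mat_index[OF Y(1) c[OF that]] mtrace_eq[of "Y * \<rho> n" d] Y(1) c[OF that]
      by (simp del: index_mult_mat)
  qed
  have "Y $$ (k, l) = 0" if kl: "k < d" "l < d" for k l
  proof -
    have "0 = of_nat d * (\<Sum>n\<in>N. (\<Sum>i<d. \<Sum>j<d. Y $$ (i, j) * \<rho> n $$ (j, i)) * \<rho> (inv n) $$ (k, l))"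
      by (simp add: t)
    also have "\<dots> = (\<Sum>i<d. \<Sum>j<d. \<Sum>n\<in>N. of_nat d * (Y $$ (i, j) * \<rho> n $$ (j, i) * \<rho> (inv n) $$ (k, l)))"
      unfolding sum_distrib_left sum_distrib_right
      by (subst sum.swap, intro sum.cong refl, rule sum.swap)
    also have "\<dots> = (\<Sum>i<d. \<Sum>j<d. Y $$ (i, j) * (of_nat d * (\<Sum>n\<in>N. \<rho> n $$ (j, i) * \<rho> (inv n) $$ (k, l))))"
      by (simp add: sum_distrib_left mult_ac)
    also have "\<dots> = (\<Sum>i<d. \<Sum>j<d. Y $$ (i, j) * (if j = l \<and> i = k then of_nat (card N) else 0))"
      using o kl unfolding ortho_def by (intro sum.cong refl arg_cong[where f = "(*) _"]) simp
    also have "\<dots> = (\<Sum>i<d. if i = k then (\<Sum>j<d. if j = l then Y $$ (i, j) * of_nat (card N) else 0) else 0)"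
      by (intro sum.cong refl) (auto simp: sum.delta if_distrib[of "(*) _"] cong: if_cong)
    also have "\<dots> = Y $$ (k, l) * of_nat (card N)" using kl by (simp add: sum.delta)
    finally show ?thesis using card_pos by simp
  qed
  then have "Y = 0\<^sub>m d d" using Y(1) by (intro eq_matI) auto
  then show False using Y(2) by simp
qed

text \<open>A representation associated with \<open>\<theta>\<close> is only known to afford
  \<open>\<theta>\<close> on \<open>N\<close>. Being similar to an irreducible representation with
  this character, it inherits the scalar commutant and with it the orthogonality relations.\<close>

lemma ortho_if_irreducible_character:
  assumes irr: "irred_rep \<Gamma> N d0 \<rho>" and r': "is_rep \<Gamma> N d \<rho>'"
    and eq: "\<And>n. n \<in> N \<Longrightarrow> mtrace (\<rho>' n) = mtrace (\<rho> n)"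
  shows "ortho \<Gamma> N d \<rho>'" and "d > 0"
proof -
  \<comment> \<open>The values at the identity are the degrees; once these agree,
    \<open>equivalent_if_same_character\<close> becomes applicable.\<close>
  have "mtrace (\<rho>' \<one>) = mtrace (\<rho> \<one>)" using eq N_one by blast
  then have "of_nat d = (of_nat d0 :: complex)"
    using irr r' by (simp add: irred_rep_def is_rep_def mtrace_def)
  then have dd: "d0 = d" by simp
  then show "d > 0" using irr by (simp add: irred_rep_def)
  from irr dd have irr: "irred_rep \<Gamma> N d \<rho>" by simp
  obtain C C' where C: "C \<in> carrier_mat d d" "C' \<in> carrier_mat d d" "C * C' = 1\<^sub>m d" "C' * C = 1\<^sub>m d"
    "\<And>n. n \<in> N \<Longrightarrow> \<rho>' n * C = C * \<rho> n"
    using equivalent_if_same_character[OF irr r' eq] by blast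
  have c: "\<rho> n \<in> carrier_mat d d" "\<rho>' n \<in> carrier_mat d d" if "n \<in> N" for n
    using irr r' that by (auto simp: irred_rep_def is_rep_def)
  have C5': "C' * \<rho>' n = \<rho> n * C'" if n: "n \<in> N" for n
  proof -
    have "C' * \<rho>' n = C' * \<rho>' n * (C * C')" using C c[OF n] by simp
    also have "\<dots> = C' * (\<rho>' n * C) * C'" using C(1,2) c[OF n] by (simp add: assoc_mult_mat[of _ d d _ d _ d])
    also have "\<dots> = C' * C * \<rho> n * C'" using C(1,2) C(5)[OF n] c[OF n] by (simp add: assoc_mult_mat[of _ d d _ d _ d])
    finally show ?thesis using C c[OF n] by simp
  qed
  show "ortho \<Gamma> N d \<rho>'"
  proof (rule ortho_if_commutant_scalar[OF r'])
    fix Z assume Z: "Z \<in> carrier_mat d d" "\<And>n. n \<in> N \<Longrightarrow> \<rho>' n * Z = Z * \<rho>' n"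
    have "\<rho> n * (C' * Z * C) = (C' * Z * C) * \<rho> n" if n: "n \<in> N" for n
    proof -
      have "\<rho> n * (C' * Z * C) = (\<rho> n * C') * Z * C" using C(1,2) Z(1) c[OF n] by (simp add: assoc_mult_mat[of _ d d _ d _ d])
      also have "\<dots> = C' * (\<rho>' n * Z) * C" unfolding C5'[OF n, symmetric]
        using C(1,2) Z(1) c[OF n] by (simp add: assoc_mult_mat[of _ d d _ d _ d])
      also have "\<dots> = C' * Z * (\<rho>' n * C)" unfolding Z(2)[OF n]
        using C(1,2) Z(1) c[OF n] by (simp add: assoc_mult_mat[of _ d d _ d _ d])
      also have "\<dots> = (C' * Z * C) * \<rho> n" unfolding C(5)[OF n]
        using C(1,2) Z(1) c[OF n] by (simp add: assoc_mult_mat[of _ d d _ d _ d])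
      finally show ?thesis .
    qed
    then obtain z where z: "C' * Z * C = z \<cdot>\<^sub>m 1\<^sub>m d"
      using schur_scalar[OF irr, of "C' * Z * C"] C Z by auto
    have "Z = (C * C') * Z * (C * C')" using C Z by simp
    also have "\<dots> = C * (C' * Z * C) * C'" using C(1,2) Z(1) by (simp add: assoc_mult_mat[of _ d d _ d _ d])
    also have "\<dots> = z \<cdot>\<^sub>m 1\<^sub>m d" unfolding z
      using C(1,2,3) by (simp add: mult_scalar_mat mult_smult_assoc_mat[of _ d d _ d])
    finally show "\<exists>c. Z = c \<cdot>\<^sub>m 1\<^sub>m d" by blast
  qed
qed

end

section \<open>Projective representations associated with a character\<close>

definition Qab_mat :: "nat \<Rightarrow> complex mat \<Rightarrow> bool" where
  "Qab_mat d A \<longleftrightarrow> A \<in> carrier_mat d d \<and> (\<forall>i<d. \<forall>j<d. A $$ (i, j) \<in> Qab)"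

lemma Qab_mat_carrier: "Qab_mat d A \<Longrightarrow> A \<in> carrier_mat d d"
  by (simp add: Qab_mat_def)

lemma Qab_mat_mtrace: "Qab_mat d A \<Longrightarrow> mtrace A \<in> Qab"
  by (auto simp: Qab_mat_def mtrace_eq intro!: Qab_sum)

lemma gal_mat_Qab_mat: "\<sigma> \<in> galQab \<Longrightarrow> Qab_mat d A \<Longrightarrow> Qab_mat d (map_mat \<sigma> A)"
  by (auto simp: Qab_mat_def gal_mem)

lemma gal_mat_mult:
  assumes "\<sigma> \<in> galQab" and A: "Qab_mat d A" and B: "Qab_mat d B"
  shows "map_mat \<sigma> (A * B) = map_mat \<sigma> A * map_mat \<sigma> B"
proof (rule eq_matI)
  have c: "A \<in> carrier_mat d d" "B \<in> carrier_mat d d"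
    "map_mat \<sigma> A \<in> carrier_mat d d" "map_mat \<sigma> B \<in> carrier_mat d d"
    using A B by (auto simp: Qab_mat_def)
  show "dim_row (map_mat \<sigma> (A * B)) = dim_row (map_mat \<sigma> A * map_mat \<sigma> B)"
    "dim_col (map_mat \<sigma> (A * B)) = dim_col (map_mat \<sigma> A * map_mat \<sigma> B)"
    using c by auto
  fix i l assume "i < dim_row (map_mat \<sigma> A * map_mat \<sigma> B)" "l < dim_col (map_mat \<sigma> A * map_mat \<sigma> B)"
  then have il: "i < d" "l < d" using c by auto
  have "map_mat \<sigma> (A * B) $$ (i, l) = \<sigma> ((A * B) $$ (i, l))" using c il by simp
  also have "\<dots> = (\<Sum>j<d. \<sigma> (A $$ (i, j) * B $$ (j, l)))"
    unfolding mult_mat_index[OF c(1,2) il]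
    using A B il by (intro gal_sum[OF assms(1)]) (auto simp: Qab_mat_def intro: Qab_mult)
  also have "\<dots> = (\<Sum>j<d. map_mat \<sigma> A $$ (i, j) * map_mat \<sigma> B $$ (j, l))"
    using A B il c by (intro sum.cong refl) (auto simp: Qab_mat_def gal_mult[OF assms(1)])
  also have "\<dots> = (map_mat \<sigma> A * map_mat \<sigma> B) $$ (i, l)"
    using mult_mat_index[OF c(3,4) il] by simp
  finally show "map_mat \<sigma> (A * B) $$ (i, l) = (map_mat \<sigma> A * map_mat \<sigma> B) $$ (i, l)" .
qed

lemma gal_mat_smult:
  "\<sigma> \<in> galQab \<Longrightarrow> Qab_mat d A \<Longrightarrow> c \<in> Qab \<Longrightarrow> map_mat \<sigma> (c \<cdot>\<^sub>m A) = \<sigma> c \<cdot>\<^sub>m map_mat \<sigma> A"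
  by (intro eq_matI) (auto simp: Qab_mat_def gal_mult)

lemma gal_mat_one: "\<sigma> \<in> galQab \<Longrightarrow> map_mat \<sigma> (1\<^sub>m d) = 1\<^sub>m d"
  by (intro eq_matI) (auto simp: gal_0 gal_1)

lemma gal_mat_mtrace: "\<sigma> \<in> galQab \<Longrightarrow> Qab_mat d A \<Longrightarrow> mtrace (map_mat \<sigma> A) = \<sigma> (mtrace A)"
  by (auto simp: Qab_mat_def mtrace_def intro!: gal_sum[symmetric])

lemma root_of_unity_nonzero: "root_of_unity z \<Longrightarrow> z \<noteq> 0"
  by (auto simp: root_of_unity_def power_0_left)

lemma smult_smult_mat: "a \<cdot>\<^sub>m (b \<cdot>\<^sub>m A) = (a * b) \<cdot>\<^sub>m (A :: complex mat)"
  by (intro eq_matI) auto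

lemma one_smult_mat: "1 \<cdot>\<^sub>m A = (A :: complex mat)"
  by (intro eq_matI) auto

lemma smult_mat_cancel:
  fixes A :: "complex mat"
  assumes "a \<cdot>\<^sub>m A = b \<cdot>\<^sub>m A" "A \<in> carrier_mat d d" "A \<noteq> 0\<^sub>m d d"
  shows "a = b"
proof -
  obtain i j where "i < d" "j < d" "A $$ (i, j) \<noteq> 0"
    using assms(2,3) by (metis carrier_matD eq_matI index_zero_mat)
  then show ?thesis using arg_cong[OF assms(1), of "\<lambda>A. A $$ (i, j)"] assms(2) by simp
qed

lemma invertible_nonzero:
  fixes A :: "complex mat"
  assumes "A \<in> carrier_mat d d" "B \<in> carrier_mat d d" "A * B = 1\<^sub>m d" "d > 0"
  shows "A \<noteq> 0\<^sub>m d d"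
  using assms one_mat_nonzero[OF assms(4)] by auto

lemma (in group) inv_mult_cancel_left:
  assumes "x \<in> carrier G" "z \<in> carrier G"
  shows "inv x \<otimes> (x \<otimes> z) = z"
proof -
  have "inv x \<otimes> (x \<otimes> z) = inv x \<otimes> x \<otimes> z"
    using assms m_assoc[of "inv x" x z] by simp
  also have "\<dots> = z" using assms by simp
  finally show ?thesis .
qed

lemma (in group) conj_mult:
  assumes "x \<in> carrier G" "y \<in> carrier G" "z \<in> carrier G"
  shows "x \<otimes> (y \<otimes> z) \<otimes> inv x = (x \<otimes> y \<otimes> inv x) \<otimes> (x \<otimes> z \<otimes> inv x)"
  using assms by (simp add: m_assoc inv_mult_cancel_left)

text \<open>A projective representation of \<open>K\<close> associated with an irreducible character
  of \<open>N\<close>. The character appears only as the trace on \<open>N\<close>, and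
  irreducibility only as \<open>orth\<close>. In this form the axioms are stable under automorphisms
  of \<open>Qab\<close>, under conjugation by elements normalising \<open>K\<close> and
  \<open>N\<close>, and under tensor products.\<close>

locale assoc_rep = group \<Gamma> for \<Gamma> (structure) +
  fixes K N :: "'a set" and P :: "'a \<Rightarrow> complex mat" and \<alpha> :: "'a \<Rightarrow> 'a \<Rightarrow> complex" and d :: nat
  assumes K_sub: "subgroup K \<Gamma>" and N_sub: "subgroup N \<Gamma>" and N_K: "N \<subseteq> K" and fin: "finite N"
    and conj_N: "k \<in> K \<Longrightarrow> n \<in> N \<Longrightarrow> k \<otimes> n \<otimes> inv k \<in> N"
    and P_Qab: "x \<in> K \<Longrightarrow> Qab_mat d (P x)"
    and P_mult: "x \<in> K \<Longrightarrow> y \<in> K \<Longrightarrow> P x * P y = \<alpha> x y \<cdot>\<^sub>m P (x \<otimes> y)"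
    and P_one: "P \<one> = 1\<^sub>m d"
    and P_left: "n \<in> N \<Longrightarrow> g \<in> K \<Longrightarrow> P (n \<otimes> g) = P n * P g"
    and P_right: "n \<in> N \<Longrightarrow> g \<in> K \<Longrightarrow> P (g \<otimes> n) = P g * P n"
    and root: "x \<in> K \<Longrightarrow> y \<in> K \<Longrightarrow> root_of_unity (\<alpha> x y)"
    and orth: "ortho \<Gamma> N d P" and d_pos: "d > 0"
begin

sublocale finite_subgroup N \<Gamma>
  using N_sub fin by (simp add: finite_subgroup_def finite_subgroup_axioms_def is_group)

lemma K_closed: "x \<in> K \<Longrightarrow> x \<in> carrier \<Gamma>"
  using subgroup.subset[OF K_sub] by blast
lemma K_one: "\<one> \<in> K"
  by (rule subgroup.one_closed[OF K_sub])
lemma K_mult: "x \<in> K \<Longrightarrow> y \<in> K \<Longrightarrow> x \<otimes> y \<in> K"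
  by (rule subgroup.m_closed[OF K_sub])
lemma K_inv: "x \<in> K \<Longrightarrow> inv x \<in> K"
  by (rule subgroup.m_inv_closed[OF K_sub])
lemma N_in_K: "n \<in> N \<Longrightarrow> n \<in> K"
  using N_K by blast

lemma P_carrier: "x \<in> K \<Longrightarrow> P x \<in> carrier_mat d d"
  using P_Qab Qab_mat_carrier by blast

lemma rep: "is_rep \<Gamma> N d P"
  unfolding is_rep_def using P_carrier P_one P_left N_in_K by blast

lemma irred: "irred_rep \<Gamma> N d P"
  using irred_if_ortho[OF rep d_pos orth] .

text \<open>\<open>P x * P (inv x)\<close> and \<open>P (inv x) * P x\<close> are nonzero scalars, a
  priori different ones. Dividing by each gives a right and a left inverse, which coincide by
  associativity.\<close>

lemma P_invertible:
  assumes x: "x \<in> K"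
  obtains Y where "Y \<in> carrier_mat d d" "P x * Y = 1\<^sub>m d" "Y * P x = 1\<^sub>m d"
proof -
  let ?x = "inv x"
  have a: "\<alpha> x ?x \<noteq> 0" "\<alpha> ?x x \<noteq> 0" using root K_inv x root_of_unity_nonzero by auto
  have e: "P x * P ?x = \<alpha> x ?x \<cdot>\<^sub>m 1\<^sub>m d" "P ?x * P x = \<alpha> ?x x \<cdot>\<^sub>m 1\<^sub>m d"
    using P_mult x K_inv[OF x] K_closed[OF x] P_one by (auto simp: r_inv l_inv)
  note c = P_carrier[OF x] P_carrier[OF K_inv[OF x]]
  let ?Y = "(1 / \<alpha> x ?x) \<cdot>\<^sub>m P ?x" and ?Z = "(1 / \<alpha> ?x x) \<cdot>\<^sub>m P ?x"
  have c': "?Y \<in> carrier_mat d d" "?Z \<in> carrier_mat d d" using c by auto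
  have Y: "P x * ?Y = 1\<^sub>m d" using c e a by (simp add: mult_smult_distrib[of _ d d _ d])
     (intro eq_matI, auto)
  have Z: "?Z * P x = 1\<^sub>m d" using c e a by (simp add: mult_smult_assoc_mat[of _ d d _ d])
     (intro eq_matI, auto)
  have "?Z = ?Z * (P x * ?Y)" unfolding Y by (rule right_mult_one_mat[symmetric, OF c'(2)])
  also have "\<dots> = ?Z * P x * ?Y" using c c' by (intro assoc_mult_mat[symmetric, of _ d d _ d _ d]) auto
  also have "\<dots> = ?Y" unfolding Z by (rule left_mult_one_mat[OF c'(1)])
  finally show thesis using that[of ?Y] Y Z c' by simp
qed

lemma P_nonzero: "x \<in> K \<Longrightarrow> P x \<noteq> 0\<^sub>m d d"
  using P_invertible[of x] invertible_nonzero[OF P_carrier[of x] _ _ d_pos] by metis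

lemma P_invertible_mat: "x \<in> K \<Longrightarrow> invertible_mat (P x)"
  using P_carrier[of x] P_invertible[of x] unfolding invertible_mat_def inverts_mat_def
  by (metis carrier_matD square_mat.simps)

lemma N_conj_swap: "n \<in> N \<Longrightarrow> y \<in> K \<Longrightarrow> y \<otimes> n = (y \<otimes> n \<otimes> inv y) \<otimes> y"
  using K_closed by (simp add: m_assoc)

lemma P_conj: "n \<in> N \<Longrightarrow> y \<in> K \<Longrightarrow> P y * P n = P (y \<otimes> n \<otimes> inv y) * P y"
  using P_left[OF conj_N, of y n y] P_right[of n y] N_conj_swap[of n y] by simp

text \<open>\<open>P\<close> is multiplicative against \<open>N\<close>, and
  \<open>P (n \<otimes> g)\<close> is a nonzero matrix, so its coefficient can be compared with
  1.\<close>

lemma alpha_N_left: assumes "n \<in> N" "g \<in> K" shows "\<alpha> n g = 1"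
proof -
  have K: "n \<otimes> g \<in> K" using assms N_in_K K_mult by blast
  have "\<alpha> n g \<cdot>\<^sub>m P (n \<otimes> g) = 1 \<cdot>\<^sub>m P (n \<otimes> g)"
    using P_mult[of n g] P_left[of n g] assms N_in_K by (simp add: one_smult_mat)
  then show ?thesis using smult_mat_cancel P_carrier[OF K] P_nonzero[OF K] by blast
qed

lemma alpha_N_right: assumes "n \<in> N" "g \<in> K" shows "\<alpha> g n = 1"
proof -
  have K: "g \<otimes> n \<in> K" using assms N_in_K K_mult by blast
  have "\<alpha> g n \<cdot>\<^sub>m P (g \<otimes> n) = 1 \<cdot>\<^sub>m P (g \<otimes> n)"
    using P_mult[of g n] P_right[of n g] assms N_in_K by (simp add: one_smult_mat)
  then show ?thesis using smult_mat_cancel P_carrier[OF K] P_nonzero[OF K] by blast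
qed

text \<open>This is what pins down scalars: if two projective representations have proportional
  traces along a coset of \<open>N\<close>, the factor is determined.\<close>

lemma trace_nonzero: "y \<in> K \<Longrightarrow> \<exists>n\<in>N. mtrace (P (y \<otimes> n)) \<noteq> 0"
  using ortho_trace_nonzero[OF rep orth P_carrier P_nonzero] P_right by auto

text \<open>Every axiom is a rational polynomial identity between entries in \<open>Qab\<close>, so
  \<open>\<sigma>\<close> may be applied to it. The values of the factor set are roots of unity and
  hence lie in \<open>Qab\<close> as well.\<close>

lemma twist:
  assumes s: "\<sigma> \<in> galQab"
  shows "assoc_rep \<Gamma> K N (\<lambda>x. map_mat \<sigma> (P x)) (\<lambda>x y. \<sigma> (\<alpha> x y)) d"
proof
  fix x y assume x: "x \<in> K"
  show "Qab_mat d (map_mat \<sigma> (P x))" using P_Qab[OF x] gal_mat_Qab_mat[OF s] by simp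
  assume y: "y \<in> K"
  show "map_mat \<sigma> (P x) * map_mat \<sigma> (P y) = \<sigma> (\<alpha> x y) \<cdot>\<^sub>m map_mat \<sigma> (P (x \<otimes> y))"
    using gal_mat_mult[OF s P_Qab[OF x] P_Qab[OF y]] P_mult[OF x y]
      gal_mat_smult[OF s P_Qab[OF K_mult[OF x y]] Qab_root_of_unity[OF root[OF x y]]] by simp
  show "root_of_unity (\<sigma> (\<alpha> x y))" using gal_root_of_unity[OF s root[OF x y]] .
next
  show "map_mat \<sigma> (P \<one>) = 1\<^sub>m d" by (simp add: P_one gal_mat_one[OF s])
next
  fix n g assume n: "n \<in> N" and g: "g \<in> K"
  show "map_mat \<sigma> (P (n \<otimes> g)) = map_mat \<sigma> (P n) * map_mat \<sigma> (P g)"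
    using P_left[OF n g] gal_mat_mult[OF s P_Qab[OF N_in_K[OF n]] P_Qab[OF g]] by simp
  show "map_mat \<sigma> (P (g \<otimes> n)) = map_mat \<sigma> (P g) * map_mat \<sigma> (P n)"
    using P_right[OF n g] gal_mat_mult[OF s P_Qab[OF g] P_Qab[OF N_in_K[OF n]]] by simp
next
  show "ortho \<Gamma> N d (\<lambda>x. map_mat \<sigma> (P x))"
    unfolding ortho_def
  proof (intro allI impI)
    fix i j k l assume l: "i < d" "j < d" "k < d" "l < d"
    have q: "P n $$ (i, j) \<in> Qab" "P (inv n) $$ (k, l) \<in> Qab" if "n \<in> N" for n
      using P_Qab[OF N_in_K] that l N_inv by (auto simp: Qab_mat_def)
    have "of_nat d * (\<Sum>n\<in>N. map_mat \<sigma> (P n) $$ (i, j) * map_mat \<sigma> (P (inv n)) $$ (k, l)) =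
      \<sigma> (of_nat d) * (\<Sum>n\<in>N. \<sigma> (P n $$ (i, j) * P (inv n) $$ (k, l)))"
      using l q carrier_matD[OF P_carrier[OF N_in_K]] N_inv
      by (simp add: gal_of_nat[OF s] gal_mult[OF s])
    also have "\<dots> = \<sigma> (of_nat d * (\<Sum>n\<in>N. P n $$ (i, j) * P (inv n) $$ (k, l)))"
      using q by (simp add: gal_sum[OF s] gal_mult[OF s] Qab_mult Qab_of_nat Qab_sum)
    also have "\<dots> = \<sigma> (if i = l \<and> j = k then of_nat (card N) else 0)"
      using orth l unfolding ortho_def by simp
    finally show "of_nat d * (\<Sum>n\<in>N. map_mat \<sigma> (P n) $$ (i, j) * map_mat \<sigma> (P (inv n)) $$ (k, l)) =
      (if i = l \<and> j = k then of_nat (card N) else 0)"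
      by (simp add: gal_of_nat[OF s] gal_0[OF s])
  qed
qed (use K_sub N_sub N_K fin conj_N d_pos K_closed K_mult K_inv K_one N_one in auto)

text \<open>Conjugation by \<open>x\<close> maps the finite set \<open>N\<close> injectively to
  itself, hence permutes it, and the orthogonality sum is merely reindexed.\<close>

lemma conjugate:
  assumes x: "x \<in> carrier \<Gamma>" and xK: "\<And>y. y \<in> K \<Longrightarrow> x \<otimes> y \<otimes> inv x \<in> K"
    and xN: "\<And>y. y \<in> N \<Longrightarrow> x \<otimes> y \<otimes> inv x \<in> N"
  shows "assoc_rep \<Gamma> K N (\<lambda>y. P (x \<otimes> y \<otimes> inv x))
    (\<lambda>y z. \<alpha> (x \<otimes> y \<otimes> inv x) (x \<otimes> z \<otimes> inv x)) d"
proof -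
  note m = conj_mult[OF x]
  have ci: "inv (x \<otimes> n \<otimes> inv x) = x \<otimes> inv n \<otimes> inv x" if "n \<in> N" for n
    using x that by (simp add: inv_mult_group m_assoc)
  have inj: "inj_on (\<lambda>n. x \<otimes> n \<otimes> inv x) N"
    using x by (auto simp: inj_on_def)
  then have img: "(\<lambda>n. x \<otimes> n \<otimes> inv x) ` N = N"
    using xN fin by (intro endo_inj_surj) auto
  have o: "ortho \<Gamma> N d (\<lambda>y. P (x \<otimes> y \<otimes> inv x))"
    unfolding ortho_def
  proof (intro allI impI)
    fix i j k l assume l: "i < d" "j < d" "k < d" "l < d"
    have "(\<Sum>n\<in>N. P (x \<otimes> n \<otimes> inv x) $$ (i, j) * P (x \<otimes> inv n \<otimes> inv x) $$ (k, l)) =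
      (\<Sum>n\<in>(\<lambda>n. x \<otimes> n \<otimes> inv x) ` N. P n $$ (i, j) * P (inv n) $$ (k, l))"
      by (simp add: sum.reindex[OF inj] ci)
    then show "of_nat d * (\<Sum>n\<in>N. P (x \<otimes> n \<otimes> inv x) $$ (i, j) * P (x \<otimes> inv n \<otimes> inv x) $$ (k, l)) =
       (if i = l \<and> j = k then of_nat (card N) else 0)"
      unfolding img using orth l by (simp add: ortho_def)
  qed
  show ?thesis
    by unfold_locales
      (use K_sub N_sub N_K fin conj_N d_pos o x in
        \<open>auto simp: m K_closed K_mult K_inv K_one N_one P_Qab xK xN P_mult root P_left P_right P_one\<close>)
qed

end

text \<open>The scalar by which \<open>Q\<close> differs from \<open>R\<close> at \<open>y\<close>,
  read off from traces on the coset of \<open>y\<close>. Traces do not see the choice of an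
  intertwiner, so the value is unchanged by similarity and can be compared across Galois
  twists.\<close>

definition ratio :: "('a, 'b) monoid_scheme \<Rightarrow> 'a set \<Rightarrow> ('a \<Rightarrow> complex mat) \<Rightarrow> ('a \<Rightarrow> complex mat) \<Rightarrow> 'a \<Rightarrow> complex"
  where "ratio \<Gamma> N Q R y = (THE c. \<forall>n\<in>N. mtrace (Q (y \<otimes>\<^bsub>\<Gamma>\<^esub> n)) = c * mtrace (R (y \<otimes>\<^bsub>\<Gamma>\<^esub> n)))"

section \<open>Pairs of projective representations over the same character\<close>

locale assoc_rep_pair = Q: assoc_rep \<Gamma> K N Q \<beta> d + R: assoc_rep \<Gamma> K N R \<delta> d
  for \<Gamma> (structure) and K N Q \<beta> R \<delta> d +
  assumes same_char: "n \<in> N \<Longrightarrow> mtrace (Q n) = mtrace (R n)"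
begin

lemma ratio_unique:
  assumes y: "y \<in> K" and "\<And>n. n \<in> N \<Longrightarrow> mtrace (Q (y \<otimes> n)) = c * mtrace (R (y \<otimes> n))"
  shows "ratio \<Gamma> N Q R y = c"
proof -
  obtain n where n: "n \<in> N" "mtrace (R (y \<otimes> n)) \<noteq> 0" using R.trace_nonzero[OF y] by blast
  show ?thesis
    unfolding ratio_def
  proof (rule the_equality)
    fix c' assume "\<forall>n\<in>N. mtrace (Q (y \<otimes> n)) = c' * mtrace (R (y \<otimes> n))"
    with n assms(2)[OF n(1)] show "c' = c" by auto
  qed (use assms(2) in blast)
qed

text \<open>Both representations are multiplicative against \<open>N\<close>, and
  \<open>\<gamma>\<close> is 1 there, so \<open>n\<close> passes the intertwiner at no cost;
  comparing coefficients needs \<open>C * R (n \<otimes> y)\<close> to be nonzero. The version with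
  \<open>n\<close> on the right follows by replacing \<open>n\<close> with its conjugate.\<close>

lemma coset_constant:
  assumes C: "C \<in> carrier_mat d d" "C' \<in> carrier_mat d d" "C' * C = 1\<^sub>m d"
    and eq: "\<And>y. y \<in> K \<Longrightarrow> Q y * C = \<gamma> y \<cdot>\<^sub>m (C * R y)"
    and one: "\<And>n. n \<in> N \<Longrightarrow> \<gamma> n = 1"
    and n: "n \<in> N" and y: "y \<in> K"
  shows "\<gamma> (n \<otimes> y) = \<gamma> y" "\<gamma> (y \<otimes> n) = \<gamma> y"
proof -
  have *: "\<gamma> (n \<otimes> y) = \<gamma> y" if n: "n \<in> N" for n
  proof -
    note c = Q.P_carrier[OF Q.N_in_K[OF n]] R.P_carrier[OF Q.N_in_K[OF n]] Q.P_carrier[OF y] R.P_carrier[OF y] C(1)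
    have ny: "n \<otimes> y \<in> K" using n y Q.N_in_K Q.K_mult by blast
    have "\<gamma> (n \<otimes> y) \<cdot>\<^sub>m (C * R (n \<otimes> y)) = Q n * (Q y * C)"
      using eq[OF ny] Q.P_left[OF n y] c by (simp add: assoc_mult_mat[of _ d d _ d _ d])
    also have "\<dots> = \<gamma> y \<cdot>\<^sub>m ((Q n * C) * R y)"
      unfolding eq[OF y] using c by (simp add: assoc_mult_mat[of _ d d _ d _ d] mult_smult_distrib[of _ d d _ d])
    also have "\<dots> = \<gamma> y \<cdot>\<^sub>m (C * R (n \<otimes> y))"
      unfolding eq[OF Q.N_in_K[OF n]] one[OF n] R.P_left[OF n y]
      using c by (simp add: assoc_mult_mat[of _ d d _ d _ d] mult_smult_assoc_mat[of _ d d _ d] one_smult_mat)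
    finally have e: "\<gamma> (n \<otimes> y) \<cdot>\<^sub>m (C * R (n \<otimes> y)) = \<gamma> y \<cdot>\<^sub>m (C * R (n \<otimes> y))" .
    note cR = R.P_carrier[OF ny]
    have "C * R (n \<otimes> y) \<noteq> 0\<^sub>m d d"
    proof
      assume "C * R (n \<otimes> y) = 0\<^sub>m d d"
      then have "C' * (C * R (n \<otimes> y)) = 0\<^sub>m d d" using C by simp
      then have "R (n \<otimes> y) = 0\<^sub>m d d" using C cR by (simp flip: assoc_mult_mat[of _ d d _ d _ d])
      then show False using R.P_nonzero[OF ny] by simp
    qed
    then show ?thesis using smult_mat_cancel[OF e, of d] C(1) cR by auto
  qed
  show "\<gamma> (n \<otimes> y) = \<gamma> y" using *[OF n] .
  show "\<gamma> (y \<otimes> n) = \<gamma> y" using *[OF Q.conj_N[OF y n]] Q.N_conj_swap[OF n y] by simp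
qed

text \<open>Multiplying the intertwining relation at \<open>y \<otimes> n\<close> by
  \<open>C'\<close> and taking traces removes \<open>C\<close>. This identifies the
  \<open>ratio\<close> with an explicitly found multiplier, in particular with the product formula
  for tensor representations.\<close>

lemma ratio_eq:
  assumes C: "C \<in> carrier_mat d d" "C' \<in> carrier_mat d d" "C * C' = 1\<^sub>m d" "C' * C = 1\<^sub>m d"
    and eq: "\<And>y. y \<in> K \<Longrightarrow> Q y * C = \<gamma> y \<cdot>\<^sub>m (C * R y)"
    and one: "\<And>n. n \<in> N \<Longrightarrow> \<gamma> n = 1"
    and y: "y \<in> K"
  shows "ratio \<Gamma> N Q R y = \<gamma> y" "n \<in> N \<Longrightarrow> mtrace (Q (y \<otimes> n)) = \<gamma> y * mtrace (R (y \<otimes> n))"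
proof -
  have *: "mtrace (Q (y \<otimes> n)) = \<gamma> y * mtrace (R (y \<otimes> n))" if n: "n \<in> N" for n
  proof -
    have K: "y \<otimes> n \<in> K" using y n Q.N_in_K Q.K_mult by blast
    note c = Q.P_carrier[OF K] R.P_carrier[OF K]
    have cc: "\<gamma> (y \<otimes> n) = \<gamma> y"
      by (rule coset_constant(2)[OF C(1,2,4) _ _ n y]) (use eq one in auto)
    have "Q (y \<otimes> n) = Q (y \<otimes> n) * C * C'" using C c by (simp add: assoc_mult_mat[of _ d d _ d _ d])
    also have "\<dots> = \<gamma> y \<cdot>\<^sub>m (C * R (y \<otimes> n) * C')"
      unfolding eq[OF K] cc
      using C c by (simp add: mult_smult_assoc_mat[of _ d d _ d])
    finally have "mtrace (Q (y \<otimes> n)) = \<gamma> y * mtrace (C * R (y \<otimes> n) * C')"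
      using C c by (simp add: mtrace_smult[of _ d])
    then show ?thesis using mtrace_conj[OF C(2,1) c(2) C(4)] by simp
  qed
  then show "n \<in> N \<Longrightarrow> mtrace (Q (y \<otimes> n)) = \<gamma> y * mtrace (R (y \<otimes> n))" by blast
  show "ratio \<Gamma> N Q R y = \<gamma> y" by (rule ratio_unique[OF y *])
qed

text \<open>On \<open>N\<close> the two representations are similar through some \<open>C\<close>.
  For \<open>y\<close> in \<open>K\<close>, the inverse of \<open>R y\<close> times
  \<open>C' * Q y * C\<close> commutes with \<open>R\<close> on \<open>N\<close>, because
  \<open>y\<close> acts on \<open>N\<close> by the same conjugation in both, so Schur's lemma makes
  it a scalar.\<close>

lemma intertwiner:
  obtains C C' where "C \<in> carrier_mat d d" "C' \<in> carrier_mat d d" "C * C' = 1\<^sub>m d" "C' * C = 1\<^sub>m d"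
    "\<And>y. y \<in> K \<Longrightarrow> Q y * C = ratio \<Gamma> N Q R y \<cdot>\<^sub>m (C * R y)"
    "\<And>y. y \<in> K \<Longrightarrow> ratio \<Gamma> N Q R y \<noteq> 0" "\<And>n. n \<in> N \<Longrightarrow> ratio \<Gamma> N Q R n = 1"
    "\<And>n y. n \<in> N \<Longrightarrow> y \<in> K \<Longrightarrow> ratio \<Gamma> N Q R (n \<otimes> y) = ratio \<Gamma> N Q R y"
    "\<And>n y. n \<in> N \<Longrightarrow> y \<in> K \<Longrightarrow> mtrace (Q (y \<otimes> n)) = ratio \<Gamma> N Q R y * mtrace (R (y \<otimes> n))"
proof -
  obtain C C' where C: "C \<in> carrier_mat d d" "C' \<in> carrier_mat d d" "C * C' = 1\<^sub>m d" "C' * C = 1\<^sub>m d"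
    "\<And>n. n \<in> N \<Longrightarrow> Q n * C = C * R n"
    using Q.equivalent_if_same_character[OF R.irred Q.rep same_char] by blast
  \<comment> \<open>Building the value 1 on \<open>N\<close> into the existence claim makes the
    chosen multiplier trivial there, as \<open>coset_constant\<close> and \<open>ratio_eq\<close>
    require.\<close>
  have "\<exists>c. c \<noteq> 0 \<and> Q y * C = c \<cdot>\<^sub>m (C * R y) \<and> (y \<in> N \<longrightarrow> c = 1)" if y: "y \<in> K" for y
  proof (cases "y \<in> N")
    case True
    then show ?thesis using C(5) by (intro exI[of _ 1]) auto
  next
    case False
    note cy = Q.P_carrier[OF y] R.P_carrier[OF y]
    obtain Y where Y: "Y \<in> carrier_mat d d" "R y * Y = 1\<^sub>m d" "Y * R y = 1\<^sub>m d"
      using R.P_invertible[OF y] by blast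
    let ?Z = "C' * Q y * C"
    have Z: "?Z \<in> carrier_mat d d" using C cy by auto
    \<comment> \<open>Moving \<open>R n\<close> through \<open>?Z\<close> turns it into the value at
      the conjugate of \<open>n\<close> by \<open>y\<close>; moving that through \<open>Y\<close>
      turns it back into \<open>R n\<close>.\<close>
    have "R n * (Y * ?Z) = (Y * ?Z) * R n" if n: "n \<in> N" for n
    proof -
      let ?n = "y \<otimes> n \<otimes> inv y"
      have n': "?n \<in> N" using Q.conj_N[OF y n] .
      note c = cy Q.P_carrier[OF Q.N_in_K[OF n]] R.P_carrier[OF Q.N_in_K[OF n]]
         Q.P_carrier[OF Q.N_in_K[OF n']] R.P_carrier[OF Q.N_in_K[OF n']] C(1,2) Y(1)
      have "?Z * R n = C' * Q y * (Q n * C)" unfolding C(5)[OF n]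
        using c by (simp add: assoc_mult_mat[of _ d d _ d _ d])
      also have "\<dots> = C' * (Q y * Q n) * C" using c by (simp add: assoc_mult_mat[of _ d d _ d _ d])
      also have "\<dots> = C' * (Q ?n * (C * C')) * Q y * C" unfolding Q.P_conj[OF n y] C(3)
        using c by (simp add: assoc_mult_mat[of _ d d _ d _ d])
      also have "\<dots> = C' * (Q ?n * C) * ?Z" using c by (simp add: assoc_mult_mat[of _ d d _ d _ d])
      also have "\<dots> = (C' * C) * R ?n * ?Z" unfolding C(5)[OF n']
        using c by (simp add: assoc_mult_mat[of _ d d _ d _ d])
      also have "\<dots> = R ?n * ?Z" unfolding C(4) using c by simp
      finally have ZR: "?Z * R n = R ?n * ?Z" .
      have "Y * R ?n = Y * R ?n * (R y * Y)" unfolding Y(2) using c by simp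
      also have "\<dots> = Y * (R ?n * R y) * Y" using c by (simp add: assoc_mult_mat[of _ d d _ d _ d])
      also have "\<dots> = (Y * R y) * R n * Y" unfolding R.P_conj[OF n y, symmetric]
        using c by (simp add: assoc_mult_mat[of _ d d _ d _ d])
      also have "\<dots> = R n * Y" unfolding Y(3) using c by simp
      finally have YR: "Y * R ?n = R n * Y" .
      have "(Y * ?Z) * R n = Y * (?Z * R n)" using c Z by (simp add: assoc_mult_mat[of _ d d _ d _ d])
      also have "\<dots> = (Y * R ?n) * ?Z" unfolding ZR using c Z by (simp add: assoc_mult_mat[of _ d d _ d _ d])
      also have "\<dots> = R n * (Y * ?Z)" unfolding YR using c Z by (simp add: assoc_mult_mat[of _ d d _ d _ d])
      finally show ?thesis by simp
    qed
    then obtain c where c: "Y * ?Z = c \<cdot>\<^sub>m 1\<^sub>m d"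
      using schur_scalar[OF R.irred, of "Y * ?Z"] Y Z by auto
    have "Q y * C = (C * C') * Q y * C" using C cy by simp
    also have "\<dots> = C * ((R y * Y) * ?Z)" unfolding Y(2)
      using C(1,2) cy by (simp add: assoc_mult_mat[of _ d d _ d _ d])
    also have "\<dots> = C * (R y * (Y * ?Z))"
      using Z Y(1) cy by (simp add: assoc_mult_mat[of _ d d _ d _ d])
    also have "\<dots> = c \<cdot>\<^sub>m (C * R y)" unfolding c
      using C(1) cy by (simp add: mult_scalar_mat mult_smult_distrib[of _ d d _ d])
    finally have e: "Q y * C = c \<cdot>\<^sub>m (C * R y)" .
    have "c \<noteq> 0"
    proof
      assume "c = 0"
      then have "Q y * C = 0\<^sub>m d d" using e C(1) cy by (intro eq_matI) auto
      then have "Q y * C * C' = 0\<^sub>m d d" using C by simp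
      then have "Q y = 0\<^sub>m d d" using C cy by (simp add: assoc_mult_mat[of _ d d _ d _ d])
      then show False using Q.P_nonzero[OF y] by simp
    qed
    then show ?thesis using e False by blast
  qed
  then obtain \<gamma> where g: "\<And>y. y \<in> K \<Longrightarrow> \<gamma> y \<noteq> 0" "\<And>y. y \<in> K \<Longrightarrow> Q y * C = \<gamma> y \<cdot>\<^sub>m (C * R y)"
    "\<And>n. n \<in> N \<Longrightarrow> \<gamma> n = 1"
    using Q.N_in_K by metis
  note r = ratio_eq[OF C(1-4) g(2,3)] and cc = coset_constant[OF C(1,2,4) g(2,3)]
  have r1: "ratio \<Gamma> N Q R y = \<gamma> y" if "y \<in> K" for y using r(1) that by blast
  show thesis
    by (rule that[OF C(1-4)])
      (use g cc r1 r(2) Q.N_in_K Q.K_mult in auto)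
qed

lemma trace_ratio: "n \<in> N \<Longrightarrow> y \<in> K \<Longrightarrow> mtrace (Q (y \<otimes> n)) = ratio \<Gamma> N Q R y * mtrace (R (y \<otimes> n))"
  by (rule intertwiner) blast

text \<open>If \<open>C\<close> intertwines the conjugate by \<open>x\<close>, then \<open>C * R s\<close> serves for \<open>x \<otimes> s\<close>.\<close>
lemma shifted_intertwiner:
  assumes C: "C \<in> carrier_mat d d"
    and eq: "\<And>y. y \<in> K \<Longrightarrow> Q y * C = ratio \<Gamma> N Q R y \<cdot>\<^sub>m (C * R y)"
    and s: "s \<in> K" "s' \<in> K" "g \<in> K"
  shows "Q (s \<otimes> g \<otimes> inv s') * (C * R s') =
    (ratio \<Gamma> N Q R (s \<otimes> g \<otimes> inv s') * \<delta> (s \<otimes> g \<otimes> inv s') s' / \<delta> s g) \<cdot>\<^sub>m (C * R s * R g)"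
proof -
  let ?t = "s \<otimes> g \<otimes> inv s'"
  have K: "?t \<in> K" "s \<otimes> g \<in> K" using s Q.K_mult Q.K_inv by auto
  have m: "?t \<otimes> s' = s \<otimes> g" using s Q.K_closed by (simp add: Q.m_assoc)
  note c = Q.P_carrier[OF K(1)] R.P_carrier[OF K(1)] R.P_carrier[OF K(2)] R.P_carrier[OF s(1)] R.P_carrier[OF s(2)] R.P_carrier[OF s(3)] C
  have d: "\<delta> s g \<noteq> 0" using R.root[OF s(1,3)] root_of_unity_nonzero by blast
  have "Q ?t * (C * R s') = Q ?t * C * R s'" using c by (simp add: assoc_mult_mat[of _ d d _ d _ d])
  also have "\<dots> = ratio \<Gamma> N Q R ?t \<cdot>\<^sub>m (C * (R ?t * R s'))"
    unfolding eq[OF K(1)] using c by (simp add: assoc_mult_mat[of _ d d _ d _ d] mult_smult_assoc_mat[of _ d d _ d])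
  also have "\<dots> = (ratio \<Gamma> N Q R ?t * \<delta> ?t s') \<cdot>\<^sub>m (C * R (s \<otimes> g))"
    unfolding R.P_mult[OF K(1) s(2)] m using c by (simp add: mult_smult_distrib[of _ d d _ d] smult_smult_mat)
  also have "\<dots> = (ratio \<Gamma> N Q R ?t * \<delta> ?t s' / \<delta> s g) \<cdot>\<^sub>m (C * (R s * R g))"
    unfolding R.P_mult[OF s(1,3)] using c d by (simp add: mult_smult_distrib[of _ d d _ d] smult_smult_mat)
  finally show ?thesis using c by (simp add: assoc_mult_mat[of _ d d _ d _ d])
qed

end

section \<open>Identification of the function \<open>mu_fun\<close>\<close>

context assoc_rep
begin

text \<open>Existence in the definite description comes from \<open>intertwiner\<close>, with
  \<open>A = C'\<close> and \<open>B = C\<close>. For uniqueness, traces remove the conjugation by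
  \<open>A\<close> and \<open>B\<close>, and constancy on cosets lets one value of a competitor be
  tested along the whole coset of \<open>y\<close>.\<close>

lemma mu_fun_eq:
  assumes pair: "assoc_rep_pair \<Gamma> K N (\<lambda>y. map_mat \<sigma> (P (x \<otimes> y \<otimes> inv x))) \<beta> P \<alpha> d"
    and y: "y \<in> K"
  shows "mu_fun \<Gamma> K N d P x \<sigma> y = ratio \<Gamma> N (\<lambda>y. map_mat \<sigma> (P (x \<otimes> y \<otimes> inv x))) P y"
proof -
  let ?Q = "\<lambda>y. map_mat \<sigma> (P (x \<otimes> y \<otimes> inv x))"
  interpret pr: assoc_rep_pair \<Gamma> K N ?Q \<beta> P \<alpha> d by (rule pair)
  obtain C C' where C: "C \<in> carrier_mat d d" "C' \<in> carrier_mat d d" "C * C' = 1\<^sub>m d" "C' * C = 1\<^sub>m d"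
    and r: "\<And>y. y \<in> K \<Longrightarrow> ?Q y * C = ratio \<Gamma> N ?Q P y \<cdot>\<^sub>m (C * P y)"
    "\<And>y. y \<in> K \<Longrightarrow> ratio \<Gamma> N ?Q P y \<noteq> 0" "\<And>n. n \<in> N \<Longrightarrow> ratio \<Gamma> N ?Q P n = 1"
    "\<And>n y. n \<in> N \<Longrightarrow> y \<in> K \<Longrightarrow> ratio \<Gamma> N ?Q P (n \<otimes> y) = ratio \<Gamma> N ?Q P y"
    by (rule pr.intertwiner) blast
  let ?\<mu> = "\<lambda>y. if y \<in> K then ratio \<Gamma> N ?Q P y else 0"
  have e: "?Q y = ratio \<Gamma> N ?Q P y \<cdot>\<^sub>m (C * P y * C')" if y: "y \<in> K" for y
  proof -
    note c = pr.Q.P_carrier[OF y] P_carrier[OF y]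
    have "?Q y = ?Q y * C * C'" using C c by (simp add: assoc_mult_mat[of _ d d _ d _ d])
    also have "\<dots> = ratio \<Gamma> N ?Q P y \<cdot>\<^sub>m (C * P y * C')"
      unfolding r(1)[OF y] using C c by (simp add: mult_smult_assoc_mat[of _ d d _ d])
    finally show ?thesis .
  qed
  have "mu_fun \<Gamma> K N d P x \<sigma> = ?\<mu>"
    unfolding mu_fun_def
  proof (rule the_equality, intro conjI)
    show "\<exists>A B. A \<in> carrier_mat d d \<and> B \<in> carrier_mat d d \<and> A * B = 1\<^sub>m d \<and> B * A = 1\<^sub>m d \<and>
        (\<forall>y\<in>K. ?Q y = ?\<mu> y \<cdot>\<^sub>m (B * P y * A))"
      using C e by (intro exI[of _ C'] exI[of _ C]) auto
    show "\<forall>y\<in>K. \<forall>n\<in>N. ?\<mu> (n \<otimes> y) = ?\<mu> y" using r(4) N_in_K K_mult by auto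
    show "?\<mu> \<one> = 1" using r(3)[OF N_one] K_one by simp
  next
    fix \<mu> assume m: "(\<forall>y. y \<notin> K \<longrightarrow> \<mu> y = 0) \<and> (\<forall>y\<in>K. \<mu> y \<noteq> 0) \<and> \<mu> \<one> = 1 \<and>
      (\<forall>y\<in>K. \<forall>n\<in>N. \<mu> (n \<otimes> y) = \<mu> y) \<and>
      (\<exists>A B. A \<in> carrier_mat d d \<and> B \<in> carrier_mat d d \<and> A * B = 1\<^sub>m d \<and> B * A = 1\<^sub>m d \<and>
         (\<forall>y\<in>K. ?Q y = \<mu> y \<cdot>\<^sub>m (B * P y * A)))"
    then obtain A B where AB: "A \<in> carrier_mat d d" "B \<in> carrier_mat d d" "A * B = 1\<^sub>m d" "B * A = 1\<^sub>m d"
      and eq: "\<And>y. y \<in> K \<Longrightarrow> ?Q y = \<mu> y \<cdot>\<^sub>m (B * P y * A)" by blast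
    show "\<mu> = ?\<mu>"
    proof
      fix y show "\<mu> y = ?\<mu> y"
      proof (cases "y \<in> K")
        case y: True
        have "ratio \<Gamma> N ?Q P y = \<mu> y"
        proof (rule pr.ratio_unique[OF y])
          fix n assume n: "n \<in> N"
          have K: "y \<otimes> n \<in> K" using y n N_in_K K_mult by blast
          have "\<mu> (y \<otimes> n) = \<mu> y"
            using m conj_N[OF y n] N_conj_swap[OF n y] y by metis
          then have "mtrace (?Q (y \<otimes> n)) = \<mu> y * mtrace (B * P (y \<otimes> n) * A)"
            using eq[OF K] AB P_carrier[OF K] by (simp add: mtrace_smult[of _ d])
          then show "mtrace (?Q (y \<otimes> n)) = \<mu> y * mtrace (P (y \<otimes> n))"
            using mtrace_conj[OF AB(1,2) P_carrier[OF K] AB(3)] by simp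
        qed
        then show ?thesis using y by simp
      qed (use m in auto)
    qed
  qed (use r in auto)
  then show ?thesis using y by simp
qed

lemma twisted_pair:
  assumes s: "\<sigma>\<^sub>1 \<in> galQab" "\<sigma>\<^sub>2 \<in> galQab" and x: "x \<in> carrier \<Gamma>"
    and xK: "\<And>y. y \<in> K \<Longrightarrow> x \<otimes> y \<otimes> inv x \<in> K" and xN: "\<And>y. y \<in> N \<Longrightarrow> x \<otimes> y \<otimes> inv x \<in> N"
    and eq: "\<And>n. n \<in> N \<Longrightarrow> \<sigma>\<^sub>1 (mtrace (P (x \<otimes> n \<otimes> inv x))) = \<sigma>\<^sub>2 (mtrace (P n))"
  shows "assoc_rep_pair \<Gamma> K N (\<lambda>y. map_mat \<sigma>\<^sub>1 (P (x \<otimes> y \<otimes> inv x)))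
    (\<lambda>y z. \<sigma>\<^sub>1 (\<alpha> (x \<otimes> y \<otimes> inv x) (x \<otimes> z \<otimes> inv x)))
    (\<lambda>y. map_mat \<sigma>\<^sub>2 (P y)) (\<lambda>x y. \<sigma>\<^sub>2 (\<alpha> x y)) d"
  unfolding assoc_rep_pair_def assoc_rep_pair_axioms_def
  using twist[OF s(2)] assoc_rep.twist[OF conjugate[OF x xK xN] s(1)] eq
    gal_mat_mtrace[OF s(1) P_Qab] gal_mat_mtrace[OF s(2) P_Qab] xK N_in_K by auto

text \<open>Stated separately so that the second representation is literally \<open>P\<close>, as
  \<open>mu_fun_eq\<close> expects, and not its image under an entrywise identity map.\<close>

lemma twisted_pair_id:
  assumes s: "\<sigma>\<^sub>1 \<in> galQab" and x: "x \<in> carrier \<Gamma>"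
    and xK: "\<And>y. y \<in> K \<Longrightarrow> x \<otimes> y \<otimes> inv x \<in> K" and xN: "\<And>y. y \<in> N \<Longrightarrow> x \<otimes> y \<otimes> inv x \<in> N"
    and eq: "\<And>n. n \<in> N \<Longrightarrow> \<sigma>\<^sub>1 (mtrace (P (x \<otimes> n \<otimes> inv x))) = mtrace (P n)"
  shows "assoc_rep_pair \<Gamma> K N (\<lambda>y. map_mat \<sigma>\<^sub>1 (P (x \<otimes> y \<otimes> inv x)))
    (\<lambda>y z. \<sigma>\<^sub>1 (\<alpha> (x \<otimes> y \<otimes> inv x) (x \<otimes> z \<otimes> inv x))) P \<alpha> d"
  unfolding assoc_rep_pair_def assoc_rep_pair_axioms_def
  using assoc_rep_axioms assoc_rep.twist[OF conjugate[OF x xK xN] s(1)] eq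
    gal_mat_mtrace[OF s(1) P_Qab] xK N_in_K by auto

text \<open>A value of mu is a quotient s/t of traces; since s and t lie in \<open>Qab\<close>, this determines the
  value for the twisted representations without knowing that mu itself has values in \<open>Qab\<close>.\<close>
lemma mu_fun_trace_quotient:
  assumes s: "\<sigma>\<^sub>1 \<in> galQab" "\<sigma>\<^sub>2 \<in> galQab" "\<rho> \<in> galQab" "\<sigma>\<^sub>1 = \<sigma>\<^sub>2 \<circ> \<rho>" and x: "x \<in> carrier \<Gamma>"
    and xK: "\<And>y. y \<in> K \<Longrightarrow> x \<otimes> y \<otimes> inv x \<in> K" and xN: "\<And>y. y \<in> N \<Longrightarrow> x \<otimes> y \<otimes> inv x \<in> N"
    and eq: "\<And>n. n \<in> N \<Longrightarrow> \<rho> (mtrace (P (x \<otimes> n \<otimes> inv x))) = mtrace (P n)"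
    and y: "y \<in> K"
  obtains u v where "u \<in> Qab" "v \<in> Qab" "v \<noteq> 0" "u = mu_fun \<Gamma> K N d P x \<rho> y * v"
    "\<sigma>\<^sub>2 u = ratio \<Gamma> N (\<lambda>y. map_mat \<sigma>\<^sub>1 (P (x \<otimes> y \<otimes> inv x))) (\<lambda>y. map_mat \<sigma>\<^sub>2 (P y)) y * \<sigma>\<^sub>2 v"
proof -
  have p1: "assoc_rep_pair \<Gamma> K N (\<lambda>y. map_mat \<rho> (P (x \<otimes> y \<otimes> inv x)))
    (\<lambda>y z. \<rho> (\<alpha> (x \<otimes> y \<otimes> inv x) (x \<otimes> z \<otimes> inv x))) P \<alpha> d"
    by (rule twisted_pair_id[OF s(3) x xK xN eq])
  have eq2: "\<sigma>\<^sub>1 (mtrace (P (x \<otimes> n \<otimes> inv x))) = \<sigma>\<^sub>2 (mtrace (P n))" if "n \<in> N" for n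
    using eq[OF that] s(4) by simp
  have p2: "assoc_rep_pair \<Gamma> K N (\<lambda>y. map_mat \<sigma>\<^sub>1 (P (x \<otimes> y \<otimes> inv x)))
    (\<lambda>y z. \<sigma>\<^sub>1 (\<alpha> (x \<otimes> y \<otimes> inv x) (x \<otimes> z \<otimes> inv x)))
    (\<lambda>y. map_mat \<sigma>\<^sub>2 (P y)) (\<lambda>x y. \<sigma>\<^sub>2 (\<alpha> x y)) d"
    by (rule twisted_pair[OF s(1,2) x xK xN eq2])
  obtain n where n: "n \<in> N" "mtrace (P (y \<otimes> n)) \<noteq> 0" using trace_nonzero[OF y] by blast
  have K: "y \<otimes> n \<in> K" using y n N_in_K K_mult by blast
  note K' = xK[OF K]
  have 1: "mtrace (map_mat \<rho> (P (x \<otimes> (y \<otimes> n) \<otimes> inv x))) = mu_fun \<Gamma> K N d P x \<rho> y * mtrace (P (y \<otimes> n))"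
    unfolding mu_fun_eq[OF p1 y] by (rule assoc_rep_pair.trace_ratio[OF p1 n(1) y])
  have 2: "mtrace (map_mat \<sigma>\<^sub>1 (P (x \<otimes> (y \<otimes> n) \<otimes> inv x))) =
    ratio \<Gamma> N (\<lambda>y. map_mat \<sigma>\<^sub>1 (P (x \<otimes> y \<otimes> inv x))) (\<lambda>y. map_mat \<sigma>\<^sub>2 (P y)) y * mtrace (map_mat \<sigma>\<^sub>2 (P (y \<otimes> n)))"
    by (rule assoc_rep_pair.trace_ratio[OF p2 n(1) y])
  show thesis
  proof (rule that[of "mtrace (map_mat \<rho> (P (x \<otimes> (y \<otimes> n) \<otimes> inv x)))" "mtrace (P (y \<otimes> n))"])
    show "mtrace (map_mat \<rho> (P (x \<otimes> (y \<otimes> n) \<otimes> inv x))) \<in> Qab"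
      using P_Qab[OF K'] gal_mat_Qab_mat[OF s(3)] Qab_mat_mtrace by blast
    show "mtrace (P (y \<otimes> n)) \<in> Qab" using P_Qab[OF K] Qab_mat_mtrace by blast
    show "\<sigma>\<^sub>2 (mtrace (map_mat \<rho> (P (x \<otimes> (y \<otimes> n) \<otimes> inv x)))) =
      ratio \<Gamma> N (\<lambda>y. map_mat \<sigma>\<^sub>1 (P (x \<otimes> y \<otimes> inv x))) (\<lambda>y. map_mat \<sigma>\<^sub>2 (P y)) y * \<sigma>\<^sub>2 (mtrace (P (y \<otimes> n)))"
      using 2 gal_mat_mtrace[OF s(1) P_Qab[OF K']] gal_mat_mtrace[OF s(2) P_Qab[OF K]]
        gal_mat_mtrace[OF s(3) P_Qab[OF K']] s(4) by (metis comp_apply)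
  qed (use n 1 in auto)
qed

end

section \<open>Tensor powers and wreath products\<close>

abbreviation pinv :: "(nat \<Rightarrow> nat) \<Rightarrow> nat \<Rightarrow> nat" where
  "pinv w \<equiv> inv_into UNIV w"

lemma permutes_lt [simp]: "w permutes {..<n} \<Longrightarrow> w i < n \<longleftrightarrow> i < (n::nat)"
  using permutes_in_image[of w "{..<n}" i] by simp

lemma pinv_permutes: "w permutes {..<n} \<Longrightarrow> pinv w permutes {..<n}"
  by (rule permutes_inv)

lemma pinv_lt [simp]: "w permutes {..<n} \<Longrightarrow> pinv w i < n \<longleftrightarrow> i < (n::nat)"
  by (rule permutes_lt[OF pinv_permutes])

lemma pinv_inverse [simp]:
  assumes "w permutes {..<n::nat}"
  shows "w (pinv w i) = i" "pinv w (w i) = i"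
  using permutes_inverses[OF assms] by auto

lemma pinv_comp: "w permutes {..<n::nat} \<Longrightarrow> v permutes {..<n} \<Longrightarrow> pinv (w \<circ> v) = pinv v \<circ> pinv w"
  by (rule o_inv_distrib) (auto simp: permutes_bij)

lemma pinv_pinv: "w permutes {..<n::nat} \<Longrightarrow> pinv (pinv w) = w"
  by (rule inv_inv_eq) (auto simp: permutes_bij)

lemma prod_permute: "w permutes {..<n::nat} \<Longrightarrow> (\<Prod>i<n. f (w i)) = (\<Prod>i<n. f i)"
  for f :: "nat \<Rightarrow> complex"
  by (rule prod.reindex_bij_betw[OF permutes_imp_bij])

text \<open>The basis vectors of the tensor power are multi-indices, while matrices are indexed by
  numbers below \<open>d ^ n\<close>. An arbitrary bijection between the two suffices, as only its
  bijectivity enters.\<close>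

definition idx :: "nat \<Rightarrow> nat \<Rightarrow> nat \<Rightarrow> nat \<Rightarrow> nat" where
  "idx n d = (SOME h. bij_betw h {..<d ^ n} ({..<n} \<rightarrow>\<^sub>E {..<d}))"

lemma idx_bij: "bij_betw (idx n d) {..<d ^ n} ({..<n} \<rightarrow>\<^sub>E {..<d})"
proof -
  have "\<exists>h. bij_betw h {0..<card ({..<n} \<rightarrow>\<^sub>E {..<d})} ({..<n} \<rightarrow>\<^sub>E {..<d})"
    by (rule ex_bij_betw_nat_finite) (auto intro: finite_PiE)
  then have "\<exists>h. bij_betw h {..<d ^ n} ({..<n} \<rightarrow>\<^sub>E {..<d})"
    by (simp add: card_PiE atLeast0LessThan)
  then show ?thesis unfolding idx_def by (rule someI_ex)
qed

lemma idx_lt: "a < d ^ n \<Longrightarrow> i < n \<Longrightarrow> idx n d a i < d"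
  using bij_betwE[OF idx_bij[of n d]] by (fastforce simp: PiE_iff)

lemma idx_eq_iff:
  assumes "a < d ^ n" "b < d ^ n"
  shows "(\<forall>i<n. idx n d a i = idx n d b i) \<longleftrightarrow> a = b"
proof
  assume e: "\<forall>i<n. idx n d a i = idx n d b i"
  have "idx n d a \<in> {..<n} \<rightarrow>\<^sub>E {..<d}" "idx n d b \<in> {..<n} \<rightarrow>\<^sub>E {..<d}"
    using assms bij_betwE[OF idx_bij[of n d]] by auto
  then have "idx n d a = idx n d b" by (rule PiE_ext) (use e in auto)
  then show "a = b" using assms bij_betw_imp_inj_on[OF idx_bij[of n d]] by (auto simp: inj_on_def)
qed simp

text \<open>Distributivity over multi-indices: the reason why products and traces of tensors factor
  over the places.\<close>

lemma sum_idx: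
  fixes f :: "nat \<Rightarrow> nat \<Rightarrow> complex"
  shows "(\<Sum>c<d ^ n. \<Prod>i<n. f i (idx n d c i)) = (\<Prod>i<n. \<Sum>c<d. f i c)"
proof -
  have "(\<Sum>c<d ^ n. \<Prod>i<n. f i (idx n d c i)) = (\<Sum>\<phi>\<in>{..<n} \<rightarrow>\<^sub>E {..<d}. \<Prod>i<n. f i (\<phi> i))"
    by (rule sum.reindex_bij_betw[OF idx_bij])
  also have "\<dots> = (\<Prod>i<n. \<Sum>c<d. f i c)"
    by (rule prod_sum_PiE[symmetric]) auto
  finally show ?thesis .
qed

text \<open>The operator on the n-fold tensor power of C^d that applies the place permutation w and then
  the matrix X i in the i-th tensor factor.\<close>
definition tens :: "nat \<Rightarrow> nat \<Rightarrow> (nat \<Rightarrow> complex mat) \<Rightarrow> (nat \<Rightarrow> nat) \<Rightarrow> complex mat" where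
  "tens n d A w = mat (d ^ n) (d ^ n) (\<lambda>(a, b). \<Prod>i<n. A i $$ (idx n d a i, idx n d b (pinv w i)))"

lemma tens_carrier [simp]: "tens n d A w \<in> carrier_mat (d ^ n) (d ^ n)"
  by (simp add: tens_def)

lemma tens_index: "a < d ^ n \<Longrightarrow> b < d ^ n \<Longrightarrow>
  tens n d A w $$ (a, b) = (\<Prod>i<n. A i $$ (idx n d a i, idx n d b (pinv w i)))"
  by (simp add: tens_def)

lemma tens_cong: "(\<And>i. i < n \<Longrightarrow> A i = B i) \<Longrightarrow> tens n d A w = tens n d B w"
  unfolding tens_def by (intro cong_mat refl) simp

text \<open>Sliding the permutation \<open>w\<close> past the second tensor moves the factor at
  place \<open>pinv w i\<close> to place \<open>i\<close>. This is the same twist as in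
  \<open>wreath_mult\<close>, so tensors multiply like elements of the wreath product.\<close>

lemma tens_mult:
  assumes A: "\<And>i. i < n \<Longrightarrow> A i \<in> carrier_mat d d" and B: "\<And>i. i < n \<Longrightarrow> B i \<in> carrier_mat d d"
    and w: "w permutes {..<n}" and v: "v permutes {..<n}"
  shows "tens n d A w * tens n d B v = tens n d (\<lambda>i. A i * B (pinv w i)) (w \<circ> v)"
proof (rule eq_matI)
  fix a b assume "a < dim_row (tens n d (\<lambda>i. A i * B (pinv w i)) (w \<circ> v))"
    "b < dim_col (tens n d (\<lambda>i. A i * B (pinv w i)) (w \<circ> v))"
  then have ab: "a < d ^ n" "b < d ^ n" by (auto simp: tens_def)
  let ?a = "idx n d a" and ?b = "idx n d b"
  have "(tens n d A w * tens n d B v) $$ (a, b) =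
      (\<Sum>c<d ^ n. (\<Prod>i<n. A i $$ (?a i, idx n d c (pinv w i))) * (\<Prod>i<n. B i $$ (idx n d c i, ?b (pinv v i))))"
    using mult_mat_index[OF tens_carrier tens_carrier ab] ab by (simp add: tens_index)
  \<comment> \<open>Reindexing the first product by \<open>w\<close> makes both products use the
    summation index at the same place \<open>i\<close>, so that \<open>sum_idx\<close> separates the
    places.\<close>
  also have "\<dots> = (\<Sum>c<d ^ n. \<Prod>i<n. A (w i) $$ (?a (w i), idx n d c i) * B i $$ (idx n d c i, ?b (pinv v i)))"
  proof (intro sum.cong refl)
    fix c
    have "(\<Prod>i<n. A i $$ (?a i, idx n d c (pinv w i))) = (\<Prod>i<n. A (w i) $$ (?a (w i), idx n d c i))"
      using prod_permute[OF w, of "\<lambda>i. A i $$ (?a i, idx n d c (pinv w i))"] w by simp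
    then show "(\<Prod>i<n. A i $$ (?a i, idx n d c (pinv w i))) * (\<Prod>i<n. B i $$ (idx n d c i, ?b (pinv v i))) =
      (\<Prod>i<n. A (w i) $$ (?a (w i), idx n d c i) * B i $$ (idx n d c i, ?b (pinv v i)))"
      by (simp add: prod.distrib)
  qed
  also have "\<dots> = (\<Prod>i<n. \<Sum>c<d. A (w i) $$ (?a (w i), c) * B i $$ (c, ?b (pinv v i)))"
    using sum_idx[where f = "\<lambda>i c. A (w i) $$ (?a (w i), c) * B i $$ (c, ?b (pinv v i))" and d = d and n = n] by simp
  also have "\<dots> = (\<Prod>i<n. (A (w i) * B i) $$ (?a (w i), ?b (pinv v i)))"
    using w v ab by (intro prod.cong refl mult_mat_index[symmetric, of _ d d _ d] A B) (auto intro!: idx_lt)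
  also have "\<dots> = (\<Prod>i<n. (A i * B (pinv w i)) $$ (?a i, ?b (pinv v (pinv w i))))"
    using prod_permute[OF w, of "\<lambda>i. (A i * B (pinv w i)) $$ (?a i, ?b (pinv v (pinv w i)))"] w by simp
  also have "\<dots> = tens n d (\<lambda>i. A i * B (pinv w i)) (w \<circ> v) $$ (a, b)"
    using ab w v by (simp add: tens_index pinv_comp)
  finally show "(tens n d A w * tens n d B v) $$ (a, b) = tens n d (\<lambda>i. A i * B (pinv w i)) (w \<circ> v) $$ (a, b)" .
qed (auto simp: tens_def)

lemma tens_smult:
  assumes A: "\<And>i. i < n \<Longrightarrow> A i \<in> carrier_mat d d" and w: "w permutes {..<n}"
  shows "tens n d (\<lambda>i. c i \<cdot>\<^sub>m A i) w = (\<Prod>i<n. c i) \<cdot>\<^sub>m tens n d A w"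
proof (rule eq_matI)
  fix a b assume "a < dim_row ((\<Prod>i<n. c i) \<cdot>\<^sub>m tens n d A w)" "b < dim_col ((\<Prod>i<n. c i) \<cdot>\<^sub>m tens n d A w)"
  then have ab: "a < d ^ n" "b < d ^ n" by (auto simp: tens_def)
  have l: "idx n d a i < d" "idx n d b (pinv w i) < d" if "i < n" for i
    using that ab w by (auto intro!: idx_lt)
  have "tens n d (\<lambda>i. c i \<cdot>\<^sub>m A i) w $$ (a, b) = (\<Prod>i<n. c i * A i $$ (idx n d a i, idx n d b (pinv w i)))"
    unfolding tens_index[OF ab] using carrier_matD[OF A] l by (intro prod.cong refl) auto
  then show "tens n d (\<lambda>i. c i \<cdot>\<^sub>m A i) w $$ (a, b) = ((\<Prod>i<n. c i) \<cdot>\<^sub>m tens n d A w) $$ (a, b)"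
    using ab by (simp add: prod.distrib tens_index tens_def)
qed (auto simp: tens_def)

lemma tens_one: "tens n d (\<lambda>_. 1\<^sub>m d) id = 1\<^sub>m (d ^ n)"
proof (rule eq_matI)
  fix a b assume "a < dim_row (1\<^sub>m (d ^ n) :: complex mat)" "b < dim_col (1\<^sub>m (d ^ n) :: complex mat)"
  then have ab: "a < d ^ n" "b < d ^ n" by auto
  have "tens n d (\<lambda>_. 1\<^sub>m d) id $$ (a, b) = (\<Prod>i<n. if idx n d a i = idx n d b i then 1 else 0)"
    unfolding tens_index[OF ab] using ab by (intro prod.cong refl) (auto simp: idx_lt)
  also have "\<dots> = (if \<forall>i<n. idx n d a i = idx n d b i then 1 else 0)"
    by (auto simp: prod_zero_iff)
  also have "\<dots> = 1\<^sub>m (d ^ n) $$ (a, b)" using ab by (simp add: idx_eq_iff)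
  finally show "tens n d (\<lambda>_. 1\<^sub>m d) id $$ (a, b) = 1\<^sub>m (d ^ n) $$ (a, b)" .
qed (auto simp: tens_def)

lemma tens_mtrace:
  assumes A: "\<And>i. i < n \<Longrightarrow> A i \<in> carrier_mat d d"
  shows "mtrace (tens n d A id) = (\<Prod>i<n. mtrace (A i))"
proof -
  have "mtrace (tens n d A id) = (\<Sum>c<d ^ n. \<Prod>i<n. A i $$ (idx n d c i, idx n d c i))"
    by (simp add: mtrace_eq[OF tens_carrier] tens_index)
  also have "\<dots> = (\<Prod>i<n. \<Sum>c<d. A i $$ (c, c))" by (rule sum_idx)
  also have "\<dots> = (\<Prod>i<n. mtrace (A i))" by (intro prod.cong refl mtrace_eq[symmetric] A) simp
  finally show ?thesis .
qed

lemma tens_map: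
  assumes s: "\<sigma> \<in> galQab" and A: "\<And>i. i < n \<Longrightarrow> Qab_mat d (A i)" and w: "w permutes {..<n}"
  shows "map_mat \<sigma> (tens n d A w) = tens n d (\<lambda>i. map_mat \<sigma> (A i)) w"
proof (rule eq_matI)
  fix a b assume "a < dim_row (tens n d (\<lambda>i. map_mat \<sigma> (A i)) w)" "b < dim_col (tens n d (\<lambda>i. map_mat \<sigma> (A i)) w)"
  then have ab: "a < d ^ n" "b < d ^ n" by (auto simp: tens_def)
  have l: "idx n d a i < d" "idx n d b (pinv w i) < d" if "i < n" for i
    using that ab w by (auto intro!: idx_lt)
  have "map_mat \<sigma> (tens n d A w) $$ (a, b) = \<sigma> (\<Prod>i<n. A i $$ (idx n d a i, idx n d b (pinv w i)))"
    using ab by (simp add: tens_def)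
  also have "\<dots> = (\<Prod>i<n. \<sigma> (A i $$ (idx n d a i, idx n d b (pinv w i))))"
    using A l by (intro gal_prod[OF s]) (auto simp: Qab_mat_def)
  also have "\<dots> = tens n d (\<lambda>i. map_mat \<sigma> (A i)) w $$ (a, b)"
    unfolding tens_index[OF ab] using l carrier_matD[OF Qab_mat_carrier[OF A]] by (intro prod.cong refl) auto
  finally show "map_mat \<sigma> (tens n d A w) $$ (a, b) = tens n d (\<lambda>i. map_mat \<sigma> (A i)) w $$ (a, b)" .
qed (auto simp: tens_def)

lemma tens_Qab:
  assumes "\<And>i. i < n \<Longrightarrow> Qab_mat d (A i)" "w permutes {..<n}"
  shows "Qab_mat (d ^ n) (tens n d A w)"
proof -
  have "A i $$ (a, b) \<in> Qab" if "i < n" "a < d" "b < d" for i a b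
    using assms(1)[OF that(1)] that by (simp add: Qab_mat_def)
  then show ?thesis using assms(2)
    by (auto simp: Qab_mat_def tens_index intro!: Qab_prod) (simp add: idx_lt)
qed

lemma root_of_unity_mult: "root_of_unity a \<Longrightarrow> root_of_unity b \<Longrightarrow> root_of_unity (a * b)"
proof -
  assume "root_of_unity a" "root_of_unity b"
  then obtain k l where "k > 0" "l > 0" "a ^ k = 1" "b ^ l = 1" by (auto simp: root_of_unity_def)
  then show ?thesis unfolding root_of_unity_def
    by (intro exI[of _ "k * l"]) (metis mult_1 nat_0_less_mult_iff power_mult power_mult_distrib mult.commute power_one)
qed

lemma root_of_unity_prod: "(\<And>i. i \<in> S \<Longrightarrow> root_of_unity (c i)) \<Longrightarrow> root_of_unity (prod c S)"
proof (induction S rule: infinite_finite_induct)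
  case (insert x S)
  then show ?case by (simp add: root_of_unity_mult)
qed (auto simp: root_of_unity_def)

section \<open>The wreath product as a group\<close>

context group
begin

abbreviation W where "W n \<equiv> wreath G n"

lemma wreath_carrier: "x \<in> carrier (W n) \<longleftrightarrow> fst x \<in> {..<n} \<rightarrow>\<^sub>E carrier G \<and> snd x permutes {..<n}"
  by (simp add: wreath_def)

lemma wreath_carrier_pair: "(f, w) \<in> carrier (W n) \<longleftrightarrow> f \<in> {..<n} \<rightarrow>\<^sub>E carrier G \<and> w permutes {..<n}"
  by (simp add: wreath_carrier)

lemma wreath_mult: "(f, w) \<otimes>\<^bsub>W n\<^esub> (g, v) = ((\<lambda>i\<in>{..<n}. f i \<otimes> g (pinv w i)), w \<circ> v)"
  by (simp add: wreath_def)

lemma wreath_one: "\<one>\<^bsub>W n\<^esub> = ((\<lambda>i\<in>{..<n}. \<one>), id)"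
  by (simp add: wreath_def)

lemma wreath_inv_aux:
  assumes x: "(f, w) \<in> carrier (W n)"
  defines "y \<equiv> ((\<lambda>i\<in>{..<n}. inv (f (w i))), pinv w)"
  shows "y \<in> carrier (W n)" "y \<otimes>\<^bsub>W n\<^esub> (f, w) = \<one>\<^bsub>W n\<^esub>"
proof -
  have w: "w permutes {..<n}" and f: "\<And>i. i < n \<Longrightarrow> f i \<in> carrier G"
    using x by (auto simp: wreath_carrier_pair PiE_iff)
  show "y \<in> carrier (W n)" using w f by (auto simp: y_def wreath_carrier_pair pinv_permutes)
  have "pinv w \<circ> w = id" using w by (auto simp: fun_eq_iff)
  then show "y \<otimes>\<^bsub>W n\<^esub> (f, w) = \<one>\<^bsub>W n\<^esub>"
    using w f by (auto simp: y_def wreath_mult wreath_one pinv_pinv[OF w])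
qed

lemma wreath_group: "group (W n)"
proof (rule groupI)
  fix x y assume "x \<in> carrier (W n)" "y \<in> carrier (W n)"
  then show "x \<otimes>\<^bsub>W n\<^esub> y \<in> carrier (W n)"
    by (cases x, cases y) (auto simp: wreath_carrier_pair wreath_mult PiE_iff permutes_compose)
next
  show "\<one>\<^bsub>W n\<^esub> \<in> carrier (W n)" by (auto simp: wreath_carrier_pair wreath_one permutes_id)
next
  fix x y z assume "x \<in> carrier (W n)" "y \<in> carrier (W n)" "z \<in> carrier (W n)"
  then show "x \<otimes>\<^bsub>W n\<^esub> y \<otimes>\<^bsub>W n\<^esub> z = x \<otimes>\<^bsub>W n\<^esub> (y \<otimes>\<^bsub>W n\<^esub> z)"
    by (cases x, cases y, cases z)
      (auto simp: wreath_carrier_pair wreath_mult PiE_iff pinv_comp m_assoc fun_eq_iff)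
next
  fix x assume x: "x \<in> carrier (W n)"
  then show "\<one>\<^bsub>W n\<^esub> \<otimes>\<^bsub>W n\<^esub> x = x"
    by (cases x) (auto simp: wreath_carrier_pair wreath_mult wreath_one PiE_iff extensional_def fun_eq_iff)
  show "\<exists>y\<in>carrier (W n). y \<otimes>\<^bsub>W n\<^esub> x = \<one>\<^bsub>W n\<^esub>"
    using wreath_inv_aux[of "fst x" "snd x" n] x by (metis prod.collapse)
qed

lemma wreath_inv:
  assumes "(f, w) \<in> carrier (W n)"
  shows "inv\<^bsub>W n\<^esub> (f, w) = ((\<lambda>i\<in>{..<n}. inv (f (w i))), pinv w)"
  using group.inv_equality[OF wreath_group wreath_inv_aux(2)[OF assms] assms wreath_inv_aux(1)[OF assms]] .

text \<open>In the coordinate \<open>i = w j\<close> the inverse is taken of \<open>f\<close> at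
  \<open>w (pinv v j)\<close> and not at \<open>i\<close>, because \<open>v\<close> shifts the
  place. This mismatch is the source of the correction terms in \<open>coeff\<close>.\<close>

lemma wreath_conj:
  assumes x: "(f, w) \<in> carrier (W n)" and y: "(g, v) \<in> carrier (W n)"
  shows "(f, w) \<otimes>\<^bsub>W n\<^esub> (g, v) \<otimes>\<^bsub>W n\<^esub> inv\<^bsub>W n\<^esub> (f, w) =
    ((\<lambda>i\<in>{..<n}. f i \<otimes> g (pinv w i) \<otimes> inv (f (w (pinv v (pinv w i))))), w \<circ> v \<circ> pinv w)"
proof -
  have "w permutes {..<n}" "v permutes {..<n}"
    using x y by (auto simp: wreath_carrier_pair)
  then show ?thesis
    by (auto simp: wreath_inv[OF x] wreath_mult pinv_comp fun_eq_iff)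
qed

lemma wreath_conj_base:
  assumes x: "(f, w) \<in> carrier (W n)" and h: "h \<in> {..<n} \<rightarrow>\<^sub>E carrier G"
  shows "(f, w) \<otimes>\<^bsub>W n\<^esub> (h, id) \<otimes>\<^bsub>W n\<^esub> inv\<^bsub>W n\<^esub> (f, w) =
    ((\<lambda>i\<in>{..<n}. f i \<otimes> h (pinv w i) \<otimes> inv (f i)), id)"
proof -
  have w: "w permutes {..<n}" using x by (auto simp: wreath_carrier_pair)
  have "w \<circ> pinv w = id" using w by (auto simp: fun_eq_iff)
  then show ?thesis using h w by (subst wreath_conj[OF x]) (auto simp: wreath_carrier_pair permutes_id)
qed

lemma wreath_sub_subgroup:
  assumes "subgroup H G"
  shows "subgroup (wreath_sub H n) (W n)"
proof -
  note H = subgroup.m_closed[OF assms] subgroup.m_inv_closed[OF assms] subgroup.one_closed[OF assms]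
  have sub: "wreath_sub H n \<subseteq> carrier (W n)"
    using subgroup.mem_carrier[OF assms] by (auto simp: wreath_sub_def wreath_carrier_pair PiE_iff)
  show ?thesis
  proof (rule group.subgroupI[OF wreath_group sub])
    have "((\<lambda>i\<in>{..<n}. \<one>), id) \<in> wreath_sub H n" using H by (auto simp: wreath_sub_def permutes_id)
    then show "wreath_sub H n \<noteq> {}" by blast
    fix a assume a: "a \<in> wreath_sub H n"
    then have "a \<in> carrier (W n)" using sub by blast
    then show "inv\<^bsub>W n\<^esub> a \<in> wreath_sub H n"
      using a H by (cases a) (auto simp: wreath_inv wreath_sub_def PiE_iff pinv_permutes)
    fix b assume "b \<in> wreath_sub H n"
    then show "a \<otimes>\<^bsub>W n\<^esub> b \<in> wreath_sub H n"
      using a H by (cases a, cases b) (auto simp: wreath_mult wreath_sub_def PiE_iff permutes_compose)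
  qed
qed

lemma base_sub_subgroup:
  assumes "subgroup N G"
  shows "subgroup (base_sub N n) (W n)"
proof -
  note H = subgroup.m_closed[OF assms] subgroup.m_inv_closed[OF assms] subgroup.one_closed[OF assms]
  have sub: "base_sub N n \<subseteq> carrier (W n)"
    using subgroup.mem_carrier[OF assms] by (auto simp: base_sub_def wreath_carrier_pair PiE_iff permutes_id)
  show ?thesis
  proof (rule group.subgroupI[OF wreath_group sub])
    have "((\<lambda>i\<in>{..<n}. \<one>), id) \<in> base_sub N n" using H by (auto simp: base_sub_def)
    then show "base_sub N n \<noteq> {}" by blast
    fix a assume a: "a \<in> base_sub N n"
    then have "a \<in> carrier (W n)" using sub by blast
    then show "inv\<^bsub>W n\<^esub> a \<in> base_sub N n"
      using a H by (cases a) (auto simp: wreath_inv base_sub_def PiE_iff inv_id)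
    fix b assume "b \<in> base_sub N n"
    then show "a \<otimes>\<^bsub>W n\<^esub> b \<in> base_sub N n"
      using a H by (cases a, cases b) (auto simp: wreath_mult base_sub_def PiE_iff inv_id)
  qed
qed

end

lemma base_sub_eq_image: "base_sub N n = (\<lambda>h. (h, id)) ` ({..<n} \<rightarrow>\<^sub>E N)"
  by (auto simp: base_sub_def)

lemma sum_base_sub: "(\<Sum>x\<in>base_sub N n. F x) = (\<Sum>h\<in>{..<n} \<rightarrow>\<^sub>E N. F (h, id))"
  unfolding base_sub_eq_image by (subst sum.reindex) (auto simp: inj_on_def)

lemma card_base_sub: "card (base_sub N n) = card N ^ n"
  unfolding base_sub_eq_image by (subst card_image) (auto simp: inj_on_def card_PiE)

text \<open>The factor at place \<open>i\<close> depends on \<open>i\<close> only through its block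
  \<open>bl i\<close>, and all blocks share \<open>K\<close>, \<open>N\<close> and the degree. This
  lets a block-preserving permutation exchange tensor factors.\<close>

locale wreath_rep = group G for G (structure) +
  fixes K N :: "'a set" and R :: "nat \<Rightarrow> 'a \<Rightarrow> complex mat" and \<delta> :: "nat \<Rightarrow> 'a \<Rightarrow> 'a \<Rightarrow> complex"
    and d n :: nat and bl :: "nat \<Rightarrow> nat"
  assumes factor: "i < n \<Longrightarrow> assoc_rep G K N (R (bl i)) (\<delta> (bl i)) d" and n_pos: "n > 0"
begin

text \<open>This will be the stabiliser of the product character, see \<open>stab_T\<close>. The
  explicit description allows the representation to be built before that character is
  introduced.\<close>

definition block_stab :: "((nat \<Rightarrow> 'a) \<times> (nat \<Rightarrow> nat)) set" where
  "block_stab = {(f, w). f \<in> {..<n} \<rightarrow>\<^sub>E K \<and> w permutes {..<n} \<and> (\<forall>i<n. bl (w i) = bl i)}"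

definition tensor_rep :: "(nat \<Rightarrow> 'a) \<times> (nat \<Rightarrow> nat) \<Rightarrow> complex mat" where
  "tensor_rep x = tens n d (\<lambda>i. R (bl i) (fst x i)) (snd x)"

definition tensor_fs :: "(nat \<Rightarrow> 'a) \<times> (nat \<Rightarrow> nat) \<Rightarrow> (nat \<Rightarrow> 'a) \<times> (nat \<Rightarrow> nat) \<Rightarrow> complex" where
  "tensor_fs x y = (\<Prod>i<n. \<delta> (bl i) (fst x i) (fst y (pinv (snd x) i)))"

lemma factor_0: "assoc_rep G K N (R (bl 0)) (\<delta> (bl 0)) d"
  using factor n_pos by blast

lemmas K_sub = assoc_rep.K_sub[OF factor_0] and N_sub = assoc_rep.N_sub[OF factor_0] and N_K = assoc_rep.N_K[OF factor_0]
  and K_closed = assoc_rep.K_closed[OF factor_0] and K_mult = assoc_rep.K_mult[OF factor_0]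
  and K_inv = assoc_rep.K_inv[OF factor_0] and K_one = assoc_rep.K_one[OF factor_0] and N_in_K = assoc_rep.N_in_K[OF factor_0]
  and conj_N = assoc_rep.conj_N[OF factor_0] and fin = assoc_rep.fin[OF factor_0] and d_pos = assoc_rep.d_pos[OF factor_0]

lemma block_stab_pair: "(f, w) \<in> block_stab \<longleftrightarrow>
    f \<in> {..<n} \<rightarrow>\<^sub>E K \<and> w permutes {..<n} \<and> (\<forall>i<n. bl (w i) = bl i)"
  by (simp add: block_stab_def)

lemma bl_pinv:
  assumes "(f, w) \<in> block_stab" "i < n"
  shows "bl (pinv w i) = bl i"
proof -
  have "pinv w i < n" "w (pinv w i) = i" using assms by (auto simp: block_stab_pair)
  then show ?thesis using assms by (metis block_stab_pair)
qed

lemma block_stab_carrier: "block_stab \<subseteq> carrier (wreath G n)"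
  using K_closed by (auto simp: block_stab_def wreath_carrier_pair PiE_iff)

lemma block_stab_subgroup: "subgroup block_stab (wreath G n)"
proof (rule group.subgroupI[OF wreath_group block_stab_carrier])
  have "((\<lambda>i\<in>{..<n}. \<one>), id) \<in> block_stab" using K_one by (auto simp: block_stab_pair permutes_id)
  then show "block_stab \<noteq> {}" by blast
  fix a assume a: "a \<in> block_stab"
  then have "a \<in> carrier (wreath G n)" using block_stab_carrier by blast
  then show "inv\<^bsub>wreath G n\<^esub> a \<in> block_stab"
    using a by (cases a) (auto simp: wreath_inv bl_pinv block_stab_pair[of _ "pinv _"] pinv_permutes,
      auto simp: block_stab_pair PiE_iff K_inv pinv_permutes)
  fix b assume b: "b \<in> block_stab"
  show "a \<otimes>\<^bsub>wreath G n\<^esub> b \<in> block_stab"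
    using a b by (cases a, cases b) (auto simp: wreath_mult block_stab_pair PiE_iff permutes_compose K_mult)
qed

lemma base_sub_block_stab: "base_sub N n \<subseteq> block_stab"
  using N_in_K by (auto simp: base_sub_def block_stab_def PiE_iff permutes_id)

text \<open>A sum over the base group of products over places is a product of sums over
  \<open>N\<close>, so the relation is the product of the relations of the factors. Distinct
  multi-indices differ at some place, where the corresponding factor vanishes.\<close>

lemma tensor_ortho: "ortho (wreath G n) (base_sub N n) (d ^ n) tensor_rep"
  unfolding ortho_def
proof (intro allI impI)
  fix a b c e assume l: "a < d ^ n" "b < d ^ n" "c < d ^ n" "e < d ^ n"
  let ?a = "idx n d a" and ?b = "idx n d b" and ?c = "idx n d c" and ?e = "idx n d e"
  have "of_nat (d ^ n) * (\<Sum>x\<in>base_sub N n. tensor_rep x $$ (a, b) * tensor_rep (inv\<^bsub>wreath G n\<^esub> x) $$ (c, e))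
    = of_nat d ^ n * (\<Sum>h\<in>{..<n} \<rightarrow>\<^sub>E N. \<Prod>i<n. R (bl i) (h i) $$ (?a i, ?b i) * R (bl i) (inv (h i)) $$ (?c i, ?e i))"
  proof -
    have "tensor_rep (h, id) $$ (a, b) * tensor_rep (inv\<^bsub>wreath G n\<^esub> (h, id)) $$ (c, e) =
      (\<Prod>i<n. R (bl i) (h i) $$ (?a i, ?b i) * R (bl i) (inv (h i)) $$ (?c i, ?e i))"
      if h: "h \<in> {..<n} \<rightarrow>\<^sub>E N" for h
    proof -
      have "(h, id) \<in> carrier (wreath G n)"
        using h N_in_K K_closed by (auto simp: wreath_carrier_pair PiE_iff permutes_id)
      then show ?thesis using l by (simp add: tensor_rep_def tens_index wreath_inv prod.distrib)
    qed
    then show ?thesis by (simp add: sum_base_sub)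
  qed
  also have "\<dots> = of_nat d ^ n * (\<Prod>i<n. \<Sum>h\<in>N. R (bl i) h $$ (?a i, ?b i) * R (bl i) (inv h) $$ (?c i, ?e i))"
    using fin by (subst prod_sum_PiE) auto
  also have "\<dots> = (\<Prod>i<n. of_nat d * (\<Sum>h\<in>N. R (bl i) h $$ (?a i, ?b i) * R (bl i) (inv h) $$ (?c i, ?e i)))"
    by (simp add: prod.distrib)
  also have "\<dots> = (\<Prod>i<n. if ?a i = ?e i \<and> ?b i = ?c i then of_nat (card N) else 0)"
    using assoc_rep.orth[OF factor] l by (intro prod.cong refl) (auto simp: ortho_def idx_lt)
  also have "\<dots> = (if (\<forall>i<n. ?a i = ?e i) \<and> (\<forall>i<n. ?b i = ?c i) then of_nat (card N) ^ n else 0)"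
    by (auto simp: prod_zero_iff)
  also have "\<dots> = (if a = e \<and> b = c then of_nat (card (base_sub N n)) else 0)"
    using l by (simp add: idx_eq_iff card_base_sub)
  finally show "of_nat (d ^ n) * (\<Sum>x\<in>base_sub N n. tensor_rep x $$ (a, b) * tensor_rep (inv\<^bsub>wreath G n\<^esub> x) $$ (c, e))
    = (if a = e \<and> b = c then of_nat (card (base_sub N n)) else 0)" .
qed

lemma base_conj:
  assumes x: "(f, w) \<in> carrier (wreath G n)" and fN: "\<And>i y. i < n \<Longrightarrow> y \<in> N \<Longrightarrow> f i \<otimes> y \<otimes> inv (f i) \<in> N"
    and y: "y \<in> base_sub N n"
  shows "(f, w) \<otimes>\<^bsub>wreath G n\<^esub> y \<otimes>\<^bsub>wreath G n\<^esub> inv\<^bsub>wreath G n\<^esub> (f, w) \<in> base_sub N n"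
proof -
  obtain h where h: "y = (h, id)" "h \<in> {..<n} \<rightarrow>\<^sub>E N" using y by (auto simp: base_sub_def)
  have h': "h \<in> {..<n} \<rightarrow>\<^sub>E carrier G" using h(2) N_in_K K_closed by (auto simp: PiE_iff)
  have w: "w permutes {..<n}" using x by (simp add: wreath_carrier_pair)
  show ?thesis
    unfolding h(1) wreath_conj_base[OF x h'] using h(2) fN w by (auto simp: base_sub_def PiE_iff)
qed

lemma tensor_assoc_rep: "assoc_rep (wreath G n) block_stab (base_sub N n) tensor_rep tensor_fs (d ^ n)"
proof -
  have c: "R (bl i) y \<in> carrier_mat d d" if "i < n" "y \<in> K" for i y
    using assoc_rep.P_carrier[OF factor] that by blast
  have mult: "tensor_rep x * tensor_rep y = tensor_fs x y \<cdot>\<^sub>m tensor_rep (x \<otimes>\<^bsub>wreath G n\<^esub> y)"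
    if xy: "x \<in> block_stab" "y \<in> block_stab" for x y
  proof -
    obtain f w g v where e: "x = (f, w)" "y = (g, v)" by (cases x, cases y)
    have f: "w permutes {..<n}" "v permutes {..<n}" "\<And>i. i < n \<Longrightarrow> f i \<in> K" "\<And>i. i < n \<Longrightarrow> g i \<in> K"
      using xy e by (auto simp: block_stab_pair PiE_iff)
    have "tensor_rep x * tensor_rep y = tens n d (\<lambda>i. R (bl i) (f i) * R (bl (pinv w i)) (g (pinv w i))) (w \<circ> v)"
      unfolding e tensor_rep_def fst_conv snd_conv using f c by (intro tens_mult) auto
    \<comment> \<open>Since \<open>w\<close> preserves blocks, the two matrices meeting at place
      \<open>i\<close> come from the same representation \<open>R (bl i)\<close> and can be combined
      by its factor set.\<close>
    also have "\<dots> = tens n d (\<lambda>i. \<delta> (bl i) (f i) (g (pinv w i)) \<cdot>\<^sub>m R (bl i) (f i \<otimes> g (pinv w i))) (w \<circ> v)"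
      using f xy(1) by (intro tens_cong) (simp add: e bl_pinv assoc_rep.P_mult[OF factor])
    also have "\<dots> = tensor_fs x y \<cdot>\<^sub>m tens n d (\<lambda>i. R (bl i) (f i \<otimes> g (pinv w i))) (w \<circ> v)"
      unfolding tensor_fs_def e fst_conv snd_conv
      using f c K_mult by (intro tens_smult) (auto simp: permutes_compose)
    also have "tens n d (\<lambda>i. R (bl i) (f i \<otimes> g (pinv w i))) (w \<circ> v) = tensor_rep (x \<otimes>\<^bsub>wreath G n\<^esub> y)"
      unfolding tensor_rep_def e wreath_mult by (auto intro: tens_cong)
    finally show ?thesis .
  qed
  have left: "tensor_fs x y = 1" if "x \<in> base_sub N n" "y \<in> block_stab" for x y
    using that by (auto simp: tensor_fs_def base_sub_def block_stab_def PiE_iff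
      intro!: prod.neutral assoc_rep.alpha_N_left[OF factor])
  have right: "tensor_fs y x = 1" if "x \<in> base_sub N n" "y \<in> block_stab" for x y
    using that by (auto simp: tensor_fs_def base_sub_def block_stab_def PiE_iff
      intro!: prod.neutral assoc_rep.alpha_N_right[OF factor])
  show ?thesis
    unfolding assoc_rep_def assoc_rep_axioms_def
  proof (intro conjI allI impI)
    fix k y assume "k \<in> block_stab" "y \<in> base_sub N n"
    then show "k \<otimes>\<^bsub>wreath G n\<^esub> y \<otimes>\<^bsub>wreath G n\<^esub> inv\<^bsub>wreath G n\<^esub> k \<in> base_sub N n"
      using block_stab_carrier conj_N by (cases k) (auto intro!: base_conj simp: block_stab_pair PiE_iff)
  next
    fix x assume "x \<in> block_stab"
    then show "Qab_mat (d ^ n) (tensor_rep x)"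
      unfolding tensor_rep_def
      by (auto simp: block_stab_def PiE_iff intro!: tens_Qab assoc_rep.P_Qab[OF factor])
  next
    show "tensor_rep \<one>\<^bsub>wreath G n\<^esub> = 1\<^sub>m (d ^ n)"
      unfolding tensor_rep_def wreath_one tens_one[symmetric] snd_conv
      by (rule tens_cong) (simp add: assoc_rep.P_one[OF factor])
  next
    fix x y assume "x \<in> block_stab" "y \<in> block_stab"
    then show "root_of_unity (tensor_fs x y)"
      unfolding tensor_fs_def
      by (intro root_of_unity_prod assoc_rep.root[OF factor]) (auto simp: block_stab_def PiE_iff)
  next
    show "finite (base_sub N n)" unfolding base_sub_eq_image using fin by (auto intro: finite_PiE)
  qed (use base_sub_block_stab mult left right in \<open>auto simp: wreath_group block_stab_subgroup
      base_sub_subgroup[OF N_sub] tensor_ortho d_pos one_smult_mat subset_iff\<close>)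
qed

end

section \<open>The function \<open>\<mu>\<close> of a tensor representation\<close>

lemma (in group) conj_decompose:
  assumes "x \<in> carrier G" "s \<in> carrier G" "g \<in> carrier G" "s' \<in> carrier G"
  shows "(x \<otimes> s) \<otimes> g \<otimes> inv (x \<otimes> s') = x \<otimes> (s \<otimes> g \<otimes> inv s') \<otimes> inv x"
  using assms by (simp add: m_assoc inv_mult_group)

text \<open>Data for an element \<open>(f, w)\<close> and an automorphism \<open>\<tau>\<close> that
  together fix the product character. Within a block all \<open>f (w j)\<close> share a
  representative \<open>x0 j\<close> up to a factor \<open>s j\<close> in \<open>K\<close>, and
  \<open>inv_char\<close> says that \<open>\<tau>\<close> and \<open>x0 j\<close> carry the
  character of the block of \<open>w j\<close> to that of the block of \<open>j\<close>.\<close>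

locale wreath_conj = wreath_rep +
  fixes f :: "nat \<Rightarrow> 'a" and w :: "nat \<Rightarrow> nat" and \<tau> :: "complex \<Rightarrow> complex" and x0 s :: "nat \<Rightarrow> 'a"
  assumes tau: "\<tau> \<in> galQab" and x_carrier: "(f, w) \<in> carrier (wreath G n)"
    and x0: "j < n \<Longrightarrow> x0 j \<in> carrier G"
    and x0K: "j < n \<Longrightarrow> y \<in> K \<Longrightarrow> x0 j \<otimes> y \<otimes> inv (x0 j) \<in> K"
    and x0N: "j < n \<Longrightarrow> y \<in> N \<Longrightarrow> x0 j \<otimes> y \<otimes> inv (x0 j) \<in> N"
    and s: "j < n \<Longrightarrow> s j \<in> K" and f_eq: "j < n \<Longrightarrow> f (w j) = x0 j \<otimes> s j"
    and blk: "i < n \<Longrightarrow> j < n \<Longrightarrow> bl i = bl j \<Longrightarrow> x0 i = x0 j \<and> bl (w i) = bl (w j)"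
    and inv_char: "j < n \<Longrightarrow> y \<in> N \<Longrightarrow>
      \<tau> (mtrace (R (bl (w j)) (x0 j \<otimes> y \<otimes> inv (x0 j)))) = mtrace (R (bl j) y)"
begin

definition Q where "Q j = (\<lambda>y. map_mat \<tau> (R (bl (w j)) (x0 j \<otimes> y \<otimes> inv (x0 j))))"

text \<open>The scalar of \<open>shifted_intertwiner\<close> at place \<open>j\<close>, with
  \<open>s j\<close> on the left and \<open>s (pinv v j)\<close> on the right; the two values of
  \<open>\<delta>\<close> pay for absorbing these elements into the intertwiner.\<close>

definition coeff where "coeff g v j =
  (let t = s j \<otimes> g j \<otimes> inv (s (pinv v j)) in
     ratio G N (Q j) (R (bl j)) t * \<delta> (bl j) t (s (pinv v j)) / \<delta> (bl j) (s j) (g j))"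

lemma w: "w permutes {..<n}"
  using x_carrier by (simp add: wreath_carrier_pair)

lemma pair:
  assumes j: "j < n"
  shows "assoc_rep_pair G K N (Q j)
    (\<lambda>y z. \<tau> (\<delta> (bl (w j)) (x0 j \<otimes> y \<otimes> inv (x0 j)) (x0 j \<otimes> z \<otimes> inv (x0 j)))) (R (bl j)) (\<delta> (bl j)) d"
proof -
  have wj: "w j < n" using w j by simp
  note r = factor[OF wj]
  have "assoc_rep G K N (\<lambda>y. R (bl (w j)) (x0 j \<otimes> y \<otimes> inv (x0 j)))
    (\<lambda>y z. \<delta> (bl (w j)) (x0 j \<otimes> y \<otimes> inv (x0 j)) (x0 j \<otimes> z \<otimes> inv (x0 j))) d"
    by (rule assoc_rep.conjugate[OF r x0[OF j] x0K[OF j] x0N[OF j]])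
  note t = assoc_rep.twist[OF this tau]
  have "mtrace (Q j y) = mtrace (R (bl j) y)" if y: "y \<in> N" for y
    using inv_char[OF j y] gal_mat_mtrace[OF tau assoc_rep.P_Qab[OF r N_in_K[OF x0N[OF j y]]]]
    by (simp add: Q_def)
  then show ?thesis
    using t factor[OF j] unfolding assoc_rep_pair_def assoc_rep_pair_axioms_def Q_def by blast
qed

lemma coeff_N:
  assumes g: "\<And>j. j < n \<Longrightarrow> g j \<in> N" and j: "j < n"
  shows "coeff g id j = 1"
proof -
  interpret p: assoc_rep_pair G K N "Q j"
    "\<lambda>y z. \<tau> (\<delta> (bl (w j)) (x0 j \<otimes> y \<otimes> inv (x0 j)) (x0 j \<otimes> z \<otimes> inv (x0 j)))" "R (bl j)" "\<delta> (bl j)" d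
    by (rule pair[OF j])
  have t: "s j \<otimes> g j \<otimes> inv (s j) \<in> N" using conj_N s g j by blast
  have "ratio G N (Q j) (R (bl j)) (s j \<otimes> g j \<otimes> inv (s j)) = 1"
    by (rule p.intertwiner) (use t in blast)
  then show ?thesis
    using p.R.alpha_N_left[OF t s[OF j]] p.R.alpha_N_right[OF g[OF j] s[OF j]]
    by (simp add: coeff_def Let_def inv_id)
qed

text \<open>The description mentions \<open>j\<close> only through \<open>Q j\<close> and
  \<open>R (bl j)\<close>, and both depend on the block alone. Choosing with \<open>SOME\<close>
  therefore gives equal intertwiners throughout a block, which unrelated choices at the places would
  not.\<close>

definition twiner :: "nat \<Rightarrow> complex mat \<times> complex mat" where
  "twiner j = (SOME (C, C'). C \<in> carrier_mat d d \<and> C' \<in> carrier_mat d d \<and> C * C' = 1\<^sub>m d \<and> C' * C = 1\<^sub>m d \<and>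
    (\<forall>y\<in>K. Q j y * C = ratio G N (Q j) (R (bl j)) y \<cdot>\<^sub>m (C * R (bl j) y)))"

lemma twiner:
  assumes j: "j < n"
  obtains C C' where "twiner j = (C, C')" "C \<in> carrier_mat d d" "C' \<in> carrier_mat d d" "C * C' = 1\<^sub>m d" "C' * C = 1\<^sub>m d"
    "\<And>y. y \<in> K \<Longrightarrow> Q j y * C = ratio G N (Q j) (R (bl j)) y \<cdot>\<^sub>m (C * R (bl j) y)"
proof -
  have "\<exists>CC. case CC of (C, C') \<Rightarrow> C \<in> carrier_mat d d \<and> C' \<in> carrier_mat d d \<and> C * C' = 1\<^sub>m d \<and> C' * C = 1\<^sub>m d \<and>
    (\<forall>y\<in>K. Q j y * C = ratio G N (Q j) (R (bl j)) y \<cdot>\<^sub>m (C * R (bl j) y))"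
    by (rule assoc_rep_pair.intertwiner[OF pair[OF j]]) blast
  then have "case twiner j of (C, C') \<Rightarrow> C \<in> carrier_mat d d \<and> C' \<in> carrier_mat d d \<and> C * C' = 1\<^sub>m d \<and> C' * C = 1\<^sub>m d \<and>
    (\<forall>y\<in>K. Q j y * C = ratio G N (Q j) (R (bl j)) y \<cdot>\<^sub>m (C * R (bl j) y))"
    unfolding twiner_def by (rule someI_ex)
  then show thesis using that by (cases "twiner j") auto
qed

lemma Q_block: "i < n \<Longrightarrow> j < n \<Longrightarrow> bl i = bl j \<Longrightarrow> Q i = Q j"
  using blk[of i j] by (simp add: Q_def)

lemma twiner_block: "i < n \<Longrightarrow> j < n \<Longrightarrow> bl i = bl j \<Longrightarrow> twiner i = twiner j"
  using Q_block[of i j] by (simp add: twiner_def)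

text \<open>The intertwiner of the block, corrected for the difference between
  \<open>f (w j)\<close> and the representative \<open>x0 j\<close>.\<close>

definition D where "D j = fst (twiner j) * R (bl j) (s j)"

lemma D_carrier: "j < n \<Longrightarrow> D j \<in> carrier_mat d d"
  using assoc_rep.P_carrier[OF factor s, of j j] by (auto simp: D_def elim!: twiner[of j])

lemma D_invertible:
  assumes j: "j < n"
  shows "\<exists>E. E \<in> carrier_mat d d \<and> D j * E = 1\<^sub>m d \<and> E * D j = 1\<^sub>m d"
proof -
  obtain C C' where C: "twiner j = (C, C')" "C \<in> carrier_mat d d" "C' \<in> carrier_mat d d" "C * C' = 1\<^sub>m d" "C' * C = 1\<^sub>m d"
    by (rule twiner[OF j])
  let ?R = "R (bl j) (s j)"
  obtain Y where Y: "Y \<in> carrier_mat d d" "?R * Y = 1\<^sub>m d" "Y * ?R = 1\<^sub>m d"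
    using assoc_rep.P_invertible[OF factor[OF j] s[OF j]] by blast
  note c = C(2,3) Y(1) assoc_rep.P_carrier[OF factor[OF j] s[OF j]]
  have "C * ?R * (Y * C') = C * (?R * Y) * C'" "(Y * C') * (C * ?R) = Y * (C' * C) * ?R"
    using c by (simp_all add: assoc_mult_mat[of _ d d _ d _ d])
  then show ?thesis
    using c C Y by (intro exI[of _ "Y * C'"]) (auto simp: D_def)
qed

text \<open>\<open>D\<close> occurs at \<open>pinv v j\<close> on the left and at \<open>j\<close>
  on the right. Both places lie in one block, so they share the intertwiner and \<open>x0\<close>,
  and the relation is an instance of \<open>shifted_intertwiner\<close>.\<close>

lemma D_step:
  assumes g: "(g, v) \<in> block_stab" and j: "j < n"
  shows "map_mat \<tau> (R (bl (w j)) (f (w j) \<otimes> g j \<otimes> inv (f (w (pinv v j))))) * D (pinv v j)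
    = coeff g v j \<cdot>\<^sub>m (D j * R (bl j) (g j))"
proof -
  let ?j = "pinv v j"
  have v: "v permutes {..<n}" and gK: "g j \<in> K" using g j by (auto simp: block_stab_pair)
  have j': "?j < n" "bl ?j = bl j" using v j bl_pinv[OF g j] by auto
  have x0': "x0 ?j = x0 j" using blk[OF j'(1) j j'(2)] by simp
  obtain C C' where C: "twiner j = (C, C')" "C \<in> carrier_mat d d"
     "\<And>y. y \<in> K \<Longrightarrow> Q j y * C = ratio G N (Q j) (R (bl j)) y \<cdot>\<^sub>m (C * R (bl j) y)"
    by (rule twiner[OF j]) blast
  have D: "D j = C * R (bl j) (s j)" "D ?j = C * R (bl j) (s ?j)"
    using C(1) twiner_block[OF j'(1) j j'(2)] j'(2) by (auto simp: D_def)
  have e: "f (w j) \<otimes> g j \<otimes> inv (f (w ?j)) = x0 j \<otimes> (s j \<otimes> g j \<otimes> inv (s ?j)) \<otimes> inv (x0 j)"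
    unfolding f_eq[OF j] f_eq[OF j'(1)] x0'
    using x0[OF j] s[OF j] s[OF j'(1)] gK K_closed by (intro conj_decompose) auto
  show ?thesis
    unfolding e D coeff_def Let_def
    using assoc_rep_pair.shifted_intertwiner[OF pair[OF j] C(2,3) s[OF j] s[OF j'(1)] gK]
    by (simp add: Q_def)
qed

lemma conj_base: "y \<in> base_sub N n \<Longrightarrow>
    (f, w) \<otimes>\<^bsub>wreath G n\<^esub> y \<otimes>\<^bsub>wreath G n\<^esub> inv\<^bsub>wreath G n\<^esub> (f, w) \<in> base_sub N n"
proof (rule base_conj[OF x_carrier])
  fix i y assume i: "i < n" and y: "y \<in> N"
  let ?j = "pinv w i"
  have j: "?j < n" "w ?j = i" using i w by auto
  have "f i \<otimes> y \<otimes> inv (f i) = x0 ?j \<otimes> (s ?j \<otimes> y \<otimes> inv (s ?j)) \<otimes> inv (x0 ?j)"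
    using f_eq[OF j(1)] j(2) conj_decompose[OF x0[OF j(1)] K_closed[OF s[OF j(1)]] K_closed[OF N_in_K[OF y]] K_closed[OF s[OF j(1)]]]
    by simp
  then show "f i \<otimes> y \<otimes> inv (f i) \<in> N" using x0N[OF j(1)] conj_N[OF s[OF j(1)] y] by simp
qed

text \<open>The two values of \<open>f\<close> belong to images of places in one block, so they
  share the representative \<open>x0\<close>; what remains is an element of \<open>K\<close>
  conjugated by it.\<close>

lemma conj_factor:
  assumes g: "(g, v) \<in> block_stab" and i: "i < n"
  shows "f i \<otimes> g (pinv w i) \<otimes> inv (f (w (pinv v (pinv w i)))) \<in> K"
proof -
  let ?j = "pinv w i" and ?k = "pinv v (pinv w i)"
  have v: "v permutes {..<n}" using g by (simp add: block_stab_pair)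
  have j: "?j < n" "w ?j = i" "?k < n" using i w v by auto
  have gK: "g ?j \<in> K" using g j by (auto simp: block_stab_pair)
  have x0': "x0 ?k = x0 ?j" using blk[OF j(3,1)] bl_pinv[OF g j(1)] by simp
  have "f i \<otimes> g ?j \<otimes> inv (f (w ?k)) = x0 ?j \<otimes> (s ?j \<otimes> g ?j \<otimes> inv (s ?k)) \<otimes> inv (x0 ?j)"
    using f_eq[OF j(1)] f_eq[OF j(3)] j(2) x0'
      conj_decompose[OF x0[OF j(1)] K_closed[OF s[OF j(1)]] K_closed[OF gK] K_closed[OF s[OF j(3)]]]
    by simp
  then show ?thesis using x0K[OF j(1)] K_mult K_inv s[OF j(1)] s[OF j(3)] gK by simp
qed

lemma conj_block_stab:
  assumes y: "y \<in> block_stab"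
  shows "(f, w) \<otimes>\<^bsub>wreath G n\<^esub> y \<otimes>\<^bsub>wreath G n\<^esub> inv\<^bsub>wreath G n\<^esub> (f, w) \<in> block_stab"
proof -
  obtain g v where e: "y = (g, v)" by (cases y)
  have g: "(g, v) \<in> block_stab" using y e by simp
  then have v: "v permutes {..<n}" and gc: "(g, v) \<in> carrier (wreath G n)"
    using block_stab_carrier by (auto simp: block_stab_pair)
  have "bl (w (v (pinv w i))) = bl i" if i: "i < n" for i
  proof -
    have j: "pinv w i < n" "v (pinv w i) < n" using w v i by auto
    have "bl (w (v (pinv w i))) = bl (w (pinv w i))"
      using blk[OF j(2,1)] g j by (simp add: block_stab_pair)
    then show ?thesis using w by simp
  qed
  then show ?thesis
    unfolding e wreath_conj[OF x_carrier gc]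
    using conj_factor[OF g] w v by (auto simp: block_stab_pair permutes_compose pinv_permutes)
qed

text \<open>The tensor of the \<open>D j\<close> together with the place permutation
  \<open>w\<close> is an intertwiner, place by place through \<open>D_step\<close>. The scalars come
  out as a product, which \<open>ratio_eq\<close> identifies with the value of
  \<open>mu_fun\<close>.\<close>

lemma mu_fun_wreath:
  assumes y: "(g, v) \<in> block_stab"
  shows "mu_fun (wreath G n) block_stab (base_sub N n) (d ^ n) tensor_rep (f, w) \<tau> (g, v) = (\<Prod>j<n. coeff g v j)"
proof -
  let ?W = "wreath G n" and ?x = "(f, w)"
  interpret T: assoc_rep ?W block_stab "base_sub N n" tensor_rep tensor_fs "d ^ n"
    by (rule tensor_assoc_rep)
  let ?Q = "\<lambda>y. map_mat \<tau> (tensor_rep (?x \<otimes>\<^bsub>?W\<^esub> y \<otimes>\<^bsub>?W\<^esub> inv\<^bsub>?W\<^esub> ?x))"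
  \<comment> \<open>\<open>D j\<close> leads from place \<open>j\<close> to place
    \<open>w j\<close>, so it stands at the output place \<open>i = w j\<close>.\<close>
  let ?C = "tens n d (\<lambda>i. D (pinv w i)) w"
  obtain E where E: "\<And>j. j < n \<Longrightarrow> E j \<in> carrier_mat d d" "\<And>j. j < n \<Longrightarrow> D j * E j = 1\<^sub>m d"
    "\<And>j. j < n \<Longrightarrow> E j * D j = 1\<^sub>m d"
    using D_invertible by metis
  let ?C' = "tens n d E (pinv w)"
  have ww: "w \<circ> pinv w = id" "pinv w \<circ> w = id" using w by (auto simp: fun_eq_iff)
  have C1: "?C * ?C' = 1\<^sub>m (d ^ n)"
    using w D_carrier E(1,2) unfolding tens_one[symmetric]
    by (subst tens_mult) (auto simp: pinv_permutes ww intro!: tens_cong)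
  have C2: "?C' * ?C = 1\<^sub>m (d ^ n)"
    using w D_carrier E(1,3) unfolding tens_one[symmetric]
    by (subst tens_mult) (auto simp: pinv_permutes pinv_pinv ww intro!: tens_cong)
  have step: "?Q (g, v) * ?C = (\<Prod>j<n. coeff g v j) \<cdot>\<^sub>m (?C * tensor_rep (g, v))"
    if g: "(g, v) \<in> block_stab" for g v
  proof -
    have v: "v permutes {..<n}" and gK: "\<And>i. i < n \<Longrightarrow> g i \<in> K" and gc: "(g, v) \<in> carrier ?W"
      using g block_stab_carrier by (auto simp: block_stab_pair)
    let ?z = "\<lambda>i. f i \<otimes> g (pinv w i) \<otimes> inv (f (w (pinv v (pinv w i))))"
    let ?u = "w \<circ> v \<circ> pinv w"
    have u: "?u permutes {..<n}" using w v by (intro permutes_compose pinv_permutes)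
    have Rz: "Qab_mat d (R (bl i) (?z i))" if "i < n" for i
      using assoc_rep.P_Qab[OF factor[OF that] conj_factor[OF g that]] .
    have Rz': "map_mat \<tau> (R (bl i) (?z i)) \<in> carrier_mat d d" if "i < n" for i
      using gal_mat_Qab_mat[OF tau Rz[OF that]] Qab_mat_carrier by blast
    have Rg: "R (bl i) (g i) \<in> carrier_mat d d" if "i < n" for i
      using assoc_rep.P_carrier[OF factor[OF that] gK[OF that]] .
    have "?Q (g, v) = map_mat \<tau> (tens n d (\<lambda>i. R (bl i) (?z i)) ?u)"
      unfolding wreath_conj[OF x_carrier gc] tensor_rep_def fst_conv snd_conv
      by (intro arg_cong[where f = "map_mat \<tau>"] tens_cong) simp
    also have "\<dots> = tens n d (\<lambda>i. map_mat \<tau> (R (bl i) (?z i))) ?u"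
      by (rule tens_map[OF tau Rz u])
    finally have "?Q (g, v) * ?C = tens n d (\<lambda>i. map_mat \<tau> (R (bl i) (?z i)) * D (pinv w (pinv ?u i))) (?u \<circ> w)"
      using D_carrier w u Rz' by (simp add: tens_mult)
    also have "?u \<circ> w = w \<circ> v" using w by (auto simp: fun_eq_iff)
    also have "tens n d (\<lambda>i. map_mat \<tau> (R (bl i) (?z i)) * D (pinv w (pinv ?u i))) (w \<circ> v) =
       tens n d (\<lambda>i. coeff g v (pinv w i) \<cdot>\<^sub>m (D (pinv w i) * R (bl (pinv w i)) (g (pinv w i)))) (w \<circ> v)"
    proof (rule tens_cong)
      fix i assume i: "i < n"
      have j: "pinv w i < n" "w (pinv w i) = i" using i w by auto
      have "pinv w (pinv ?u i) = pinv v (pinv w i)"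
        using pinv_comp[OF permutes_compose[OF v w] pinv_permutes[OF w]] pinv_comp[OF w v] pinv_pinv[OF w] w
        by simp
      then show "map_mat \<tau> (R (bl i) (?z i)) * D (pinv w (pinv ?u i)) =
        coeff g v (pinv w i) \<cdot>\<^sub>m (D (pinv w i) * R (bl (pinv w i)) (g (pinv w i)))"
        using D_step[OF g j(1)] j(2) by simp
    qed
    also have "\<dots> = (\<Prod>i<n. coeff g v (pinv w i)) \<cdot>\<^sub>m
        tens n d (\<lambda>i. D (pinv w i) * R (bl (pinv w i)) (g (pinv w i))) (w \<circ> v)"
      using w v by (intro tens_smult mult_carrier_mat[of _ d d _ d] D_carrier Rg) (auto simp: permutes_compose)
    also have "(\<Prod>i<n. coeff g v (pinv w i)) = (\<Prod>j<n. coeff g v j)"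
      by (rule prod_permute[OF pinv_permutes[OF w]])
    also have "tens n d (\<lambda>i. D (pinv w i) * R (bl (pinv w i)) (g (pinv w i))) (w \<circ> v) = ?C * tensor_rep (g, v)"
      using D_carrier Rg w v by (simp add: tensor_rep_def tens_mult)
    finally show ?thesis .
  qed
  \<comment> \<open>Invariance of the tensor character is read off from \<open>step\<close>: on the
    base group all coefficients are 1, so the two representations are similar there.\<close>
  have char: "\<tau> (mtrace (tensor_rep (?x \<otimes>\<^bsub>?W\<^esub> y \<otimes>\<^bsub>?W\<^esub> inv\<^bsub>?W\<^esub> ?x))) = mtrace (tensor_rep y)"
    if y: "y \<in> base_sub N n" for y
  proof -
    obtain h where h: "y = (h, id)" "h \<in> {..<n} \<rightarrow>\<^sub>E N" using y by (auto simp: base_sub_def)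
    have K: "(h, id) \<in> block_stab" using y h base_sub_block_stab by auto
    have "(\<Prod>j<n. coeff h id j) = 1" using h by (intro prod.neutral) (auto intro!: coeff_N)
    then have "?Q y * ?C = ?C * tensor_rep y" using step[OF K] h(1) by (simp add: one_smult_mat)
    then have "?Q y * ?C * ?C' = ?C * tensor_rep y * ?C'" by simp
    moreover have Qc: "Qab_mat (d ^ n) (tensor_rep (?x \<otimes>\<^bsub>?W\<^esub> y \<otimes>\<^bsub>?W\<^esub> inv\<^bsub>?W\<^esub> ?x))"
      using T.P_Qab[OF conj_block_stab] K h(1) by simp
    moreover have "?Q y * ?C * ?C' = ?Q y"
      using C1 Qab_mat_carrier[OF gal_mat_Qab_mat[OF tau Qc]] by (simp add: assoc_mult_mat[of _ "d ^ n" "d ^ n" _ "d ^ n" _ "d ^ n"])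
    ultimately have "mtrace (?Q y) = mtrace (?C * tensor_rep y * ?C')" by simp
    also have "\<dots> = mtrace (tensor_rep y)"
      using T.P_carrier[OF K] h(1) C2 by (intro mtrace_conj[of _ "d ^ n"]) auto
    finally show ?thesis using gal_mat_mtrace[OF tau Qc] by simp
  qed
  have pr: "assoc_rep_pair ?W block_stab (base_sub N n) ?Q
     (\<lambda>y z. \<tau> (tensor_fs (?x \<otimes>\<^bsub>?W\<^esub> y \<otimes>\<^bsub>?W\<^esub> inv\<^bsub>?W\<^esub> ?x) (?x \<otimes>\<^bsub>?W\<^esub> z \<otimes>\<^bsub>?W\<^esub> inv\<^bsub>?W\<^esub> ?x)))
     tensor_rep tensor_fs (d ^ n)"
    by (rule T.twisted_pair_id[OF tau x_carrier conj_block_stab conj_base char])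
  have "ratio ?W (base_sub N n) ?Q tensor_rep (g, v) = (\<lambda>(g, v). \<Prod>j<n. coeff g v j) (g, v)"
  proof (rule assoc_rep_pair.ratio_eq(1)[OF pr _ _ C1 C2 _ _ y])
    fix y assume "y \<in> block_stab"
    then show "?Q y * ?C = (case y of (g, v) \<Rightarrow> \<Prod>j<n. coeff g v j) \<cdot>\<^sub>m (?C * tensor_rep y)"
      using step by (cases y) auto
  next
    fix y assume "y \<in> base_sub N n"
    then show "(case y of (g, v) \<Rightarrow> \<Prod>j<n. coeff g v j) = 1"
      by (auto simp: base_sub_def intro!: prod.neutral coeff_N)
  qed auto
  then show ?thesis using T.mu_fun_eq[OF pr y] by simp
qed

end

section \<open>Character triples in wreath products\<close>

context group
begin

abbreviation cj where "cj g x \<equiv> g \<otimes> x \<otimes> inv g"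

lemma cj_mult: "g \<in> carrier G \<Longrightarrow> h \<in> carrier G \<Longrightarrow> x \<in> carrier G \<Longrightarrow> cj (g \<otimes> h) x = cj g (cj h x)"
  by (simp add: m_assoc inv_mult_group)

lemma cj_inverse:
  assumes "g \<in> carrier G" "x \<in> carrier G"
  shows "cj (inv g) (cj g x) = x" "cj g (cj (inv g) x) = x"
  using cj_mult[of "inv g" g x] cj_mult[of g "inv g" x] assms by simp_all

lemma normal_in_iff:
  assumes K: "subgroup K G"
  shows "normal N (G\<lparr>carrier := K\<rparr>) \<longleftrightarrow>
    subgroup N G \<and> N \<subseteq> K \<and> (\<forall>x\<in>K. \<forall>h\<in>N. cj x h \<in> N)"
proof -
  have "subgroup N (G\<lparr>carrier := K\<rparr>) \<longleftrightarrow> subgroup N G \<and> N \<subseteq> K"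
    using incl_subgroup[OF K] subgroup_incl[OF _ K] subgroup.subset[of N "G\<lparr>carrier := K\<rparr>"] by auto
  then show ?thesis
    using group.normal_inv_iff[OF subgroup_imp_group[OF K], of N] m_inv_consistent[OF K] by auto
qed

lemma char_act_eq_iff:
  assumes "\<And>x. x \<notin> N \<Longrightarrow> \<theta> x = 0"
  shows "char_act G N \<theta> g \<tau> = \<theta> \<longleftrightarrow> (\<forall>x\<in>N. \<tau> (\<theta> (cj g x)) = \<theta> x)"
  using assms by (auto simp: char_act_def fun_eq_iff)

lemma stab_iff:
  assumes "\<And>x. x \<notin> N \<Longrightarrow> \<theta> x = 0"
  shows "g \<in> stab G K N \<theta> \<longleftrightarrow> g \<in> K \<and> (\<forall>x\<in>N. \<theta> (cj g x) = \<theta> x)"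
  using char_act_eq_iff[of N \<theta> g id] assms by (simp add: stab_def)

text \<open>Moving the automorphism to the other side replaces it by its inverse, which is again in
  \<open>Hgal p\<close>. The set \<open>stab_orb\<close> is thus a projection of the joint
  stabiliser, which gives its subgroup property.\<close>

lemma stab_orb_iff:
  assumes p: "Factorial_Ring.prime p" and N: "N \<subseteq> carrier G" and z: "\<And>x. x \<notin> N \<Longrightarrow> \<theta> x = 0"
  shows "g \<in> stab_orb p G K N \<theta> \<longleftrightarrow> g \<in> K \<and> (\<exists>\<tau>\<in>Hgal p. char_act G N \<theta> g \<tau> = \<theta>)"
proof -
  have *: "char_act G N \<theta> g id = char_act G N \<theta> \<one> \<tau> \<longleftrightarrow> char_act G N \<theta> g (inv_into UNIV \<tau>) = \<theta>"
    if t: "\<tau> \<in> galQab" for \<tau>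
  proof -
    have b: "inv_into UNIV \<tau> (\<tau> z) = z" "\<tau> (inv_into UNIV \<tau> z) = z" for z
      using galQab_bij[OF t] by (auto simp: bij_def surj_f_inv_f)
    have "char_act G N \<theta> g id = char_act G N \<theta> \<one> \<tau> \<longleftrightarrow> (\<forall>x\<in>N. \<theta> (cj g x) = \<tau> (\<theta> x))"
      using N by (auto simp: char_act_def fun_eq_iff)
    also have "\<dots> \<longleftrightarrow> (\<forall>x\<in>N. inv_into UNIV \<tau> (\<theta> (cj g x)) = \<theta> x)"
      using b by metis
    finally show ?thesis using char_act_eq_iff[OF z] by simp
  qed
  have "(\<exists>\<tau>\<in>Hgal p. char_act G N \<theta> g id = char_act G N \<theta> \<one> \<tau>) \<longleftrightarrow> (\<exists>\<tau>\<in>Hgal p. char_act G N \<theta> g \<tau> = \<theta>)"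
  proof
    assume "\<exists>\<tau>\<in>Hgal p. char_act G N \<theta> g id = char_act G N \<theta> \<one> \<tau>"
    then show "\<exists>\<tau>\<in>Hgal p. char_act G N \<theta> g \<tau> = \<theta>"
      using * Hgal_galQab Hgal_inv[OF p] by metis
  next
    assume "\<exists>\<tau>\<in>Hgal p. char_act G N \<theta> g \<tau> = \<theta>"
    then obtain \<tau> where t: "\<tau> \<in> Hgal p" "char_act G N \<theta> g \<tau> = \<theta>" by blast
    have "inv_into UNIV (inv_into UNIV \<tau>) = \<tau>"
      using galQab_bij[OF Hgal_galQab[OF t(1)]] by (rule inv_inv_eq)
    then show "\<exists>\<tau>\<in>Hgal p. char_act G N \<theta> g id = char_act G N \<theta> \<one> \<tau>"
      using *[OF Hgal_galQab[OF Hgal_inv[OF p t(1)]]] t Hgal_inv[OF p t(1)] by metis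
  qed
  then show ?thesis unfolding stab_orb_def Horbit_def by auto
qed

context
  fixes p :: nat and K N :: "'a set" and \<theta> :: "'a \<Rightarrow> complex"
  assumes p: "Factorial_Ring.prime p" and K: "subgroup K G" and N: "N \<subseteq> carrier G"
    and cN: "\<And>g x. g \<in> K \<Longrightarrow> x \<in> N \<Longrightarrow> cj g x \<in> N" and z: "\<And>x. x \<notin> N \<Longrightarrow> \<theta> x = 0"
begin

lemma char_act_fixed_iff: "char_act G N \<theta> g \<tau> = \<theta> \<longleftrightarrow> (\<forall>x\<in>N. \<tau> (\<theta> (cj g x)) = \<theta> x)"
  by (rule char_act_eq_iff[OF z])

lemma char_act_compose:
  assumes g: "g \<in> K" "char_act G N \<theta> g \<tau> = \<theta>" and h: "h \<in> K" "char_act G N \<theta> h \<rho> = \<theta>"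
  shows "char_act G N \<theta> (g \<otimes> h) (\<rho> \<circ> \<tau>) = \<theta>"
proof -
  note K' = subgroup.mem_carrier[OF K]
  have "(\<rho> \<circ> \<tau>) (\<theta> (cj (g \<otimes> h) x)) = \<theta> x" if x: "x \<in> N" for x
  proof -
    have "cj (g \<otimes> h) x = cj g (cj h x)" using cj_mult K' g h x N by blast
    then show ?thesis using g(2) h(2) cN[OF h(1) x] x by (simp add: char_act_fixed_iff)
  qed
  then show ?thesis by (simp add: char_act_fixed_iff)
qed

lemma char_act_inverse:
  assumes g: "g \<in> K" "char_act G N \<theta> g \<tau> = \<theta>" and t: "\<tau> \<in> galQab"
  shows "char_act G N \<theta> (inv g) (inv_into UNIV \<tau>) = \<theta>"
proof -
  note K' = subgroup.mem_carrier[OF K]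
  have b: "inv_into UNIV \<tau> (\<tau> z) = z" for z
    using galQab_bij[OF t] by (auto simp: bij_def)
  have "inv_into UNIV \<tau> (\<theta> (cj (inv g) x)) = \<theta> x" if x: "x \<in> N" for x
  proof -
    have y: "cj (inv g) x \<in> N" using cN[OF subgroup.m_inv_closed[OF K g(1)] x] .
    have "\<tau> (\<theta> (cj g (cj (inv g) x))) = \<theta> (cj (inv g) x)"
      using g(2) y by (simp only: char_act_fixed_iff)
    moreover have "cj g (cj (inv g) x) = x" using cj_inverse(2) K'[OF g(1)] x N by blast
    ultimately have "\<tau> (\<theta> x) = \<theta> (cj (inv g) x)" by simp
    then show ?thesis using b by metis
  qed
  then show ?thesis unfolding char_act_fixed_iff by blast
qed

lemma char_act_one: "char_act G N \<theta> \<one> id = \<theta>"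
  using N by (auto simp: char_act_fixed_iff)

lemma stab_orb_subgroup: "subgroup (stab_orb p G K N \<theta>) G"
proof (rule subgroupI)
  have iff: "g \<in> stab_orb p G K N \<theta> \<longleftrightarrow> g \<in> K \<and> (\<exists>\<tau>\<in>Hgal p. char_act G N \<theta> g \<tau> = \<theta>)" for g
    by (rule stab_orb_iff[OF p N z])
  show "stab_orb p G K N \<theta> \<subseteq> carrier G" using subgroup.subset[OF K] by (auto simp: stab_orb_def)
  have "\<one> \<in> stab_orb p G K N \<theta>"
    unfolding iff using subgroup.one_closed[OF K] char_act_one Hgal_id by blast
  then show "stab_orb p G K N \<theta> \<noteq> {}" by blast
  fix a assume a: "a \<in> stab_orb p G K N \<theta>"
  then show "inv a \<in> stab_orb p G K N \<theta>"
    unfolding iff using subgroup.m_inv_closed[OF K] char_act_inverse Hgal_inv[OF p] Hgal_galQab by blast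
  fix b assume "b \<in> stab_orb p G K N \<theta>"
  with a show "a \<otimes> b \<in> stab_orb p G K N \<theta>"
    unfolding iff using subgroup.m_closed[OF K] char_act_compose Hgal_comp[OF p] by blast
qed

lemma stab_subgroup: "subgroup (stab G K N \<theta>) G"
proof (rule subgroupI)
  show "stab G K N \<theta> \<subseteq> carrier G" using subgroup.subset[OF K] by (auto simp: stab_def)
  have "\<one> \<in> stab G K N \<theta>"
    using subgroup.one_closed[OF K] char_act_one by (simp add: stab_def)
  then show "stab G K N \<theta> \<noteq> {}" by blast
  fix a assume a: "a \<in> stab G K N \<theta>"
  then show "inv a \<in> stab G K N \<theta>"
    using subgroup.m_inv_closed[OF K] char_act_inverse[OF _ _ galQab_id] by (simp add: stab_def inv_id)
  fix b assume "b \<in> stab G K N \<theta>"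
  with a show "a \<otimes> b \<in> stab G K N \<theta>"
    using subgroup.m_closed[OF K] char_act_compose[of a id b id] by (simp add: stab_def)
qed

end

lemma assoc_repI:
  assumes "subgroup K G" "subgroup N G" "N \<subseteq> K" "finite N" and cN: "\<And>g x. g \<in> K \<Longrightarrow> x \<in> N \<Longrightarrow> cj g x \<in> N"
    and \<theta>: "\<theta> \<in> Irr G N"
    and P: "proj_rep G K d P \<alpha>" "associated G K N \<theta> d P" "entries_in_Qab K d P"
    and root: "\<forall>x\<in>K. \<forall>y\<in>K. root_of_unity (\<alpha> x y)"
  shows "assoc_rep G K N P \<alpha> d"
proof -
  interpret finite_subgroup N G by (simp add: finite_subgroup_def finite_subgroup_axioms_def is_group assms)
  obtain d0 \<rho> where r: "irred_rep G N d0 \<rho>" "\<theta> = afforded N \<rho>" using \<theta> by (auto simp: Irr_def)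
  have rep: "is_rep G N d P" and a: "afforded N P = \<theta>" using P(2) by (auto simp: associated_def)
  have "mtrace (P x) = mtrace (\<rho> x)" if "x \<in> N" for x
    using fun_cong[OF a, of x] r(2) that by (simp add: afforded_def)
  note o = ortho_if_irreducible_character[OF r(1) rep this]
  show ?thesis
    using assms o rep unfolding assoc_rep_def assoc_rep_axioms_def
    by (auto simp: proj_rep_def associated_def entries_in_Qab_def is_rep_def Qab_mat_def is_group)
qed

end

context assoc_rep
begin

lemma proj_rep: "proj_rep \<Gamma> K d P \<alpha>"
  unfolding proj_rep_def using P_carrier P_invertible_mat P_mult by blast

lemma associated: "afforded N P = \<theta> \<Longrightarrow> associated \<Gamma> K N \<theta> d P"
  unfolding associated_def using rep P_left P_right by blast

lemma entries: "entries_in_Qab K d P"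
  unfolding entries_in_Qab_def using P_Qab by (auto simp: Qab_mat_def)

end

text \<open>Instantiated twice: with \<open>K0\<close> the whole group for \<open>\<theta>\<close>,
  and with \<open>K0 = H\<close> for \<open>\<phi>\<close>. Everything about a single triple is
  proved for both sides at once, and the two resulting formulas for \<mu> have the same
  shape.\<close>

locale wreath_triple = group G for G (structure) +
  fixes p :: nat and K0 N :: "'a set" and \<theta> :: "'a \<Rightarrow> complex" and P \<alpha> d and \<sigma> :: "nat \<Rightarrow> complex \<Rightarrow> complex"
    and m k :: nat
  assumes p: "Factorial_Ring.prime p" and K0: "subgroup K0 G" and N_K0: "N \<subseteq> K0"
    and conj_N0: "g \<in> K0 \<Longrightarrow> x \<in> N \<Longrightarrow> cj g x \<in> N"
    and aff: "\<theta> = afforded N P"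
    and ar: "assoc_rep G (stab G K0 N \<theta>) N P \<alpha> d"
    and sig: "i < k \<Longrightarrow> \<sigma> i \<in> Hgal p" and mk: "m > 0" "k > 0"
    and nonconj: "i < k \<Longrightarrow> j < k \<Longrightarrow> g \<in> K0 \<Longrightarrow> (\<And>x. x \<in> N \<Longrightarrow> \<sigma> i (\<theta> (cj g x)) = \<sigma> j (\<theta> x)) \<Longrightarrow> i = j"
begin

abbreviation "n \<equiv> m * k"
abbreviation "bl \<equiv> \<lambda>i. i div m"
abbreviation "R \<equiv> \<lambda>b y. map_mat (\<sigma> b) (P y)"
abbreviation "\<delta> \<equiv> \<lambda>b x y. \<sigma> b (\<alpha> x y)"
abbreviation "K \<equiv> stab G K0 N \<theta>"
abbreviation "BN \<equiv> base_sub N n"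
definition "\<theta>t = prod_char N m k (\<lambda>i. char_act G N \<theta> \<one> (\<sigma> i))"

lemma bl_lt: "i < n \<Longrightarrow> bl i < k"
  by (simp add: less_mult_imp_div_less mult.commute)

lemma sig_gal: "i < k \<Longrightarrow> \<sigma> i \<in> galQab"
  using sig Hgal_galQab by blast

lemma sbl: "i < n \<Longrightarrow> \<sigma> (bl i) \<in> galQab"
  using sig_gal bl_lt by blast

sublocale wreath_rep G K N R \<delta> d n bl
  unfolding wreath_rep_def wreath_rep_axioms_def
  using assoc_rep.twist[OF ar sbl] mk is_group by simp

lemma off: "x \<notin> N \<Longrightarrow> \<theta> x = 0"
  by (simp add: aff afforded_def)

lemma theta_eq: "x \<in> N \<Longrightarrow> \<theta> x = mtrace (P x)"
  by (simp add: aff afforded_def)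

lemma theta_Qab: "x \<in> N \<Longrightarrow> \<theta> x \<in> Qab"
  unfolding theta_eq using assoc_rep.P_Qab[OF ar] N_in_K Qab_mat_mtrace by blast

lemma N_carrier: "x \<in> N \<Longrightarrow> x \<in> carrier G"
  using N_in_K K_closed by blast

lemma K0_carrier: "x \<in> K0 \<Longrightarrow> x \<in> carrier G"
  by (rule subgroup.mem_carrier[OF K0])

lemma theta_one: "\<theta> \<one> = of_nat d"
  using theta_eq[OF subgroup.one_closed[OF N_sub]] assoc_rep.P_one[OF ar] by (simp add: mtrace_def)

lemma theta_t: "h \<in> {..<n} \<rightarrow>\<^sub>E N \<Longrightarrow> \<theta>t (h, id) = (\<Prod>i<n. \<sigma> (bl i) (\<theta> (h i)))"
  by (auto simp: \<theta>t_def prod_char_def base_sub_def char_act_def PiE_iff N_carrier intro!: prod.cong)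

lemma theta_t_off: "x \<notin> BN \<Longrightarrow> \<theta>t x = 0"
  by (simp add: \<theta>t_def prod_char_def)

lemma wreath_sub_K0: "(f, w) \<in> wreath_sub K0 n \<longleftrightarrow> f \<in> {..<n} \<rightarrow>\<^sub>E K0 \<and> w permutes {..<n}"
  by (simp add: wreath_sub_def)

lemma wreath_sub_carrier: "x \<in> wreath_sub K0 n \<Longrightarrow> x \<in> carrier (wreath G n)"
  using subgroup.mem_carrier[OF wreath_sub_subgroup[OF K0]] .

lemma BN_carrier: "BN \<subseteq> carrier (wreath G n)"
  using subgroup.subset[OF base_sub_subgroup[OF N_sub]] .

lemma BN_conj: "x \<in> wreath_sub K0 n \<Longrightarrow> y \<in> BN \<Longrightarrow> x \<otimes>\<^bsub>wreath G n\<^esub> y \<otimes>\<^bsub>wreath G n\<^esub> inv\<^bsub>wreath G n\<^esub> x \<in> BN"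
  using wreath_sub_carrier by (cases x) (auto intro!: base_conj conj_N0 simp: wreath_sub_K0 PiE_iff)

text \<open>Invariance of the product character under \<open>(f, w)\<close> and
  \<open>\<tau>\<close>, one place at a time; see \<open>char_act_wreath\<close>.\<close>

definition rel where "rel f w \<tau> \<longleftrightarrow> (\<forall>j<n. \<forall>x\<in>N. \<tau> (\<sigma> (bl (w j)) (\<theta> (cj (f (w j)) x))) = \<sigma> (bl j) (\<theta> x))"

lemma theta_t_conj:
  assumes x: "(f, w) \<in> wreath_sub K0 n" and t: "\<tau> \<in> galQab" and h: "h \<in> {..<n} \<rightarrow>\<^sub>E N"
  shows "\<tau> (\<theta>t ((f, w) \<otimes>\<^bsub>wreath G n\<^esub> (h, id) \<otimes>\<^bsub>wreath G n\<^esub> inv\<^bsub>wreath G n\<^esub> (f, w))) =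
    (\<Prod>j<n. \<tau> (\<sigma> (bl (w j)) (\<theta> (cj (f (w j)) (h j)))))"
proof -
  have w: "w permutes {..<n}" and f: "\<And>i. i < n \<Longrightarrow> f i \<in> K0" using x by (auto simp: wreath_sub_K0)
  have hN: "\<And>i. i < n \<Longrightarrow> h i \<in> N" using h by auto
  have hc: "h \<in> {..<n} \<rightarrow>\<^sub>E carrier G" using h N_carrier by (auto simp: PiE_iff)
  have N1: "cj (f i) (h (pinv w i)) \<in> N" if "i < n" for i
    using conj_N0[OF f[OF that]] hN w that by simp
  have "\<theta>t ((f, w) \<otimes>\<^bsub>wreath G n\<^esub> (h, id) \<otimes>\<^bsub>wreath G n\<^esub> inv\<^bsub>wreath G n\<^esub> (f, w)) =
     (\<Prod>i<n. \<sigma> (bl i) (\<theta> (cj (f i) (h (pinv w i)))))"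
    unfolding wreath_conj_base[OF wreath_sub_carrier[OF x] hc]
    using N1 by (subst theta_t) (auto intro!: prod.cong)
  also have "\<tau> \<dots> = (\<Prod>i<n. \<tau> (\<sigma> (bl i) (\<theta> (cj (f i) (h (pinv w i))))))"
    using N1 by (intro gal_prod[OF t]) (auto simp: gal_mem[OF sbl] theta_Qab)
  also have "\<dots> = (\<Prod>j<n. \<tau> (\<sigma> (bl (w j)) (\<theta> (cj (f (w j)) (h j)))))"
    using prod_permute[OF w, of "\<lambda>i. \<tau> (\<sigma> (bl i) (\<theta> (cj (f i) (h (pinv w i)))))"] w by simp
  finally show ?thesis .
qed

text \<open>Both sides are products of functions of separate variables. Setting all variables but
  one to the identity leaves powers of the degree \<open>d\<close>, which is an integer and hence
  fixed by the automorphisms; cancelling them gives equality of the factors at the remaining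
  place.\<close>

lemma char_act_wreath:
  assumes x: "(f, w) \<in> wreath_sub K0 n" and t: "\<tau> \<in> galQab"
  shows "char_act (wreath G n) BN \<theta>t (f, w) \<tau> = \<theta>t \<longleftrightarrow> rel f w \<tau>"
proof -
  have w: "w permutes {..<n}" and f: "\<And>i. i < n \<Longrightarrow> f i \<in> K0" using x by (auto simp: wreath_sub_K0)
  have "char_act (wreath G n) BN \<theta>t (f, w) \<tau> = \<theta>t \<longleftrightarrow>
    (\<forall>h\<in>{..<n} \<rightarrow>\<^sub>E N. (\<Prod>j<n. \<tau> (\<sigma> (bl (w j)) (\<theta> (cj (f (w j)) (h j))))) = (\<Prod>i<n. \<sigma> (bl i) (\<theta> (h i))))"
    by (subst group.char_act_eq_iff[OF wreath_group theta_t_off], assumption)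
      (simp add: base_sub_eq_image theta_t_conj[OF x t] theta_t)
  also have "\<dots> \<longleftrightarrow> rel f w \<tau>"
  proof
    assume "rel f w \<tau>"
    then show "\<forall>h\<in>{..<n} \<rightarrow>\<^sub>E N. (\<Prod>j<n. \<tau> (\<sigma> (bl (w j)) (\<theta> (cj (f (w j)) (h j))))) = (\<Prod>i<n. \<sigma> (bl i) (\<theta> (h i)))"
      unfolding rel_def by (auto intro!: prod.cong simp: PiE_iff)
  next
    assume *: "\<forall>h\<in>{..<n} \<rightarrow>\<^sub>E N. (\<Prod>j<n. \<tau> (\<sigma> (bl (w j)) (\<theta> (cj (f (w j)) (h j))))) = (\<Prod>i<n. \<sigma> (bl i) (\<theta> (h i)))"
    show "rel f w \<tau>"
      unfolding rel_def
    proof (intro allI impI ballI)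
      fix j x assume j: "j < n" and x: "x \<in> N"
      let ?h = "\<lambda>i\<in>{..<n}. if i = j then x else \<one>"
      let ?F = "\<lambda>i. \<tau> (\<sigma> (bl (w i)) (\<theta> (cj (f (w i)) (?h i))))" and ?E = "\<lambda>i. \<sigma> (bl i) (\<theta> (?h i))"
      have h: "?h \<in> {..<n} \<rightarrow>\<^sub>E N" using x subgroup.one_closed[OF N_sub] by auto
      have e: "?F i = of_nat d" "?E i = of_nat d" if i: "i < n" "i \<noteq> j" for i
      proof -
        have wi: "w i < n" using w i by simp
        have "cj (f (w i)) \<one> = \<one>" using K0_carrier[OF f[OF wi]] by simp
        then show "?F i = of_nat d" "?E i = of_nat d"
          using i wi by (simp_all add: theta_one gal_of_nat[OF sbl] gal_of_nat[OF t])
      qed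
      have "(\<Prod>i<n. ?F i) = (\<Prod>i<n. ?E i)" using * h by blast
      moreover have "(\<Prod>i<n. ?F i) = ?F j * (\<Prod>i\<in>{..<n} - {j}. of_nat d)"
        using j e by (subst prod.remove[of _ j]) auto
      moreover have "(\<Prod>i<n. ?E i) = ?E j * (\<Prod>i\<in>{..<n} - {j}. of_nat d)"
        using j e by (subst prod.remove[of _ j]) auto
      ultimately have "?F j = ?E j" using d_pos by simp
      then show "\<tau> (\<sigma> (bl (w j)) (\<theta> (cj (f (w j)) x))) = \<sigma> (bl j) (\<theta> x)" using j by simp
    qed
  qed
  finally show ?thesis .
qed

lemma K_iff: "g \<in> K \<longleftrightarrow> g \<in> K0 \<and> (\<forall>x\<in>N. \<theta> (cj g x) = \<theta> x)"
  by (rule stab_iff[OF off])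

context
  fixes f w \<tau>
  assumes x: "(f, w) \<in> wreath_sub K0 n" and t: "\<tau> \<in> galQab" and r: "rel f w \<tau>"
begin

lemma rel_w: "w permutes {..<n}" and rel_f: "i < n \<Longrightarrow> f i \<in> K0"
  using x by (auto simp: wreath_sub_K0)

lemma relD: "j < n \<Longrightarrow> y \<in> N \<Longrightarrow> \<tau> (\<sigma> (bl (w j)) (\<theta> (cj (f (w j)) y))) = \<sigma> (bl j) (\<theta> y)"
  using r by (simp add: rel_def)

text \<open>Places \<open>i\<close> and \<open>j\<close> carry the same character. After cancelling
  \<open>\<tau>\<close>, the characters at \<open>w i\<close> and \<open>w j\<close> agree once
  conjugated by \<open>f (w i)\<close> and \<open>f (w j)\<close>; so
  \<open>f (w i) \<otimes> inv (f (w j))\<close> takes one to the other and \<open>nonconj\<close>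
  applies.\<close>

lemma rel_block:
  assumes ij: "i < n" "j < n" "bl i = bl j"
  shows "bl (w i) = bl (w j)"
proof -
  have wij: "w i < n" "w j < n" using rel_w ij by auto
  note fi = rel_f[OF wij(1)] and fj = rel_f[OF wij(2)]
  have fj': "inv (f (w j)) \<in> K0" using subgroup.m_inv_closed[OF K0 fj] .
  show ?thesis
  proof (rule nonconj[OF bl_lt[OF wij(1)] bl_lt[OF wij(2)] subgroup.m_closed[OF K0 fi fj']])
    fix y assume y: "y \<in> N"
    let ?z = "cj (inv (f (w j))) y"
    have z: "?z \<in> N" using conj_N0[OF fj' y] .
    have 1: "cj (f (w i) \<otimes> inv (f (w j))) y = cj (f (w i)) ?z"
      using cj_mult K0_carrier[OF fi] K0_carrier[OF fj'] N_carrier[OF y] by blast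
    have 2: "cj (f (w j)) ?z = y" using cj_inverse(2)[OF K0_carrier[OF fj] N_carrier[OF y]] .
    have "\<tau> (\<sigma> (bl (w i)) (\<theta> (cj (f (w i)) ?z))) = \<tau> (\<sigma> (bl (w j)) (\<theta> (cj (f (w j)) ?z)))"
      using relD[OF ij(1) z] relD[OF ij(2) z] ij(3) by simp
    then show "\<sigma> (bl (w i)) (\<theta> (cj (f (w i) \<otimes> inv (f (w j))) y)) = \<sigma> (bl (w j)) (\<theta> y)"
      unfolding 1 2 gal_inj[OF t] .
  qed
qed

text \<open>By \<open>rel_block\<close> the elements \<open>f (w i)\<close> and
  \<open>f (w j)\<close> act on one and the same twist of \<open>\<theta>\<close> with the same
  outcome, so they differ by an element fixing \<open>\<theta>\<close>.\<close>

lemma rel_quotient: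
  assumes ij: "i < n" "j < n" "bl i = bl j"
  shows "inv (f (w i)) \<otimes> f (w j) \<in> K"
proof -
  have wij: "w i < n" "w j < n" using rel_w ij by auto
  note fi = rel_f[OF wij(1)] and fj = rel_f[OF wij(2)]
  let ?s = "inv (f (w i)) \<otimes> f (w j)"
  have s: "?s \<in> K0" using subgroup.m_closed[OF K0 subgroup.m_inv_closed[OF K0 fi] fj] .
  note c = K0_carrier[OF fi] K0_carrier[OF fj] K0_carrier[OF s]
  have e: "f (w i) \<otimes> ?s = f (w j)" using c by (simp flip: m_assoc)
  have "\<theta> (cj ?s y) = \<theta> y" if y: "y \<in> N" for y
  proof -
    have "\<sigma> (bl i) (\<theta> (cj ?s y)) = \<tau> (\<sigma> (bl (w i)) (\<theta> (cj (f (w i)) (cj ?s y))))"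
      using relD[OF ij(1) conj_N0[OF s y]] by simp
    also have "cj (f (w i)) (cj ?s y) = cj (f (w j)) y"
      using cj_mult[OF c(1,3) N_carrier[OF y]] e by simp
    also have "\<tau> (\<sigma> (bl (w i)) (\<theta> (cj (f (w j)) y))) = \<sigma> (bl i) (\<theta> y)"
      using relD[OF ij(2) y] rel_block[OF ij] ij(3) by simp
    finally show ?thesis unfolding gal_inj[OF sbl[OF ij(1)]] .
  qed
  then show ?thesis using s by (simp add: K_iff)
qed

text \<open>An element carrying a character to a Galois conjugate of itself normalises the
  stabiliser of that character; \<open>f (w j)\<close> is such an element for
  \<open>\<theta>\<close>.\<close>

lemma rel_normalizes:
  assumes j: "j < n" and y: "y \<in> K"
  shows "cj (f (w j)) y \<in> K"
proof -
  have wj: "w j < n" using rel_w j by auto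
  note fj = rel_f[OF wj]
  note ck = K0_carrier[OF fj] subgroup.m_inv_closed[OF K0 fj]
  have yK0: "y \<in> K0" using y by (simp add: K_iff)
  have g: "cj (f (w j)) y \<in> K0" using subgroup.m_closed[OF K0] fj yK0 ck by blast
  have "\<theta> (cj (cj (f (w j)) y) u) = \<theta> u" if u: "u \<in> N" for u
  proof -
    let ?z = "cj (inv (f (w j))) u"
    have z: "?z \<in> N" using conj_N0[OF ck(2) u] .
    have yz: "cj y ?z \<in> N" using conj_N0[OF yK0 z] .
    have e: "cj (f (w j)) ?z = u" using cj_inverse(2)[OF ck(1) N_carrier[OF u]] .
    have "cj (cj (f (w j)) y) u = cj (f (w j)) (cj y ?z)"
      using cj_mult ck K0_carrier yK0 N_carrier[OF u] N_carrier[OF z] by (metis inv_closed m_closed)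
    then have "\<tau> (\<sigma> (bl (w j)) (\<theta> (cj (cj (f (w j)) y) u))) = \<sigma> (bl j) (\<theta> (cj y ?z))"
      using relD[OF j yz] by simp
    also have "\<theta> (cj y ?z) = \<theta> ?z" using y z by (simp add: K_iff)
    also have "\<sigma> (bl j) (\<theta> ?z) = \<tau> (\<sigma> (bl (w j)) (\<theta> u))" using relD[OF j z] e by simp
    finally show ?thesis unfolding gal_inj[OF t] gal_inj[OF sbl[OF wj]] .
  qed
  then show ?thesis using g by (simp add: K_iff)
qed

end

text \<open>For trivial \<open>\<tau>\<close>, places \<open>j\<close> and \<open>w j\<close> carry
  conjugate characters, so \<open>nonconj\<close> makes their blocks equal. The same automorphism
  then stands on both sides and cancels, which leaves invariance of \<open>\<theta>\<close>.\<close>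

lemma rel_id_iff:
  assumes x: "(f, w) \<in> wreath_sub K0 n"
  shows "rel f w id \<longleftrightarrow> (f, w) \<in> block_stab"
proof
  have w: "w permutes {..<n}" and f: "f \<in> {..<n} \<rightarrow>\<^sub>E K0" using x by (auto simp: wreath_sub_K0)
  assume r: "rel f w id"
  note d = relD[OF x galQab_id r]
  have b: "bl (w j) = bl j" if j: "j < n" for j
  proof (rule nonconj[of _ _ "f (w j)"])
    show "bl (w j) < k" "bl j < k" "f (w j) \<in> K0" using bl_lt j w f by auto
  qed (use d[OF j] in simp)
  have "f i \<in> K" if i: "i < n" for i
  proof -
    have j: "pinv w i < n" "w (pinv w i) = i" using w i by auto
    have "\<theta> (cj (f i) y) = \<theta> y" if y: "y \<in> N" for y
      using d[OF j(1) y] b[OF j(1)] j(2) gal_inj[OF sbl[OF i]] by simp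
    then show ?thesis using f i by (auto simp: K_iff)
  qed
  then show "(f, w) \<in> block_stab" using f w b by (auto simp: block_stab_pair PiE_iff)
next
  assume "(f, w) \<in> block_stab"
  then show "rel f w id" by (auto simp: rel_def block_stab_pair PiE_iff K_iff)
qed

definition "T = stab_orb p (wreath G n) (wreath_sub K0 n) BN \<theta>t"

lemma T_iff: "x \<in> T \<longleftrightarrow> x \<in> wreath_sub K0 n \<and> (\<exists>\<tau>\<in>Hgal p. char_act (wreath G n) BN \<theta>t x \<tau> = \<theta>t)"
  unfolding T_def by (rule group.stab_orb_iff[OF wreath_group p BN_carrier theta_t_off])

lemma T_subgroup: "subgroup T (wreath G n)"
  unfolding T_def
  by (rule group.stab_orb_subgroup[OF wreath_group p wreath_sub_subgroup[OF K0] BN_carrier BN_conj theta_t_off])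

lemma block_stab_K0: "block_stab \<subseteq> wreath_sub K0 n"
  by (auto simp: block_stab_def wreath_sub_def PiE_iff K_iff)

lemma stab_T: "stab (wreath G n) T BN \<theta>t = block_stab"
proof -
  have "x \<in> stab (wreath G n) T BN \<theta>t \<longleftrightarrow> x \<in> block_stab" for x
  proof -
    obtain f w where e: "x = (f, w)" by (cases x)
    have "x \<in> stab (wreath G n) T BN \<theta>t \<longleftrightarrow> x \<in> wreath_sub K0 n \<and> char_act (wreath G n) BN \<theta>t x id = \<theta>t"
      using Hgal_id T_iff by (auto simp: stab_def)
    then show ?thesis unfolding e
      using char_act_wreath[OF _ galQab_id] rel_id_iff block_stab_K0 by blast
  qed
  then show ?thesis by blast
qed

lemma afforded_tensor: "afforded BN tensor_rep = \<theta>t"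
proof
  fix x show "afforded BN tensor_rep x = \<theta>t x"
  proof (cases "x \<in> BN")
    case True
    then obtain h where h: "x = (h, id)" "h \<in> {..<n} \<rightarrow>\<^sub>E N" by (auto simp: base_sub_def)
    have hN: "\<And>i. i < n \<Longrightarrow> h i \<in> N" using h(2) by auto
    have "mtrace (tensor_rep x) = (\<Prod>i<n. mtrace (R (bl i) (h i)))"
      unfolding h(1) tensor_rep_def fst_conv snd_conv
      using assoc_rep.P_carrier[OF factor N_in_K[OF hN]] by (intro tens_mtrace) blast
    also have "\<dots> = (\<Prod>i<n. \<sigma> (bl i) (\<theta> (h i)))"
      using hN N_in_K by (intro prod.cong refl) (simp add: gal_mat_mtrace[OF sbl assoc_rep.P_Qab[OF ar]] theta_eq)
    finally show ?thesis using True theta_t[OF h(2)] h(1) by (simp add: afforded_def)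
  qed (simp add: afforded_def theta_t_off)
qed

lemma BN_T: "BN \<subseteq> T"
  using base_sub_block_stab stab_T by (auto simp: stab_def)

lemma Htriple_wreath: "Htriple p (wreath G n) T BN \<theta>t"
  unfolding Htriple_def
proof (intro conjI T_subgroup)
  show "normal BN (wreath G n\<lparr>carrier := T\<rparr>)"
    unfolding group.normal_in_iff[OF wreath_group T_subgroup]
    using base_sub_subgroup[OF N_sub] BN_T BN_conj T_iff by blast
  show "\<theta>t \<in> Irr (wreath G n) BN"
    unfolding Irr_def
    by (intro CollectI exI conjI, rule assoc_rep.irred[OF tensor_assoc_rep], rule afforded_tensor[symmetric])
  show "stab_orb p (wreath G n) T BN \<theta>t = T"
  proof (rule Set.set_eqI)
    fix x
    have "x \<in> stab_orb p (wreath G n) T BN \<theta>t \<longleftrightarrow>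
      x \<in> T \<and> (\<exists>\<tau>\<in>Hgal p. char_act (wreath G n) BN \<theta>t x \<tau> = \<theta>t)"
      by (rule group.stab_orb_iff[OF wreath_group p BN_carrier theta_t_off])
    then show "x \<in> stab_orb p (wreath G n) T BN \<theta>t \<longleftrightarrow> x \<in> T" using T_iff by blast
  qed
qed

text \<open>The first place of the block of \<open>j\<close>; \<open>f (w (base_pt j))\<close> is
  the common representative chosen for this block.\<close>

definition base_pt where "base_pt j = bl j * m"

lemma base_pt: "j < n \<Longrightarrow> base_pt j < n" "j < n \<Longrightarrow> bl (base_pt j) = bl j"
  using mk le_less_trans[OF div_times_less_eq_dividend[of j m]] by (simp_all add: base_pt_def)

definition sh where "sh f w j = inv (f (w (base_pt j))) \<otimes> f (w j)"

text \<open>The \<open>coeff\<close> of \<open>wreath_conj\<close> for these choices, with the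
  twists merged and written out in terms of \<open>P\<close> and \<open>\<alpha>\<close>, so that it
  can be compared between the two triples.\<close>

definition mu_factor where
  "mu_factor f w \<tau> g v j =
    (let t = sh f w j \<otimes> g j \<otimes> inv (sh f w (pinv v j)) in
     ratio G N (\<lambda>y. map_mat (\<tau> \<circ> \<sigma> (bl (w j))) (P (cj (f (w (base_pt j))) y))) (R (bl j)) t
       * \<sigma> (bl j) (\<alpha> t (sh f w (pinv v j))) / \<sigma> (bl j) (\<alpha> (sh f w j) (g j)))"

lemma sh_K:
  assumes "(f, w) \<in> wreath_sub K0 n" "\<tau> \<in> galQab" "rel f w \<tau>" "j < n"
  shows "sh f w j \<in> K"
  unfolding sh_def using rel_quotient[OF assms(1-3) base_pt(1)[OF assms(4)] assms(4) base_pt(2)[OF assms(4)]] .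

lemma mu_fun_formula:
  assumes x: "(f, w) \<in> wreath_sub K0 n" and t: "\<tau> \<in> galQab" and r: "rel f w \<tau>"
    and y: "(g, v) \<in> block_stab"
  shows "mu_fun (wreath G n) block_stab BN (d ^ n) tensor_rep (f, w) \<tau> (g, v) = (\<Prod>j<n. mu_factor f w \<tau> g v j)"
proof -
  note w = rel_w[OF x t r] and f = rel_f[OF x t r]
  have b: "base_pt j < n" "w (base_pt j) < n" if "j < n" for j
    using base_pt that w by auto
  interpret C: wreath_conj G K N R \<delta> d n bl f w \<tau> "\<lambda>j. f (w (base_pt j))" "sh f w"
  proof
    fix j assume j: "j < n"
    show "f (w (base_pt j)) \<in> carrier G" using K0_carrier f b j by blast
    show "cj (f (w (base_pt j))) y \<in> K" if "y \<in> K" for y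
      using rel_normalizes[OF x t r b(1)[OF j] that] .
    show "cj (f (w (base_pt j))) y \<in> N" if "y \<in> N" for y
      using conj_N0[OF f[OF b(2)[OF j]] that] .
    show "sh f w j \<in> K" using sh_K[OF x t r j] .
    show "f (w j) = f (w (base_pt j)) \<otimes> sh f w j"
      using K0_carrier[OF f[OF b(2)[OF j]]] K0_carrier[OF f] w j by (simp add: sh_def flip: m_assoc)
    show "f (w (base_pt i)) = f (w (base_pt j)) \<and> bl (w i) = bl (w j)" if "i < n" "bl i = bl j" for i
      using rel_block[OF x t r that(1) j that(2)] that(2) by (simp add: base_pt_def)
    show "\<tau> (mtrace (R (bl (w j)) (cj (f (w (base_pt j))) y))) = mtrace (R (bl j) y)" if y: "y \<in> N" for y
    proof -
      have wj: "w j < n" using w j by simp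
      have N': "cj (f (w (base_pt j))) y \<in> N" using conj_N0[OF f[OF b(2)[OF j]] y] .
      have "bl (w (base_pt j)) = bl (w j)" using rel_block[OF x t r b(1)[OF j] j base_pt(2)[OF j]] .
      then show ?thesis
        using relD[OF x t r b(1)[OF j] y] base_pt(2)[OF j] theta_eq[OF N'] theta_eq[OF y]
          gal_mat_mtrace[OF sbl[OF wj] assoc_rep.P_Qab[OF ar N_in_K[OF N']]]
          gal_mat_mtrace[OF sbl[OF j] assoc_rep.P_Qab[OF ar N_in_K[OF y]]] by simp
    qed
  qed (use t x wreath_sub_carrier in auto)
  have "C.coeff g v j = mu_factor f w \<tau> g v j" for j
  proof -
    have "map_mat \<tau> (map_mat \<rho> A) = map_mat (\<tau> \<circ> \<rho>) A" for \<rho> and A :: "complex mat"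
      by (intro eq_matI) auto
    then show ?thesis by (simp add: C.coeff_def mu_factor_def C.Q_def)
  qed
  then show ?thesis using C.mu_fun_wreath[OF y] by simp
qed

end

section \<open>Reduction of the ratios to values of \<open>mu_fun\<close> for the given
  triple\<close>

context wreath_triple
begin

context
  fixes f w \<tau>
  assumes x: "(f, w) \<in> wreath_sub K0 n" and t: "\<tau> \<in> galQab" and r: "rel f w \<tau>"
begin

text \<open>Dividing out the twist of the block of \<open>j\<close> leaves an automorphism that
  together with \<open>f (w (base_pt j))\<close> fixes \<open>\<theta>\<close> itself. It is in
  \<open>Hgal p\<close> whenever \<open>\<tau>\<close> is, which brings condition (iv) for the given
  triples into play.\<close>

abbreviation "gal_quot j \<equiv> inv_into UNIV (\<sigma> (bl j)) \<circ> (\<tau> \<circ> \<sigma> (bl (w j)))"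

lemma gal_quot_char:
  assumes j: "j < n" and y: "y \<in> N"
  shows "gal_quot j (\<theta> (cj (f (w (base_pt j))) y)) = \<theta> y"
proof -
  note b = base_pt[OF j]
  have "bl (w (base_pt j)) = bl (w j)" using rel_block[OF x t r b(1) j b(2)] .
  then have "\<tau> (\<sigma> (bl (w j)) (\<theta> (cj (f (w (base_pt j))) y))) = \<sigma> (bl j) (\<theta> y)"
    using relD[OF x t r b(1) y] b(2) by simp
  then show ?thesis using galQab_bij[OF sbl[OF j]] by (simp add: bij_def)
qed

lemma gal_quot_char_act: "j < n \<Longrightarrow> char_act G N \<theta> (f (w (base_pt j))) (gal_quot j) = \<theta>"
  using gal_quot_char by (subst char_act_eq_iff[OF off]) auto

lemma ratio_quotient:
  assumes j: "j < n" and y: "y \<in> K"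
  obtains u v where "u \<in> Qab" "v \<in> Qab" "v \<noteq> 0"
    "u = mu_fun G K N d P (f (w (base_pt j))) (gal_quot j) y * v"
    "\<sigma> (bl j) u = ratio G N (\<lambda>y. map_mat (\<tau> \<circ> \<sigma> (bl (w j))) (P (cj (f (w (base_pt j))) y))) (R (bl j)) y * \<sigma> (bl j) v"
proof -
  note b = base_pt[OF j]
  have wj: "w j < n" "w (base_pt j) < n" using rel_w[OF x t r] j b by auto
  let ?x = "f (w (base_pt j))"
  have xK0: "?x \<in> K0" using rel_f[OF x t r wj(2)] .
  have s1: "\<tau> \<circ> \<sigma> (bl (w j)) \<in> galQab" using galQab_comp[OF t sbl[OF wj(1)]] .
  have q: "gal_quot j \<in> galQab" using galQab_comp[OF galQab_inv[OF sbl[OF j]] s1] .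
  have e: "\<tau> \<circ> \<sigma> (bl (w j)) = \<sigma> (bl j) \<circ> gal_quot j"
    using galQab_bij[OF sbl[OF j]] by (auto simp: fun_eq_iff bij_def surj_f_inv_f)
  have c: "gal_quot j (mtrace (P (cj ?x z))) = mtrace (P z)" if "z \<in> N" for z
    using gal_quot_char[OF j that] theta_eq[OF that] theta_eq[OF conj_N0[OF xK0 that]] by simp
  show thesis
    by (rule assoc_rep.mu_fun_trace_quotient[OF ar s1 sbl[OF j] q e K0_carrier[OF xK0]
      rel_normalizes[OF x t r b(1)] conj_N0[OF xK0] c y that])
qed

end

end

lemma (in finite_subgroup) rep_class_function:
  assumes r: "is_rep \<Gamma> N d \<rho>" and "g \<in> N" "x \<in> N"
  shows "mtrace (\<rho> (g \<otimes> x \<otimes> inv g)) = mtrace (\<rho> x)"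
proof -
  have c: "\<rho> y \<in> carrier_mat d d" if "y \<in> N" for y using r that by (auto simp: is_rep_def)
  have "\<rho> (g \<otimes> x \<otimes> inv g) = \<rho> g * \<rho> x * \<rho> (inv g)" using r assms by (simp add: is_rep_def)
  then show ?thesis
    using rep_one[OF r assms(2)] c assms by (simp add: mtrace_conj[of _ d])
qed

text \<open>At the identity matrix the relation between the entries (0, 0) and (1, 1) would read 1 =
  0, up to the factor \<open>d\<close>. This serves the case of trivial \<open>N\<close>, where the
  centraliser of the base group may permute the places.\<close>

lemma (in assoc_rep) dim_one_if_trivial:
  assumes "N = {\<one>}"
  shows "d = 1"
proof (rule ccontr)
  assume "d \<noteq> 1"
  then have d: "0 < d" "1 < d" using d_pos by auto
  then have "of_nat d * (\<Sum>n\<in>N. P n $$ (0, 0) * P (inv n) $$ (1, 1)) = 0"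
    using orth unfolding ortho_def by fastforce
  then show False using d assms by (simp add: P_one)
qed

lemma tens_one_dim_one: "tens n 1 (\<lambda>_. 1\<^sub>m 1) w = 1\<^sub>m 1" if w: "w permutes {..<n}"
proof (rule eq_matI)
  fix a b assume "a < dim_row (1\<^sub>m 1 :: complex mat)" "b < dim_col (1\<^sub>m 1 :: complex mat)"
  then have ab: "a < 1 ^ n" "b < 1 ^ n" by auto
  have "tens n 1 (\<lambda>_. 1\<^sub>m 1) w $$ (a, b) = 1"
    unfolding tens_index[OF ab]
  proof (rule prod.neutral, rule ballI)
    fix i assume "i \<in> {..<n}"
    then have "idx n 1 a i < 1" "idx n 1 b (pinv w i) < 1" using idx_lt[OF ab(1), of i] idx_lt[OF ab(2), of "pinv w i"] w by auto
    then show "1\<^sub>m 1 $$ (idx n 1 a i, idx n 1 b (pinv w i)) = (1 :: complex)" by simp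
  qed
  then show "tens n 1 (\<lambda>_. 1\<^sub>m 1) w $$ (a, b) = 1\<^sub>m 1 $$ (a, b)" using ab by simp
qed (auto simp: tens_def)

lemma map_scalar_mat: "\<sigma> \<in> galQab \<Longrightarrow> map_mat \<sigma> (c \<cdot>\<^sub>m 1\<^sub>m d) = \<sigma> c \<cdot>\<^sub>m 1\<^sub>m d"
  by (intro eq_matI) (auto simp: gal_0)

section \<open>From character triples to associated representations\<close>

context group
begin

lemma Htriple_assoc_rep:
  assumes p: "Factorial_Ring.prime p" and fin: "finite (carrier G)" and tr: "Htriple p G K N \<theta>"
    and P: "proj_rep G (stab G K N \<theta>) d P \<alpha>" "associated G (stab G K N \<theta>) N \<theta> d P" "entries_in_Qab (stab G K N \<theta>) d P"
    and root: "\<forall>x\<in>stab G K N \<theta>. \<forall>y\<in>stab G K N \<theta>. root_of_unity (\<alpha> x y)"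
  shows "assoc_rep G (stab G K N \<theta>) N P \<alpha> d" "subgroup K G" "subgroup N G" "N \<subseteq> K"
    "\<And>g x. g \<in> K \<Longrightarrow> x \<in> N \<Longrightarrow> cj g x \<in> N" "\<And>x. x \<notin> N \<Longrightarrow> \<theta> x = 0" "\<theta> = afforded N P"
proof -
  show K: "subgroup K G" using tr by (simp add: Htriple_def)
  show N: "subgroup N G" "N \<subseteq> K" and cN: "\<And>g x. g \<in> K \<Longrightarrow> x \<in> N \<Longrightarrow> cj g x \<in> N"
    using tr normal_in_iff[OF K] by (auto simp: Htriple_def)
  show aff: "\<theta> = afforded N P" using P(2) by (simp add: associated_def)
  show off: "\<theta> x = 0" if "x \<notin> N" for x using that by (simp add: aff afforded_def)
  have Nc: "N \<subseteq> carrier G" using subgroup.subset[OF N(1)] .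
  have fN: "finite N" using finite_subset[OF Nc fin] .
  interpret finite_subgroup N G
    using N(1) fN by (simp add: finite_subgroup_def finite_subgroup_axioms_def is_group)
  have rep: "is_rep G N d P" using P(2) by (simp add: associated_def)
  \<comment> \<open>Characters are class functions, so \<open>N\<close> lies in the stabiliser of
    \<open>\<theta>\<close>.\<close>
  have "\<theta> (cj g x) = \<theta> x" if "g \<in> N" "x \<in> N" for g x
    using rep_class_function[OF rep that] that cN N(2) by (auto simp: aff afforded_def)
  then have NK: "N \<subseteq> stab G K N \<theta>" using N(2) by (auto simp: stab_iff[OF off])
  show "assoc_rep G (stab G K N \<theta>) N P \<alpha> d"
  proof (rule assoc_repI[OF _ N(1) NK fN _ _ P root])
    show "subgroup (stab G K N \<theta>) G" by (rule stab_subgroup[OF p K Nc cN off])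
    show "cj g x \<in> N" if "g \<in> stab G K N \<theta>" "x \<in> N" for g x using that cN by (simp add: stab_def)
    show "\<theta> \<in> Irr G N" using tr by (simp add: Htriple_def)
  qed
qed

end

text \<open>\<open>S\<close> is the side of \<open>\<theta>\<close> and \<open>Z\<close> the side of
  \<open>\<phi>\<close>; the further assumptions are the conditions (i) to (iv) that link the
  two.\<close>

locale wreath_triple_pair = S: wreath_triple G p "carrier G" N \<theta> P \<alpha> d \<sigma> m k +
    Z: wreath_triple G p H M \<phi> P' \<alpha>' d' \<sigma> m k
  for G (structure) and p N \<theta> P \<alpha> d \<sigma> m k H M \<phi> P' \<alpha>' d' +
  assumes prod_NH: "carrier G = N <#> H" and N_H: "N \<inter> H = M"
    and cent_H: "centraliser G (carrier G) N \<subseteq> H"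
    and same_stab: "h \<in> H \<Longrightarrow> \<rho> \<in> Hgal p \<Longrightarrow> char_act G N \<theta> h \<rho> = \<theta> \<longleftrightarrow> char_act G M \<phi> h \<rho> = \<phi>"
    and same_fs: "x \<in> stab G H N \<theta> \<Longrightarrow> y \<in> stab G H N \<theta> \<Longrightarrow> \<alpha> x y = \<alpha>' x y"
    and same_scalar: "c \<in> centraliser G (carrier G) N \<Longrightarrow> \<exists>s. P c = s \<cdot>\<^sub>m 1\<^sub>m d \<and> P' c = s \<cdot>\<^sub>m 1\<^sub>m d'"
    and same_mu: "h \<in> H \<Longrightarrow> \<rho> \<in> Hgal p \<Longrightarrow> char_act G N \<theta> h \<rho> = \<theta> \<Longrightarrow> y \<in> stab G H N \<theta> \<Longrightarrow>
        mu_fun G (stab G (carrier G) N \<theta>) N d P h \<rho> y = mu_fun G (stab G H M \<phi>) M d' P' h \<rho> y"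
begin

abbreviation "WG \<equiv> wreath G (m * k)"

lemma wreath_sub_H: "wreath_sub H (m * k) \<subseteq> wreath_sub (carrier G) (m * k)"
  using Z.K0_carrier by (auto simp: wreath_sub_def PiE_iff)

text \<open>Dividing by \<open>\<sigma> j\<close> turns a relation between two twists into
  invariance of the character itself under an automorphism that is again in \<open>Hgal p\<close>,
  and there condition (ii) applies.\<close>

lemma coordinate_stab:
  assumes g: "g \<in> H" and t: "\<tau> \<in> Hgal p" and ij: "i < k" "j < k"
  shows "(\<forall>x\<in>N. \<tau> (\<sigma> i (\<theta> (S.cj g x))) = \<sigma> j (\<theta> x)) \<longleftrightarrow> (\<forall>x\<in>M. \<tau> (\<sigma> i (\<phi> (S.cj g x))) = \<sigma> j (\<phi> x))"
proof -
  let ?r = "inv_into UNIV (\<sigma> j) \<circ> (\<tau> \<circ> \<sigma> i)"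
  have r: "?r \<in> Hgal p"
    using Hgal_comp[OF S.p Hgal_inv[OF S.p S.sig[OF ij(2)]] Hgal_comp[OF S.p t S.sig[OF ij(1)]]] .
  have b: "inv_into UNIV (\<sigma> j) a = c \<longleftrightarrow> a = \<sigma> j c" for a c
    using galQab_bij[OF S.sig_gal[OF ij(2)]] by (metis bij_inv_eq_iff)
  have "(\<forall>x\<in>N. \<tau> (\<sigma> i (\<theta> (S.cj g x))) = \<sigma> j (\<theta> x)) \<longleftrightarrow> char_act G N \<theta> g ?r = \<theta>"
    by (subst S.char_act_eq_iff[OF S.off]) (simp_all add: b)
  also have "\<dots> \<longleftrightarrow> char_act G M \<phi> g ?r = \<phi>" by (rule same_stab[OF g r])
  also have "\<dots> \<longleftrightarrow> (\<forall>x\<in>M. \<tau> (\<sigma> i (\<phi> (S.cj g x))) = \<sigma> j (\<phi> x))"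
    by (subst S.char_act_eq_iff[OF Z.off]) (simp_all add: b)
  finally show ?thesis .
qed

lemma rel_iff:
  assumes x: "(f, w) \<in> wreath_sub H (m * k)" and t: "\<tau> \<in> Hgal p"
  shows "S.rel f w \<tau> \<longleftrightarrow> Z.rel f w \<tau>"
proof -
  have w: "w permutes {..<m * k}" and f: "\<And>i. i < m * k \<Longrightarrow> f i \<in> H" using x by (auto simp: wreath_sub_def)
  have "(\<forall>x\<in>N. \<tau> (\<sigma> (w j div m) (\<theta> (S.cj (f (w j)) x))) = \<sigma> (j div m) (\<theta> x)) \<longleftrightarrow>
    (\<forall>x\<in>M. \<tau> (\<sigma> (w j div m) (\<phi> (S.cj (f (w j)) x))) = \<sigma> (j div m) (\<phi> x))" if j: "j < m * k" for j
  proof -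
    have wj: "w j < m * k" using w j by simp
    show ?thesis by (rule coordinate_stab[OF f[OF wj] t S.bl_lt[OF wj] S.bl_lt[OF j]])
  qed
  then show ?thesis unfolding S.rel_def Z.rel_def by blast
qed

lemma char_act_iff:
  assumes x: "x \<in> wreath_sub H (m * k)" and t: "\<tau> \<in> Hgal p"
  shows "char_act WG S.BN S.\<theta>t x \<tau> = S.\<theta>t \<longleftrightarrow> char_act WG Z.BN Z.\<theta>t x \<tau> = Z.\<theta>t"
proof -
  obtain f w where e: "x = (f, w)" by (cases x)
  have 1: "(f, w) \<in> wreath_sub H (m * k)" "(f, w) \<in> wreath_sub (carrier G) (m * k)"
    using x e wreath_sub_H by auto
  show ?thesis
    unfolding e S.char_act_wreath[OF 1(2) Hgal_galQab[OF t]] Z.char_act_wreath[OF 1(1) Hgal_galQab[OF t]]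
    by (rule rel_iff[OF 1(1) t])
qed

lemma T_inter: "x \<in> Z.T \<longleftrightarrow> x \<in> wreath_sub H (m * k) \<and> x \<in> S.T"
  unfolding S.T_iff Z.T_iff using char_act_iff wreath_sub_H by blast

text \<open>Each coordinate splits as an element of \<open>N\<close> times one of \<open>H\<close>.
  The part in the base group lies in \<open>S.T\<close>, hence so does the other part, and having
  coordinates in \<open>H\<close> it lies in \<open>Z.T\<close> by \<open>T_inter\<close>.\<close>

lemma T_prod: "S.T = S.BN <#>\<^bsub>WG\<^esub> Z.T"
proof (rule equalityI; rule subsetI)
  fix x assume "x \<in> S.BN <#>\<^bsub>WG\<^esub> Z.T"
  then obtain a b where "a \<in> S.BN" "b \<in> Z.T" "x = a \<otimes>\<^bsub>WG\<^esub> b" by (auto simp: set_mult_def)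
  then show "x \<in> S.T" using S.BN_T T_inter subgroup.m_closed[OF S.T_subgroup] by blast
next
  fix x assume x: "x \<in> S.T"
  obtain f w where e: "x = (f, w)" by (cases x)
  have x': "(f, w) \<in> wreath_sub (carrier G) (m * k)" using x e S.T_iff by auto
  then have fe: "f \<in> {..<m * k} \<rightarrow>\<^sub>E carrier G" and w: "w permutes {..<m * k}" by (auto simp: wreath_sub_def)
  have "\<exists>a h. a \<in> N \<and> h \<in> H \<and> f i = a \<otimes> h" if "i < m * k" for i
  proof -
    have "f i \<in> N <#> H" using fe that prod_NH by auto
    then show ?thesis by (auto simp: set_mult_def)
  qed
  then obtain a h where ah: "\<And>i. i < m * k \<Longrightarrow> a i \<in> N \<and> h i \<in> H \<and> f i = a i \<otimes> h i" by metis
  let ?a = "(\<lambda>i\<in>{..<m * k}. a i, id)" and ?h = "(\<lambda>i\<in>{..<m * k}. h i, w)"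
  have aB: "?a \<in> S.BN" using ah by (auto simp: base_sub_def)
  have hH: "?h \<in> wreath_sub H (m * k)" using ah w by (auto simp: wreath_sub_def)
  have xe: "x = ?a \<otimes>\<^bsub>WG\<^esub> ?h"
    using fe ah unfolding e S.wreath_mult by (auto simp: fun_eq_iff inv_id PiE_iff extensional_def)
  interpret WG: group WG by (rule S.wreath_group)
  have c: "?a \<in> carrier WG" "?h \<in> carrier WG"
    using aB S.BN_carrier hH wreath_sub_H S.wreath_sub_carrier by blast+
  have "?h = inv\<^bsub>WG\<^esub> ?a \<otimes>\<^bsub>WG\<^esub> x" unfolding xe using c by (simp flip: WG.m_assoc)
  then have "?h \<in> S.T"
    using subgroup.m_closed[OF S.T_subgroup subgroup.m_inv_closed[OF S.T_subgroup] x] aB S.BN_T by auto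
  then show "x \<in> S.BN <#>\<^bsub>WG\<^esub> Z.T" using xe aB hH T_inter unfolding set_mult_def by blast
qed

lemma BN_inter: "S.BN \<inter> Z.T = Z.BN"
proof -
  have "S.BN \<inter> wreath_sub H (m * k) = Z.BN"
    using N_H by (auto simp: base_sub_def wreath_sub_def PiE_iff permutes_id)
  then show ?thesis using S.BN_T T_inter by blast
qed

text \<open>Testing against constant elements of the base group shows that each coordinate
  centralises \<open>N\<close>. Testing against an element supported at the single place
  \<open>pinv w i\<close> shows that \<open>w\<close> fixes \<open>i\<close> as soon as
  \<open>N\<close> is nontrivial.\<close>

lemma centraliser_coordinates:
  assumes c: "(f, w) \<in> centraliser WG S.T S.BN" and i: "i < m * k"
  shows "f i \<in> centraliser G (carrier G) N"
    and "y \<in> N \<Longrightarrow> y \<noteq> \<one> \<Longrightarrow> pinv w i = i"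
proof -
  have T: "(f, w) \<in> S.T" and cm: "\<And>h. h \<in> {..<m * k} \<rightarrow>\<^sub>E N \<Longrightarrow> (f, w) \<otimes>\<^bsub>WG\<^esub> (h, id) = (h, id) \<otimes>\<^bsub>WG\<^esub> (f, w)"
    using c by (auto simp: centraliser_def base_sub_def)
  have w: "w permutes {..<m * k}" and f: "f i \<in> carrier G" using T i S.T_iff by (auto simp: wreath_sub_def)
  have cm': "f i \<otimes> h (pinv w i) = h i \<otimes> f i" if "h \<in> {..<m * k} \<rightarrow>\<^sub>E N" for h
    using fun_cong[OF arg_cong[where f = fst, OF cm[OF that]], of i] i by (simp add: S.wreath_mult inv_id)
  have "f i \<otimes> y = y \<otimes> f i" if y: "y \<in> N" for y
    using cm'[of "\<lambda>_\<in>{..<m * k}. y"] y i w by simp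
  then show "f i \<in> centraliser G (carrier G) N" using f by (simp add: centraliser_def)
  assume y: "y \<in> N" "y \<noteq> \<one>"
  show "pinv w i = i"
  proof (rule ccontr)
    assume ne: "pinv w i \<noteq> i"
    have "f i \<otimes> y = \<one> \<otimes> f i"
      using cm'[of "\<lambda>j\<in>{..<m * k}. if j = pinv w i then y else \<one>"] y ne i w subgroup.one_closed[OF S.N_sub]
      by (auto split: if_splits)
    then show False using f y S.N_carrier by (simp add: S.l_cancel_one')
  qed
qed

lemma centraliser_sub: "centraliser WG S.T S.BN \<subseteq> Z.T"
proof
  fix x assume x: "x \<in> centraliser WG S.T S.BN"
  obtain f w where e: "x = (f, w)" by (cases x)
  have T: "x \<in> S.T" using x by (simp add: centraliser_def)
  then have "(f, w) \<in> wreath_sub (carrier G) (m * k)" using e S.T_iff by auto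
  moreover have "f i \<in> H" if "i < m * k" for i
    using centraliser_coordinates(1)[of f w i] x e that cent_H by blast
  ultimately have "x \<in> wreath_sub H (m * k)" unfolding e by (auto simp: wreath_sub_def PiE_iff)
  then show "x \<in> Z.T" using T T_inter by blast
qed

text \<open>The twisted scalars of the coordinates multiply to the same number on both sides. What
  remains is the operator of the place permutation, which has to be the identity.\<close>

lemma centraliser_scalar:
  assumes x: "x \<in> centraliser WG S.T S.BN"
  shows "\<exists>s. S.tensor_rep x = s \<cdot>\<^sub>m 1\<^sub>m (d ^ (m * k)) \<and> Z.tensor_rep x = s \<cdot>\<^sub>m 1\<^sub>m (d' ^ (m * k))"
proof -
  obtain f w where e: "x = (f, w)" by (cases x)
  have c: "(f, w) \<in> centraliser WG S.T S.BN" using x e by simp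
  have w: "w permutes {..<m * k}" using c S.T_iff by (auto simp: centraliser_def wreath_sub_def)
  have "\<exists>s. P (f i) = s \<cdot>\<^sub>m 1\<^sub>m d \<and> P' (f i) = s \<cdot>\<^sub>m 1\<^sub>m d'" if "i < m * k" for i
    using same_scalar centraliser_coordinates(1)[OF c that] by blast
  then obtain s where s: "\<And>i. i < m * k \<Longrightarrow> P (f i) = s i \<cdot>\<^sub>m 1\<^sub>m d \<and> P' (f i) = s i \<cdot>\<^sub>m 1\<^sub>m d'" by metis
  let ?s = "\<Prod>i<m * k. \<sigma> (i div m) (s i)"
  have scal: "tens (m * k) e (\<lambda>i. map_mat (\<sigma> (i div m)) (s i \<cdot>\<^sub>m 1\<^sub>m e)) w =
      ?s \<cdot>\<^sub>m tens (m * k) e (\<lambda>_. 1\<^sub>m e) w" for e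
  proof -
    have "tens (m * k) e (\<lambda>i. map_mat (\<sigma> (i div m)) (s i \<cdot>\<^sub>m 1\<^sub>m e)) w =
      tens (m * k) e (\<lambda>i. \<sigma> (i div m) (s i) \<cdot>\<^sub>m 1\<^sub>m e) w"
      by (rule tens_cong) (rule map_scalar_mat[OF S.sbl])
    then show ?thesis using w by (simp add: tens_smult)
  qed
  have "S.tensor_rep x = ?s \<cdot>\<^sub>m tens (m * k) d (\<lambda>_. 1\<^sub>m d) w"
    "Z.tensor_rep x = ?s \<cdot>\<^sub>m tens (m * k) d' (\<lambda>_. 1\<^sub>m d') w"
    unfolding scal[symmetric] S.tensor_rep_def Z.tensor_rep_def e fst_conv snd_conv
    using s by (auto intro!: tens_cong)
  moreover have "tens (m * k) d (\<lambda>_. 1\<^sub>m d) w = 1\<^sub>m (d ^ (m * k)) \<and> tens (m * k) d' (\<lambda>_. 1\<^sub>m d') w = 1\<^sub>m (d' ^ (m * k))"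
  \<comment> \<open>For trivial \<open>N\<close> the permutation is unrestricted, but both degrees
    are one and the tensor powers are one-dimensional; otherwise the permutation is trivial.\<close>
  proof (cases "N = {\<one>}")
    case True
    moreover have "M = {\<one>}" using True N_H subgroup.one_closed[OF Z.K0] by auto
    ultimately have "d = 1" "d' = 1"
      using assoc_rep.dim_one_if_trivial[OF S.ar] assoc_rep.dim_one_if_trivial[OF Z.ar] by auto
    then show ?thesis using tens_one_dim_one[OF w] by simp
  next
    case False
    then obtain y where y: "y \<in> N" "y \<noteq> \<one>" using subgroup.one_closed[OF S.N_sub] by blast
    have "w i = i" for i
    proof (cases "i < m * k")
      case True
      then show ?thesis using centraliser_coordinates(2)[OF c True y] w by (metis pinv_inverse(1))
    next
      case False
      then show ?thesis using w by (simp add: permutes_def)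
    qed
    then have "w = id" by auto
    then show ?thesis by (simp add: tens_one)
  qed
  ultimately show ?thesis by metis
qed

lemma stab_both:
  assumes "x \<in> stab WG Z.T S.BN S.\<theta>t"
  shows "x \<in> S.block_stab" "x \<in> Z.block_stab"
proof -
  have x: "x \<in> Z.T" "char_act WG S.BN S.\<theta>t x id = S.\<theta>t" using assms by (auto simp: stab_def)
  then have "x \<in> stab WG S.T S.BN S.\<theta>t" "x \<in> stab WG Z.T Z.BN Z.\<theta>t"
    using T_inter char_act_iff[OF _ Hgal_id] by (auto simp: stab_def)
  then show "x \<in> S.block_stab" "x \<in> Z.block_stab" using S.stab_T Z.stab_T by auto
qed

lemma stab_HN: "y \<in> S.K \<Longrightarrow> y \<in> Z.K \<Longrightarrow> y \<in> stab G H N \<theta>"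
  by (simp add: stab_def)

text \<open>Each ratio comes from a pair of traces whose quotient is a value of
  \<open>mu_fun\<close> for the given triple, and these values agree by condition (iv).\<close>

lemma ratio_both:
  assumes x: "(f, w) \<in> wreath_sub H (m * k)" and t: "\<tau> \<in> Hgal p" and rS: "S.rel f w \<tau>" and rZ: "Z.rel f w \<tau>"
    and j: "j < m * k" and y: "y \<in> S.K" "y \<in> Z.K"
  shows "ratio G N (\<lambda>y. map_mat (\<tau> \<circ> \<sigma> (w j div m)) (P (S.cj (f (w (S.base_pt j))) y))) (S.R (j div m)) y =
    ratio G M (\<lambda>y. map_mat (\<tau> \<circ> \<sigma> (w j div m)) (P' (S.cj (f (w (S.base_pt j))) y))) (Z.R (j div m)) y"
    (is "?r = ?r'")
proof -
  have xG: "(f, w) \<in> wreath_sub (carrier G) (m * k)" using x wreath_sub_H by blast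
  have w: "w permutes {..<m * k}" using x by (simp add: wreath_sub_def)
  have wj: "w j < m * k" "w (S.base_pt j) < m * k" using w j S.base_pt(1)[OF j] by simp_all
  have xH: "f (w (S.base_pt j)) \<in> H" using Z.rel_f[OF x Hgal_galQab[OF t] rZ wj(2)] .
  let ?s = "\<sigma> (j div m)" and ?q = "inv_into UNIV (\<sigma> (j div m)) \<circ> (\<tau> \<circ> \<sigma> (w j div m))"
  note sg = S.sbl[OF j]
  have q: "?q \<in> Hgal p"
    using Hgal_comp[OF S.p Hgal_inv[OF S.p S.sig[OF S.bl_lt[OF j]]] Hgal_comp[OF S.p t S.sig[OF S.bl_lt[OF wj(1)]]]] .
  obtain u v where uv: "u \<in> Qab" "v \<in> Qab" "v \<noteq> 0"
    "u = mu_fun G S.K N d P (f (w (S.base_pt j))) ?q y * v" "?s u = ?r * ?s v"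
    by (rule S.ratio_quotient[OF xG Hgal_galQab[OF t] rS j y(1)])
  obtain u' v' where uv': "u' \<in> Qab" "v' \<in> Qab" "v' \<noteq> 0"
    "u' = mu_fun G Z.K M d' P' (f (w (Z.base_pt j))) ?q y * v'" "?s u' = ?r' * ?s v'"
    by (rule Z.ratio_quotient[OF x Hgal_galQab[OF t] rZ j y(2)])
  have "mu_fun G S.K N d P (f (w (S.base_pt j))) ?q y = mu_fun G Z.K M d' P' (f (w (S.base_pt j))) ?q y"
    using same_mu[OF xH q S.gal_quot_char_act[OF xG Hgal_galQab[OF t] rS j] stab_HN[OF y]] .
  \<comment> \<open>Cross-multiplying eliminates the common value of \<open>mu_fun\<close>, so that
    the automorphism is applied to traces in \<open>Qab\<close> only.\<close>
  then have "u * v' = u' * v" using uv(4) uv'(4) by simp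
  then have "?s u * ?s v' = ?s u' * ?s v"
    using uv uv' by (metis gal_mult[OF sg])
  then have "?r * (?s v * ?s v') = ?r' * (?s v * ?s v')" using uv(5) uv'(5) by (simp add: mult_ac)
  moreover have "?s v \<noteq> 0" "?s v' \<noteq> 0" using uv(3) uv'(3) by (auto simp: gal_eq_0[OF sg])
  ultimately show ?thesis by simp
qed

text \<open>All arguments of the factor sets and of the ratio stabilise both characters, since
  \<open>rel\<close> holds for both triples; on such elements the factor sets agree by (iii) and the
  ratios by \<open>ratio_both\<close>.\<close>

lemma mu_factor_both:
  assumes x: "(f, w) \<in> wreath_sub H (m * k)" and t: "\<tau> \<in> Hgal p" and rS: "S.rel f w \<tau>" and rZ: "Z.rel f w \<tau>"
    and j: "j < m * k" and g: "(g, v) \<in> S.block_stab" "(g, v) \<in> Z.block_stab"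
  shows "S.mu_factor f w \<tau> g v j = Z.mu_factor f w \<tau> g v j"
proof -
  have xG: "(f, w) \<in> wreath_sub (carrier G) (m * k)" using x wreath_sub_H by blast
  have v: "v permutes {..<m * k}" and gj: "g j \<in> S.K" "g j \<in> Z.K"
    using g j by (auto simp: S.block_stab_pair Z.block_stab_pair)
  have vj: "pinv v j < m * k" using v j by simp
  note sS = S.sh_K[OF xG Hgal_galQab[OF t] rS] and sZ = Z.sh_K[OF x Hgal_galQab[OF t] rZ]
  let ?t = "S.sh f w j \<otimes> g j \<otimes> inv (S.sh f w (pinv v j))"
  have tS: "?t \<in> S.K" using S.K_mult S.K_inv sS[OF j] sS[OF vj] gj by blast
  have tZ: "?t \<in> Z.K" using Z.K_mult Z.K_inv sZ[OF j] sZ[OF vj] gj by blast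
  have "\<alpha> ?t (S.sh f w (pinv v j)) = \<alpha>' ?t (S.sh f w (pinv v j))"
    "\<alpha> (S.sh f w j) (g j) = \<alpha>' (S.sh f w j) (g j)"
    using same_fs stab_HN tS tZ sS[OF j] sS[OF vj] sZ[OF j] sZ[OF vj] gj by auto
  then show ?thesis
    unfolding S.mu_factor_def Z.mu_factor_def Let_def
    using ratio_both[OF x t rS rZ j tS tZ] by simp
qed

lemma ge_c_wreath: "ge_c p WG S.T S.BN S.\<theta>t Z.T Z.BN Z.\<theta>t"
proof -
  interpret TS: assoc_rep WG S.block_stab S.BN S.tensor_rep S.tensor_fs "d ^ (m * k)"
    by (rule S.tensor_assoc_rep)
  interpret TZ: assoc_rep WG Z.block_stab Z.BN Z.tensor_rep Z.tensor_fs "d' ^ (m * k)"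
    by (rule Z.tensor_assoc_rep)
  have fs: "S.tensor_fs x y = Z.tensor_fs x y"
    if xy: "x \<in> stab WG Z.T S.BN S.\<theta>t" "y \<in> stab WG Z.T S.BN S.\<theta>t" for x y
  proof -
    obtain f w g v where e: "x = (f, w)" "y = (g, v)" by (cases x, cases y)
    note b = stab_both[OF xy(1)] stab_both[OF xy(2)]
    have "\<alpha> (f i) (g (pinv w i)) = \<alpha>' (f i) (g (pinv w i))" if i: "i < m * k" for i
    proof -
      have "pinv w i < m * k" using b(1) i unfolding e by (auto simp: S.block_stab_pair)
      then have "f i \<in> S.K" "f i \<in> Z.K" "g (pinv w i) \<in> S.K" "g (pinv w i) \<in> Z.K"
        using b i unfolding e S.block_stab_pair Z.block_stab_pair PiE_iff by blast+
      then show ?thesis using same_fs stab_HN by blast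
    qed
    then show ?thesis unfolding S.tensor_fs_def Z.tensor_fs_def e by simp
  qed
  have mu: "mu_fun WG S.block_stab S.BN (d ^ (m * k)) S.tensor_rep h \<tau> y =
      mu_fun WG Z.block_stab Z.BN (d' ^ (m * k)) Z.tensor_rep h \<tau> y"
    if h: "h \<in> Z.T" and t: "\<tau> \<in> Hgal p" and c: "char_act WG S.BN S.\<theta>t h \<tau> = S.\<theta>t"
      and y: "y \<in> stab WG Z.T S.BN S.\<theta>t" for h \<tau> y
  proof -
    obtain f w g v where e: "h = (f, w)" "y = (g, v)" by (cases h, cases y)
    have x: "(f, w) \<in> wreath_sub H (m * k)" using h e T_inter by auto
    then have xG: "(f, w) \<in> wreath_sub (carrier G) (m * k)" using wreath_sub_H by blast
    have rS: "S.rel f w \<tau>" using c S.char_act_wreath[OF xG Hgal_galQab[OF t]] e by simp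
    then have rZ: "Z.rel f w \<tau>" using rel_iff[OF x t] by simp
    have b: "(g, v) \<in> S.block_stab" "(g, v) \<in> Z.block_stab" using stab_both[OF y] e by auto
    show ?thesis
      unfolding e S.mu_fun_formula[OF xG Hgal_galQab[OF t] rS b(1)] Z.mu_fun_formula[OF x Hgal_galQab[OF t] rZ b(2)]
      by (intro prod.cong refl mu_factor_both[OF x t rS rZ _ b]) simp
  qed
  show ?thesis
    unfolding ge_c_def S.stab_T Z.stab_T
  proof (intro conjI exI)
    show "proj_rep WG S.block_stab (d ^ (m * k)) S.tensor_rep S.tensor_fs" by (rule TS.proj_rep)
    show "associated WG S.block_stab S.BN S.\<theta>t (d ^ (m * k)) S.tensor_rep"
      by (rule TS.associated[OF S.afforded_tensor])
    show "entries_in_Qab S.block_stab (d ^ (m * k)) S.tensor_rep" by (rule TS.entries)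
    show "proj_rep WG Z.block_stab (d' ^ (m * k)) Z.tensor_rep Z.tensor_fs" by (rule TZ.proj_rep)
    show "associated WG Z.block_stab Z.BN Z.\<theta>t (d' ^ (m * k)) Z.tensor_rep"
      by (rule TZ.associated[OF Z.afforded_tensor])
    show "entries_in_Qab Z.block_stab (d' ^ (m * k)) Z.tensor_rep" by (rule TZ.entries)
    show "Z.T \<subseteq> S.T" using T_inter by blast
    show "\<forall>h\<in>Z.T. \<forall>\<tau>\<in>Hgal p. char_act WG S.BN S.\<theta>t h \<tau> = S.\<theta>t \<longleftrightarrow> char_act WG Z.BN Z.\<theta>t h \<tau> = Z.\<theta>t"
      using char_act_iff T_inter by blast
  qed (use TS.root TZ.root fs mu S.Htriple_wreath Z.Htriple_wreath T_prod BN_inter centraliser_sub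
      centraliser_scalar in blast)+
qed

end

theorem theorem2p7:
  fixes p :: nat and G :: "('a, 'b) monoid_scheme" and N H M :: "'a set"
    and \<theta> \<phi> :: "'a \<Rightarrow> complex" and k m :: nat and \<sigma> :: "nat \<Rightarrow> complex \<Rightarrow> complex"
  assumes "Factorial_Ring.prime p" and "group G" and "finite (carrier G)"
    and "ge_c p G (carrier G) N \<theta> H M \<phi>"
    and "k > 0" and "m > 0"
    and "\<forall>i<k. \<sigma> i \<in> Hgal p"
    and "\<forall>i<k. \<forall>j<k. i \<noteq> j \<longrightarrow> \<not> (\<exists>g\<in>carrier G.
            char_act G N (char_act G N \<theta> \<one>\<^bsub>G\<^esub> (\<sigma> i)) g id = char_act G N \<theta> \<one>\<^bsub>G\<^esub> (\<sigma> j))"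
  shows "ge_c p (wreath G (m * k))
     (stab_orb p (wreath G (m * k)) (carrier (wreath G (m * k))) (base_sub N (m * k))
        (prod_char N m k (\<lambda>i. char_act G N \<theta> \<one>\<^bsub>G\<^esub> (\<sigma> i))))
     (base_sub N (m * k))
     (prod_char N m k (\<lambda>i. char_act G N \<theta> \<one>\<^bsub>G\<^esub> (\<sigma> i)))
     (stab_orb p (wreath G (m * k)) (wreath_sub H (m * k)) (base_sub M (m * k))
        (prod_char M m k (\<lambda>i. char_act G M \<phi> \<one>\<^bsub>G\<^esub> (\<sigma> i))))
     (base_sub M (m * k))
     (prod_char M m k (\<lambda>i. char_act G M \<phi> \<one>\<^bsub>G\<^esub> (\<sigma> i)))"
proof -
  interpret group G by fact
  note p = assms(1)
  from assms(4) obtain d P \<alpha> d' P' \<alpha>' where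
    tG: "Htriple p G (carrier G) N \<theta>" and tH: "Htriple p G H M \<phi>"
    and i: "carrier G = N <#>\<^bsub>G\<^esub> H" "N \<inter> H = M" "centraliser G (carrier G) N \<subseteq> H"
    and ii: "\<forall>h\<in>H. \<forall>\<sigma>\<in>Hgal p. char_act G N \<theta> h \<sigma> = \<theta> \<longleftrightarrow> char_act G M \<phi> h \<sigma> = \<phi>"
    and P: "proj_rep G (stab G (carrier G) N \<theta>) d P \<alpha>" "associated G (stab G (carrier G) N \<theta>) N \<theta> d P"
      "entries_in_Qab (stab G (carrier G) N \<theta>) d P"
    and P': "proj_rep G (stab G H M \<phi>) d' P' \<alpha>'" "associated G (stab G H M \<phi>) M \<phi> d' P'"
      "entries_in_Qab (stab G H M \<phi>) d' P'"
    and root: "\<forall>x\<in>stab G (carrier G) N \<theta>. \<forall>y\<in>stab G (carrier G) N \<theta>. root_of_unity (\<alpha> x y)"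
      "\<forall>x\<in>stab G H M \<phi>. \<forall>y\<in>stab G H M \<phi>. root_of_unity (\<alpha>' x y)"
    and fs: "\<forall>x\<in>stab G H N \<theta>. \<forall>y\<in>stab G H N \<theta>. \<alpha> x y = \<alpha>' x y"
    and sc: "\<forall>c\<in>centraliser G (carrier G) N. \<exists>s. P c = s \<cdot>\<^sub>m 1\<^sub>m d \<and> P' c = s \<cdot>\<^sub>m 1\<^sub>m d'"
    and mu: "\<forall>h\<in>H. \<forall>\<sigma>\<in>Hgal p. char_act G N \<theta> h \<sigma> = \<theta> \<longrightarrow>
      (\<forall>y\<in>stab G H N \<theta>. mu_fun G (stab G (carrier G) N \<theta>) N d P h \<sigma> y = mu_fun G (stab G H M \<phi>) M d' P' h \<sigma> y)"
    unfolding ge_c_def by (elim conjE exE) (rule that)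
  note aG = Htriple_assoc_rep[OF p assms(3) tG P root(1)]
  note aH = Htriple_assoc_rep[OF p assms(3) tH P' root(2)]
  have sig: "\<And>i. i < k \<Longrightarrow> \<sigma> i \<in> Hgal p" using assms(7) by blast
  have ncG: "i = j" if ij: "i < k" "j < k" and g: "g \<in> carrier G"
    and eq: "\<And>x. x \<in> N \<Longrightarrow> \<sigma> i (\<theta> (cj g x)) = \<sigma> j (\<theta> x)" for i j g
  proof (rule ccontr)
    assume "i \<noteq> j"
    have "char_act G N (char_act G N \<theta> \<one>\<^bsub>G\<^esub> (\<sigma> i)) g id = char_act G N \<theta> \<one>\<^bsub>G\<^esub> (\<sigma> j)"
    proof
      fix x
      show "char_act G N (char_act G N \<theta> \<one>\<^bsub>G\<^esub> (\<sigma> i)) g id x = char_act G N \<theta> \<one>\<^bsub>G\<^esub> (\<sigma> j) x"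
      proof (cases "x \<in> N")
        case True
        then have "cj g x \<in> N" "x \<in> carrier G" using aG(5)[OF g] aG(4) by auto
        then show ?thesis using True eq[OF True] aG(4) g by (auto simp: char_act_def)
      qed (simp add: char_act_def)
    qed
    then show False using assms(8) ij g \<open>i \<noteq> j\<close> by blast
  qed
  \<comment> \<open>An \<open>H\<close>-conjugacy between twists of \<open>\<phi>\<close> is an
    invariance of \<open>\<phi>\<close> under
    \<open>inv_into UNIV (\<sigma> j) \<circ> \<sigma> i\<close>. Condition (ii) transfers it to
    \<open>\<theta>\<close>, where the twists are assumed not to be conjugate.\<close>
  have ncH: "i = j" if ij: "i < k" "j < k" and g: "g \<in> H"
    and eq: "\<And>x. x \<in> M \<Longrightarrow> \<sigma> i (\<phi> (cj g x)) = \<sigma> j (\<phi> x)" for i j g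
  proof -
    let ?r = "inv_into UNIV (\<sigma> j) \<circ> \<sigma> i"
    have r: "?r \<in> Hgal p" using Hgal_comp[OF p Hgal_inv[OF p sig[OF ij(2)]] sig[OF ij(1)]] .
    have b: "inv_into UNIV (\<sigma> j) a = c \<longleftrightarrow> a = \<sigma> j c" for a c
      using galQab_bij[OF Hgal_galQab[OF sig[OF ij(2)]]] by (metis bij_inv_eq_iff)
    have "char_act G M \<phi> g ?r = \<phi>" using eq by (subst char_act_eq_iff[OF aH(6)]) (simp_all add: b)
    then have "char_act G N \<theta> g ?r = \<theta>" using ii g r by blast
    then have *: "\<forall>x\<in>N. ?r (\<theta> (cj g x)) = \<theta> x" by (subst (asm) char_act_eq_iff[OF aG(6)])
    show ?thesis
      by (rule ncG[OF ij subgroup.mem_carrier[OF aH(2) g]]) (use * in \<open>simp add: b\<close>)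
  qed
  interpret S: wreath_triple G p "carrier G" N \<theta> P \<alpha> d \<sigma> m k
    by (intro wreath_triple.intro wreath_triple_axioms.intro)
      (fact p is_group aG(1) aG(2) aG(4) aG(5) aG(7) assms(5) assms(6) sig | rule ncG; assumption)+
  interpret Z: wreath_triple G p H M \<phi> P' \<alpha>' d' \<sigma> m k
    by (intro wreath_triple.intro wreath_triple_axioms.intro)
      (fact p is_group aH(1) aH(2) aH(4) aH(5) aH(7) assms(5) assms(6) sig | rule ncH; assumption)+
  interpret wreath_triple_pair G p N \<theta> P \<alpha> d \<sigma> m k H M \<phi> P' \<alpha>' d'
    by (intro wreath_triple_pair.intro wreath_triple_pair_axioms.intro S.wreath_triple_axioms Z.wreath_triple_axioms i)
      (rule ii[THEN bspec, THEN bspec] fs[THEN bspec, THEN bspec] sc[THEN bspec]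
        mu[THEN bspec, THEN bspec, THEN mp, THEN bspec]; assumption)+
  have "carrier (wreath G (m * k)) = wreath_sub (carrier G) (m * k)"
    by (simp add: wreath_def wreath_sub_def case_prod_unfold)
  then show ?thesis using ge_c_wreath unfolding S.T_def Z.T_def S.\<theta>t_def Z.\<theta>t_def by simp
qed

end
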